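(* Let $N\ge2$, $R>0$, and let $f:[0,\infty)\to[0,\infty)$ satisfy $(f_1)$, $(f_2)$, $(f_3)$ (listed in the context). Suppose $f$ is super-exponential. Fix $\kappa\ge0$ such that $F(t):=f(t)+\kappa t^{N-1}$ is strictly increasing on $[0,\infty)$. Assume that there is $c>0$ such that $(f(t))^\lambda\le c\,f(\lambda t)$ for all $\lambda>1$ and $t\ge0$. Let $u$ be an unbounded solution of $(P_R^* )$. Then one of the following alternatives holds: (i) $\displaystyle\lim_{x\to0}\frac{u(x)}{F^{-1}(|x|^{-N})}=1$; or (ii) there is $c_*$ with $0<c_*<1$ such that for every $a\in(c_*,1)$ the graph of $u$ crosses the graph of the function $x\mapsto aF^{-1}(|x|^{-N})$ infinitely often in $B_R$.
   Context: $B_R\subset\mathbb R^N$ is the open ball of radius $R$ centred at $0$; $\Delta_N u=\operatorname{div}(|\nabla u|^{N-2}\nabla u)$. $L^\infty_{\rm loc}(\overline B_R\setminus\{0\})$ denotes functions essentially bounded on compact subsets of $\overline B_R\setminus\{0\}$. Standing assumptions on $f$: $(f_1)$ $f$ is locally Hölder continuous on $[0,\infty)$ with some exponent $\theta\in(0,1)$; $(f_2)$ $\liminf_{t\to\infty}f(t)t^{1-N}>0$; $(f_3)$ there is $\kappa>0$ such that $t\mapsto f(t)+\kappa t^{N-1}$ is non-decreasing on $[0,\infty)$. $f$ is sub-exponential if there is $\beta>0$ with $\sup_{t\ge0}f(t)e^{-\beta t}<\infty$; it is super-exponential if it is not sub-exponential. A solution of $(P_R^* )$ is a radial function $u\ge0$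 on $B_R\setminus\{0\}$, $u\in L^\infty_{\rm loc}(\overline B_R\setminus\{0\})$, weakly differentiable with $|\nabla u|\in L^{N-1}_{\rm loc}(B_R\setminus\{0\})$, with $-\Delta_N u=f(u)$ in $\mathcal D'(B_R\setminus\{0\})$, i.e. $\int|\nabla u|^{N-2}\nabla u\cdot\nabla\phi\,dx=\int f(u)\phi\,dx$ for all $\phi\in C_0^\infty(B_R\setminus\{0\})$; $u$ is identified with its continuous representative. $F^{-1}$ is the inverse function of $F$, defined on $[F(0),\infty)$, so that $F^{-1}(|x|^{-N})$ makes sense for small $|x|$. "Crosses infinitely often" means that, as a function of $r=|x|$, the difference $u-aF^{-1}(r^{-N})$ changes sign infinitely many times. (It is known, by Brezis–Lions for $N=2$ and Véron for $N>2$, that every solution $u$ of $(P^*_R)$ lies in $W^{1,p}(B_R)$ for all $1\le p<N$, has $f(u)\in L^1(B_R)$, and satisfies $-\Delta_Nu=f(u)+\alpha\delta_0$ in $\mathcal D'(B_R)$ for some $\alpha\ge0$.) *)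

theory Defs
  imports "HOL-Analysis.Analysis"
begin

definition gradient :: "(real^'n \<Rightarrow> real) \<Rightarrow> real^'n \<Rightarrow> real^'n" where
  "gradient \<phi> x = (\<chi> i. frechet_derivative \<phi> (at x) (axis i 1))"

primrec continuously_diff :: "nat \<Rightarrow> (real^'n \<Rightarrow> real) \<Rightarrow> bool" where
  "continuously_diff 0 \<phi> \<longleftrightarrow> continuous_on UNIV \<phi>"
| "continuously_diff (Suc k) \<phi> \<longleftrightarrow>
     \<phi> differentiable_on UNIV \<and> (\<forall>i. continuously_diff k (\<lambda>x. gradient \<phi> x $ i))"

text \<open>\<open>C\<^sub>0\<^sup>\<infinity>(\<Omega>)\<close>; test functions are extended by zero to the whole space.\<close>

definition test_function :: "(real^'n) set \<Rightarrow> (real^'n \<Rightarrow> real) \<Rightarrow> bool" where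
  "test_function \<Omega> \<phi> \<longleftrightarrow> (\<forall>k. continuously_diff k \<phi>) \<and>
     compact (closure {x. \<phi> x \<noteq> 0}) \<and> closure {x. \<phi> x \<noteq> 0} \<subseteq> \<Omega>"

definition locally_integrable :: "(real^'n) set \<Rightarrow> (real^'n \<Rightarrow> 'b::euclidean_space) \<Rightarrow> bool" where
  "locally_integrable \<Omega> g \<longleftrightarrow> (\<forall>K. compact K \<and> K \<subseteq> \<Omega> \<longrightarrow> g absolutely_integrable_on K)"

definition locally_ess_bounded :: "(real^'n) set \<Rightarrow> (real^'n \<Rightarrow> real) \<Rightarrow> bool" where
  "locally_ess_bounded S u \<longleftrightarrow>
     (\<forall>K. compact K \<and> K \<subseteq> S \<longrightarrow> (\<exists>M. AE x in lebesgue. x \<in> K \<longrightarrow> \<bar>u x\<bar> \<le> M))"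

definition has_weak_gradient ::
    "(real^'n) set \<Rightarrow> (real^'n \<Rightarrow> real) \<Rightarrow> (real^'n \<Rightarrow> real^'n) \<Rightarrow> bool" where
  "has_weak_gradient \<Omega> u g \<longleftrightarrow> locally_integrable \<Omega> u \<and> locally_integrable \<Omega> g \<and>
     (\<forall>\<phi>. test_function \<Omega> \<phi> \<longrightarrow>
        (LINT x:\<Omega>|lebesgue. u x *\<^sub>R gradient \<phi> x) = - (LINT x:\<Omega>|lebesgue. \<phi> x *\<^sub>R g x))"

definition radial_on :: "(real^'n) set \<Rightarrow> (real^'n \<Rightarrow> real) \<Rightarrow> bool" where
  "radial_on \<Omega> u \<longleftrightarrow> (\<forall>x\<in>\<Omega>. \<forall>y\<in>\<Omega>. norm x = norm y \<longrightarrow> u x = u y)"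

text \<open>
  Solutions of \<open>-\<Delta>\<^sub>N u = f(u)\<close> in the sense of distributions on the punctured ball, where
  \<open>N = CARD('n)\<close>. A solution is identified with its continuous representative, hence the
  continuity clause; only the values of \<open>u\<close> on the punctured ball matter.
\<close>

definition solution :: "(real \<Rightarrow> real) \<Rightarrow> real \<Rightarrow> (real^'n \<Rightarrow> real) \<Rightarrow> bool" where
  "solution f R u \<longleftrightarrow>
     (let \<Omega> = ball 0 R - {0}; N = CARD('n) in
        continuous_on \<Omega> u \<and> radial_on \<Omega> u \<and> (\<forall>x\<in>\<Omega>. 0 \<le> u x) \<and>
        locally_ess_bounded (cball 0 R - {0}) u \<and>
        (\<exists>g. has_weak_gradient \<Omega> u g \<and>
             locally_integrable \<Omega> (\<lambda>x. norm (g x) ^ (N - 1)) \<and>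
             (\<forall>\<phi>. test_function \<Omega> \<phi> \<longrightarrow>
                (LINT x:\<Omega>|lebesgue. norm (g x) ^ (N - 2) * (g x \<bullet> gradient \<phi> x)) =
                (LINT x:\<Omega>|lebesgue. f (u x) * \<phi> x))))"

text \<open>
  The nonlinearity is a total function of which only the restriction to \<open>[0,\<infinity>)\<close> is relevant.
\<close>

definition locally_Hoelder :: "(real \<Rightarrow> real) \<Rightarrow> bool" where
  "locally_Hoelder f \<longleftrightarrow>
     (\<exists>\<theta>. 0 < \<theta> \<and> \<theta> < 1 \<and>
        (\<forall>K. compact K \<and> K \<subseteq> {0..} \<longrightarrow>
           (\<exists>C. \<forall>s\<in>K. \<forall>t\<in>K. \<bar>f s - f t\<bar> \<le> C * \<bar>s - t\<bar> powr \<theta>)))"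

definition sub_exponential :: "(real \<Rightarrow> real) \<Rightarrow> bool" where
  "sub_exponential f \<longleftrightarrow> (\<exists>\<beta>>0. bdd_above ((\<lambda>t. f t * exp (- \<beta> * t)) ` {0..}))"

definition super_exponential :: "(real \<Rightarrow> real) \<Rightarrow> bool" where
  "super_exponential f \<longleftrightarrow> \<not> sub_exponential f"

text \<open>Infinitely many sign changes: arbitrarily long finite chains of alternating sign.\<close>

definition changes_sign_infinitely_often :: "real set \<Rightarrow> (real \<Rightarrow> real) \<Rightarrow> bool" where
  "changes_sign_infinitely_often I d \<longleftrightarrow>
     (\<forall>n::nat. \<exists>r::nat \<Rightarrow> real. strict_mono_on {..n} r \<and> r ` {..n} \<subseteq> I \<and>
        (\<forall>i<n. d (r i) * d (r (Suc i)) < 0))"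

text \<open>
  Crossing of the graphs of a radial function \<open>u\<close> and of \<open>x \<mapsto> h |x|\<close>, for radii in \<open>I\<close>.
  The difference is read as a function of the radius along a ray; for radial \<open>u\<close> the choice of
  the unit vector \<open>e\<close> is immaterial.
\<close>

definition crosses_infinitely_often ::
    "real set \<Rightarrow> (real^'n \<Rightarrow> real) \<Rightarrow> (real \<Rightarrow> real) \<Rightarrow> bool" where
  "crosses_infinitely_often I u h \<longleftrightarrow>
     (\<forall>e. norm e = 1 \<longrightarrow> changes_sign_infinitely_often I (\<lambda>r. u (r *\<^sub>R e) - h r))"

text \<open>The radii in \<open>(0,R)\<close> for which \<open>r\<^sup>-\<^sup>N\<close> lies in the domain \<open>[F(0),\<infinity>)\<close> of the inverse of \<open>F\<close>.\<close>

definition admissible_radii :: "nat \<Rightarrow> real \<Rightarrow> (real \<Rightarrow> real) \<Rightarrow> real set" where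
  "admissible_radii N R F = {r. 0 < r \<and> r < R \<and> F 0 \<le> r powr - real N}"

end

theory Submission
  imports Defs
begin

text \<open>
  In the variable \<open>t = - ln |x|\<close> a radial solution \<open>v(t) = u(x)\<close> satisfies
  \<open>(|v'|\<^sup>N\<^sup>-\<^sup>2 v')' = - exp (- N t) f(v)\<close>, so it is concave, nondecreasing and tends to infinity. The power
  inequality makes \<open>f\<close> grow faster than every exponential, which forces \<open>v' \<rightarrow> 0\<close>. Integrating the
  equation over \<open>[t, t + 1]\<close> gives \<open>F(v(t)) \<le> exp (N t)\<close> for large \<open>t\<close>, i.e. the quotient
  \<open>u / F\<^sup>-\<^sup>1(|x|\<^sup>-\<^sup>N)\<close> is at most 1 near the origin. If this quotient were eventually at most
  some \<open>a < 1\<close>, the power inequality would give \<open>f(v) \<le> C exp (a N t)\<close>, hence exponential decay of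
  \<open>v'\<close> and boundedness of \<open>v\<close>. So its limit superior is 1; either it converges, or it crosses every
  level between its limit inferior and 1 infinitely often.

  The passage from the distributional equation to the ordinary differential equation uses the
  uniqueness of weak gradients: for a radial function the weak gradient is almost everywhere
  \<open>U'(|x|) x / |x|\<close> with \<open>U\<close> absolutely continuous, and testing with radial functions yields the
  equation for \<open>r\<^sup>N\<^sup>-\<^sup>1 |U'|\<^sup>N\<^sup>-\<^sup>2 U'\<close>, which is therefore continuously differentiable.
\<close>

section \<open>Smooth functions of one real variable\<close>

text \<open>The weak gradient is only locally integrable and not known to be radial, so every
  classical fact about \<open>u\<close> must be extracted from test functions. These need
  derivatives of every order, hence the syntactic classes closed under differentiation. The lemma of
  du Bois-Reymond enters three times, each time turning a weak derivative into a primitive: for the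
  profile \<open>U\<close>, for the radial densities of a test function, and for the flux.

  In the asymptotic part the power inequality has two uses. With \<lambda> = x / t0 it propagates
  one large value of f to all larger arguments, which gives growth beyond every exponential. With
  \<lambda> = 1 / a it turns F(v / a) \<le> exp(N t), that is v \<le> a G with F(G) = exp(N t), into
  f(v) \<le> c^a exp(a N t); the exponent gained, N (1 - a), is the decay rate of the flux. Passing
  between f and F costs at most a factor 2 for large arguments, because f eventually exceeds exp and
  hence the added power.\<close>

definition smooth_real :: "(real \<Rightarrow> real) \<Rightarrow> bool" where
  "smooth_real \<theta> \<longleftrightarrow>
     (\<exists>D. D 0 = \<theta> \<and> (\<forall>n t. (D n has_real_derivative D (Suc n) t) (at t)))"

text \<open>Choosing for each member of \<open>S\<close> a derivative that is again in
  \<open>S\<close>, and iterating the choice from \<theta>, produces the whole sequence of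
  derivatives at once.\<close>

lemma smooth_real_coinduct:
  assumes "\<theta> \<in> S" and "\<And>h. h \<in> S \<Longrightarrow> \<exists>h'\<in>S. \<forall>t. (h has_real_derivative h' t) (at t)"
  shows "smooth_real \<theta>"
proof -
  obtain d where d: "\<And>h. h \<in> S \<Longrightarrow> d h \<in> S \<and> (\<forall>t. (h has_real_derivative d h t) (at t))"
    using assms(2) by metis
  define D where "D = (\<lambda>n. (d ^^ n) \<theta>)"
  have "D n \<in> S" for n
    by (induction n) (auto simp: D_def assms(1) d)
  then have "D 0 = \<theta> \<and> (\<forall>n t. (D n has_real_derivative D (Suc n) t) (at t))"
    using d by (simp add: D_def)
  then show ?thesis unfolding smooth_real_def by blast
qed

lemma smooth_real_derivative:
  assumes "smooth_real \<theta>"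
  obtains \<theta>' where "smooth_real \<theta>'" "\<And>t. (\<theta> has_real_derivative \<theta>' t) (at t)"
proof -
  obtain D where D: "D 0 = \<theta>" "\<And>n t. (D n has_real_derivative D (Suc n) t) (at t)"
    using assms unfolding smooth_real_def by blast
  have "smooth_real (D 1)"
    unfolding smooth_real_def
    by (rule exI[of _ "\<lambda>n. D (Suc n)"]) (simp add: D(2))
  then show ?thesis using that D(2)[of 0] D(1) by auto
qed

lemma smooth_realI:
  assumes "smooth_real \<theta>'" "\<And>t. (\<theta> has_real_derivative \<theta>' t) (at t)"
  shows "smooth_real \<theta>"
proof (rule smooth_real_coinduct[of _ "insert \<theta> (Collect smooth_real)"])
  show "\<exists>h'\<in>insert \<theta> (Collect smooth_real). \<forall>t. (h has_real_derivative h' t) (at t)"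
    if "h \<in> insert \<theta> (Collect smooth_real)" for h
    using that assms by (auto elim: smooth_real_derivative)
qed simp

lemma smooth_real_continuous: "smooth_real \<theta> \<Longrightarrow> continuous_on A \<theta>"
  by (meson DERIV_continuous continuous_at_imp_continuous_on smooth_real_derivative)

text \<open>
  Closing the smooth functions under the algebraic operations and showing that the closure is
  stable under derivatives reduces all closure properties to one coinduction.
\<close>

inductive_set smooth_alg :: "(real \<Rightarrow> real) set" where
  base: "smooth_real \<theta> \<Longrightarrow> \<theta> \<in> smooth_alg"
| const: "(\<lambda>_. c) \<in> smooth_alg"
| ident: "(\<lambda>t. t) \<in> smooth_alg"
| add: "f \<in> smooth_alg \<Longrightarrow> g \<in> smooth_alg \<Longrightarrow> (\<lambda>t. f t + g t) \<in> smooth_alg"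
| mult: "f \<in> smooth_alg \<Longrightarrow> g \<in> smooth_alg \<Longrightarrow> (\<lambda>t. f t * g t) \<in> smooth_alg"
| comp: "smooth_real \<theta> \<Longrightarrow> g \<in> smooth_alg \<Longrightarrow> (\<lambda>t. \<theta> (g t)) \<in> smooth_alg"

lemma smooth_alg_derivative:
  "h \<in> smooth_alg \<Longrightarrow> \<exists>h'\<in>smooth_alg. \<forall>t. (h has_real_derivative h' t) (at t)"
proof (induction rule: smooth_alg.induct)
  case (base \<theta>)
  then show ?case by (metis smooth_alg.base smooth_real_derivative)
next
  case (const c)
  show ?case by (rule bexI[OF _ smooth_alg.const[of 0]]) simp
next
  case ident
  show ?case by (rule bexI[OF _ smooth_alg.const[of 1]]) simp
next
  case (add f g)
  then obtain f' g' where *: "f' \<in> smooth_alg" "g' \<in> smooth_alg"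
    "\<And>t. (f has_real_derivative f' t) (at t)" "\<And>t. (g has_real_derivative g' t) (at t)" by blast
  show ?case
    by (rule bexI[OF _ smooth_alg.add[OF *(1,2)]]) (intro allI DERIV_add *)
next
  case (mult f g)
  then obtain f' g' where *: "f' \<in> smooth_alg" "g' \<in> smooth_alg"
    "\<And>t. (f has_real_derivative f' t) (at t)" "\<And>t. (g has_real_derivative g' t) (at t)" by blast
  show ?case
    by (rule bexI[OF _ smooth_alg.add[OF smooth_alg.mult[OF *(1) mult(2)] smooth_alg.mult[OF *(2) mult(1)]]])
      (intro allI DERIV_mult *)
next
  case (comp \<theta> g)
  then obtain g' where *: "g' \<in> smooth_alg" "\<And>t. (g has_real_derivative g' t) (at t)" by blast
  obtain \<theta>' where \<theta>': "smooth_real \<theta>'" "\<And>t. (\<theta> has_real_derivative \<theta>' t) (at t)"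
    using comp smooth_real_derivative by metis
  show ?case
    by (rule bexI[OF _ smooth_alg.mult[OF smooth_alg.comp[OF \<theta>'(1) comp(2)] *(1)]])
      (intro allI DERIV_chain2 \<theta>' *)
qed

lemma smooth_alg_eq: "h \<in> smooth_alg \<longleftrightarrow> smooth_real h"
  using smooth_real_coinduct[of h smooth_alg] smooth_alg_derivative smooth_alg.base by blast

lemma smooth_real_const: "smooth_real (\<lambda>_. c)"
  and smooth_real_ident: "smooth_real (\<lambda>t. t)"
  and smooth_real_add: "smooth_real f \<Longrightarrow> smooth_real g \<Longrightarrow> smooth_real (\<lambda>t. f t + g t)"
  and smooth_real_mult: "smooth_real f \<Longrightarrow> smooth_real g \<Longrightarrow> smooth_real (\<lambda>t. f t * g t)"
  and smooth_real_comp: "smooth_real f \<Longrightarrow> smooth_real g \<Longrightarrow> smooth_real (\<lambda>t. f (g t))"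
  using smooth_alg.intros unfolding smooth_alg_eq by auto

lemma smooth_real_diff: "smooth_real f \<Longrightarrow> smooth_real g \<Longrightarrow> smooth_real (\<lambda>t. f t - g t)"
  using smooth_real_add[of f "\<lambda>t. - 1 * g t"] smooth_real_mult[OF smooth_real_const, of g "-1"] by simp

lemma smooth_real_exp: "smooth_real exp"
  by (rule smooth_real_coinduct[of _ "{exp}"]) (auto intro: DERIV_exp)

section \<open>Flat functions and bumps\<close>

definition flat :: "real \<Rightarrow> real" where
  "flat t = (if t > 0 then exp (- (1 / t)) else 0)"

lemma poly_exp_limit: "((\<lambda>h. poly p (1 / h) * exp (- (1 / h))) \<longlongrightarrow> (0::real)) (at_right 0)"
proof -
  have "((\<lambda>s. poly p s * exp (- s)) \<longlongrightarrow> (0::real)) at_top"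
  proof -
    have "((\<lambda>s. \<Sum>i\<le>degree p. coeff p i * (s ^ i / exp s)) \<longlongrightarrow> (\<Sum>i\<le>degree p. coeff p i * 0)) at_top"
      by (intro tendsto_sum tendsto_mult tendsto_const tendsto_power_div_exp_0)
    then show ?thesis
      by (simp add: poly_altdef sum_distrib_right exp_minus field_simps sum_divide_distrib)
  qed
  then show ?thesis
    using filterlim_compose[OF _ filterlim_inverse_at_top_right] by (auto simp: inverse_eq_divide)
qed

text \<open>The functions p(1/t) exp(-1/t), extended by zero, form a family stable under
  differentiation: with s = 1/t one has ds/dt = -s^2, so the polynomial p is replaced by s^2 (p -
  p'). The case p = 1 is \<open>flat\<close>.\<close>

lemma smooth_real_flat: "smooth_real flat"
proof -
  define G where "G p = (\<lambda>t::real. if t > 0 then poly p (1 / t) * exp (- (1 / t)) else 0)" for p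
  have deriv: "(G p has_real_derivative G (pCons 0 (pCons 0 (p - pderiv p))) t) (at t)" for p t
  proof -
    consider "t > 0" | "t < 0" | "t = 0" by linarith
    then show ?thesis
    proof cases
      case 1
      have "((\<lambda>t. poly p (1 / t) * exp (- (1 / t))) has_real_derivative
          G (pCons 0 (pCons 0 (p - pderiv p))) t) (at t)"
        using 1 by (auto intro!: derivative_eq_intros DERIV_chain2[OF poly_DERIV]
            simp: G_def field_simps power2_eq_square)
      moreover have "\<forall>\<^sub>F s in nhds t. poly p (1 / s) * exp (- (1 / s)) = G p s"
        using eventually_nhds_in_open[of "{0<..}" t] 1 by (auto simp: G_def elim!: eventually_mono)
      ultimately show ?thesis by (simp add: DERIV_cong_ev)
    next
      case 2
      have "\<forall>\<^sub>F s in nhds t. 0 = G p s"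
        using eventually_nhds_in_open[of "{..<0}" t] 2 by (auto simp: G_def elim!: eventually_mono)
      moreover have "((\<lambda>t. 0) has_real_derivative G (pCons 0 (pCons 0 (p - pderiv p))) t) (at t)"
        using 2 by (auto simp: G_def)
      ultimately show ?thesis using DERIV_cong_ev by force
    next
      case 3
      \<comment> \<open>The factor 1/h of the difference quotient raises the degree of the
        polynomial by one, so the limit is again that of a polynomial against the
        exponential.\<close>
      have "((\<lambda>h. (G p h - G p 0) / h) \<longlongrightarrow> 0) (at_right 0)"
      proof (rule Lim_transform_eventually[OF poly_exp_limit[of "pCons 0 p"]])
        show "\<forall>\<^sub>F h in at_right 0. poly (pCons 0 p) (1 / h) * exp (- (1 / h)) = (G p h - G p 0) / h"
          using eventually_at_right_less[of 0] by eventually_elim (simp add: G_def)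
      qed
      moreover have "((\<lambda>h. (G p h - G p 0) / h) \<longlongrightarrow> 0) (at_left 0)"
      proof (rule Lim_transform_eventually[OF tendsto_const])
        show "\<forall>\<^sub>F h in at_left 0. 0 = (G p h - G p 0) / h"
          by (auto simp: eventually_at_filter G_def)
      qed
      ultimately have "((\<lambda>h. (G p h - G p 0) / h) \<longlongrightarrow> 0) (at 0)"
        by (simp add: filterlim_split_at)
      then show ?thesis using 3 by (simp add: G_def has_field_derivative_iff)
    qed
  qed
  have "smooth_real (G 1)"
    by (rule smooth_real_coinduct[of _ "range G"]) (use deriv in auto)
  moreover have "G 1 = flat" by (auto simp: G_def flat_def)
  ultimately show ?thesis by simp
qed

lemma flat_nonneg: "0 \<le> flat t" and flat_eq_0_iff: "flat t = 0 \<longleftrightarrow> t \<le> 0"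
  by (auto simp: flat_def)

definition bump :: "real \<Rightarrow> real \<Rightarrow> real \<Rightarrow> real" where
  "bump a b t = flat (t - a) * flat (b - t)"

lemma smooth_real_bump: "smooth_real (bump a b)"
  unfolding bump_def[abs_def]
  by (intro smooth_real_mult smooth_real_comp[OF smooth_real_flat] smooth_real_diff
      smooth_real_ident smooth_real_const)

lemma bump_nonneg: "0 \<le> bump a b t" and bump_eq_0_iff: "bump a b t = 0 \<longleftrightarrow> t \<notin> {a<..<b}"
  by (auto simp: bump_def flat_nonneg flat_eq_0_iff)

lemma smooth_real_one_minus_exp: "smooth_real (\<lambda>t. 1 - exp (- real n * t))"
  by (intro smooth_real_diff smooth_real_comp[OF smooth_real_exp] smooth_real_mult
      smooth_real_ident smooth_real_const)

lemma derivative_zero_on_open: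
  assumes "open A" "t \<in> A" "\<And>s. s \<in> A \<Longrightarrow> \<theta> s = 0" "(\<theta> has_real_derivative d) (at t)"
  shows "d = 0"
proof -
  have ev: "\<forall>\<^sub>F s in nhds t. \<theta> s = 0"
    using eventually_nhds_in_open[OF assms(1,2)] assms(3) by (auto elim!: eventually_mono)
  have "((\<lambda>_. 0) has_real_derivative d) (at t)"
    using assms(4) DERIV_cong_ev[OF refl ev refl] by simp
  from DERIV_unique[OF this DERIV_const] show ?thesis .
qed

text \<open>A radial function is treated as a function of |x|^2, which is a polynomial in the
  coordinates. The square root this introduces is harmless because \<theta> vanishes up to \<delta>
  > 0. Differentiation yields terms of the same shape, \<theta>'/2 with exponent p - 1/2 and p
  \<theta> with exponent p - 1, so finite sums of such terms, encoded as lists in \<open>H\<close>,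
  serve as the coinduction set.\<close>

lemma smooth_real_comp_sqrt:
  assumes "smooth_real \<theta>" and \<delta>: "\<delta> > 0" and "\<And>t. t \<le> \<delta> \<Longrightarrow> \<theta> t = 0"
  shows "smooth_real (\<lambda>t. \<theta> (sqrt t) * t powr p)"
proof -
  define S where "S = {\<theta>. smooth_real \<theta> \<and> (\<forall>t\<le>\<delta>. \<theta> t = 0)}"
  define H where "H = (\<lambda>(L::((real \<Rightarrow> real) \<times> real) list) t. \<Sum>(\<theta>,p)\<leftarrow>L. \<theta> (sqrt t) * t powr p)"
  have step: "\<exists>\<theta>'\<in>S. \<forall>t. ((\<lambda>t. \<theta> (sqrt t) * t powr p) has_real_derivative
      H [(\<theta>', p - 1 / 2), (\<lambda>t. p * \<theta> t, p - 1)] t) (at t)" if "\<theta> \<in> S" for \<theta> p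
  proof -
    have "smooth_real \<theta>" using that by (simp add: S_def)
    then obtain \<theta>' where \<theta>': "smooth_real \<theta>'" "\<And>t. (\<theta> has_real_derivative \<theta>' t) (at t)"
      using smooth_real_derivative by metis
    have vanish: "\<theta>' t = 0" if "t \<le> \<delta>" for t
    proof -
      have z: "\<theta>' t = 0" if "t < \<delta>" for t
        by (rule derivative_zero_on_open[of "{..<\<delta>}" t \<theta>])
           (use that \<open>\<theta> \<in> S\<close> \<theta>'(2) in \<open>auto simp: S_def\<close>)
      \<comment> \<open>At \<delta> itself \<theta> is known to vanish only on the left, so the
        derivative is identified by continuity of \<theta>'.\<close>
      have "\<theta>' \<delta> = 0"
      proof (rule tendsto_unique[of "at_left \<delta>" \<theta>'])
        show "(\<theta>' \<longlongrightarrow> \<theta>' \<delta>) (at_left \<delta>)"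
          using smooth_real_continuous[OF \<theta>'(1), of UNIV]
          by (simp add: continuous_on_def filterlim_at_split)
        show "(\<theta>' \<longlongrightarrow> 0) (at_left \<delta>)"
          by (rule Lim_transform_eventually[OF tendsto_const])
             (use z in \<open>auto simp: eventually_at_filter\<close>)
      qed simp
      with z that show ?thesis by (cases "t = \<delta>") auto
    qed
    have "smooth_real (\<lambda>t. \<theta>' t / 2)"
      using smooth_real_mult[OF smooth_real_const[of "1/2"] \<theta>'(1)] by simp
    then have 1: "(\<lambda>t. \<theta>' t / 2) \<in> S" using vanish by (simp add: S_def)
    have "((\<lambda>t. \<theta> (sqrt t) * t powr p) has_real_derivative
        H [(\<lambda>t. \<theta>' t / 2, p - 1 / 2), (\<lambda>t. p * \<theta> t, p - 1)] t) (at t)" for t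
    proof (cases "t > 0")
      case True
      have e: "t powr (p - 1 / 2) = t powr p / sqrt t"
        using True by (simp add: powr_diff powr_half_sqrt)
      have "((\<lambda>t. \<theta> (sqrt t) * t powr p) has_real_derivative
          \<theta>' (sqrt t) * (inverse (sqrt t) / 2) * t powr p + p * t powr (p - 1) * \<theta> (sqrt t)) (at t)"
        by (intro DERIV_mult DERIV_chain2[OF \<theta>'(2)] DERIV_real_sqrt has_real_derivative_powr True)
      also have "\<theta>' (sqrt t) * (inverse (sqrt t) / 2) * t powr p + p * t powr (p - 1) * \<theta> (sqrt t)
          = H [(\<lambda>t. \<theta>' t / 2, p - 1 / 2), (\<lambda>t. p * \<theta> t, p - 1)] t"
        unfolding H_def by (simp add: e) (simp add: field_simps)
      finally show ?thesis .
    next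
      case False
      \<comment> \<open>The real \<open>sqrt\<close> is negative on negative arguments, so the zero
        region of \<theta> covers all s below \<delta>^2, a neighbourhood of every t \<le>
        0.\<close>
      have ev: "\<forall>\<^sub>F s in nhds t. 0 = \<theta> (sqrt s) * s powr p"
      proof -
        have "sqrt s \<le> \<delta>" if "s < \<delta>\<^sup>2" for s
          using that \<delta> real_le_lsqrt[of \<delta> s] by (simp add: real_sqrt_le_iff' less_imp_le real_le_lsqrt)
        then have "\<theta> (sqrt s) = 0" if "s < \<delta>\<^sup>2" for s
          using \<open>\<theta> \<in> S\<close> that by (auto simp: S_def)
        moreover have "t < \<delta>\<^sup>2" using False \<delta> by (smt (verit) zero_less_power)
        ultimately show ?thesis
          using eventually_nhds_in_open[of "{..<\<delta>\<^sup>2}" t] by (auto elim!: eventually_mono)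
      qed
      have "sqrt t \<le> \<delta>" using False \<delta> by (smt (verit) real_sqrt_le_0_iff)
      then have "H [(\<lambda>t. \<theta>' t / 2, p - 1 / 2), (\<lambda>t. p * \<theta> t, p - 1)] t = 0"
        using vanish \<open>\<theta> \<in> S\<close> by (simp add: H_def S_def)
      then show ?thesis
        using DERIV_cong_ev[OF refl ev refl, of 0] DERIV_const[of 0 "at t"] by simp
    qed
    then show ?thesis using 1 by blast
  qed
  have *: "\<exists>L'. fst ` set L' \<subseteq> S \<and> (\<forall>t. (H L has_real_derivative H L' t) (at t))"
    if "fst ` set L \<subseteq> S" for L
    using that
  proof (induction L)
    case Nil
    show ?case by (rule exI[of _ "[]"]) (auto simp: H_def)
  next
    case (Cons a L)
    obtain \<theta> p where a: "a = (\<theta>, p)" by (cases a)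
    obtain L' where L': "fst ` set L' \<subseteq> S" "\<And>t. (H L has_real_derivative H L' t) (at t)"
      using Cons by auto
    obtain \<theta>' where \<theta>': "\<theta>' \<in> S"
      "\<And>t. ((\<lambda>t. \<theta> (sqrt t) * t powr p) has_real_derivative
      H [(\<theta>', p - 1 / 2), (\<lambda>t. p * \<theta> t, p - 1)] t) (at t)"
      using step[of \<theta> p] Cons.prems a by auto
    have "(\<lambda>t. p * \<theta> t) \<in> S" using Cons.prems a
      by (auto simp: S_def intro: smooth_real_mult[OF smooth_real_const])
    moreover have "H (a # L) = (\<lambda>t. \<theta> (sqrt t) * t powr p + H L t)" by (auto simp: H_def a)
    moreover have "H ([(\<theta>', p - 1 / 2), (\<lambda>t. p * \<theta> t, p - 1)] @ L') =
       (\<lambda>t. H [(\<theta>', p - 1 / 2), (\<lambda>t. p * \<theta> t, p - 1)] t + H L' t)" by (auto simp: H_def)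
    ultimately show ?case using L' \<theta>'
      by (intro exI[of _ "[(\<theta>', p - 1 / 2), (\<lambda>t. p * \<theta> t, p - 1)] @ L'"]) (auto intro: DERIV_add)
  qed
  have "smooth_real (H [(\<theta>, p)])"
  proof (rule smooth_real_coinduct[of _ "H ` {L. fst ` set L \<subseteq> S}"])
    show "H [(\<theta>, p)] \<in> H ` {L. fst ` set L \<subseteq> S}" using assms by (auto simp: S_def)
    fix h assume "h \<in> H ` {L. fst ` set L \<subseteq> S}"
    then obtain L where L: "fst ` set L \<subseteq> S" "h = H L" by auto
    from *[OF L(1)] obtain L' where "fst ` set L' \<subseteq> S" "\<forall>t. (h has_real_derivative H L' t) (at t)"
      unfolding L(2) by auto
    then show "\<exists>h'\<in>H ` {L. fst ` set L \<subseteq> S}. \<forall>t. (h has_real_derivative h' t) (at t)"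
      by (intro bexI[of _ "H L'"]) auto
  qed
  then show ?thesis by (simp add: H_def)
qed

section \<open>Smooth test functions\<close>

text \<open>A syntactic class: closure under partial derivatives is one structural induction, from
  which \<open>continuously_diff k\<close> follows for every k.\<close>

inductive_set smooth_vec :: "(real^'n \<Rightarrow> real) set" where
  const: "(\<lambda>_. c) \<in> smooth_vec"
| coord: "(\<lambda>x. x $ i) \<in> smooth_vec"
| add: "f \<in> smooth_vec \<Longrightarrow> g \<in> smooth_vec \<Longrightarrow> (\<lambda>x. f x + g x) \<in> smooth_vec"
| mult: "f \<in> smooth_vec \<Longrightarrow> g \<in> smooth_vec \<Longrightarrow> (\<lambda>x. f x * g x) \<in> smooth_vec"
| comp: "smooth_real \<theta> \<Longrightarrow> g \<in> smooth_vec \<Longrightarrow> (\<lambda>x. \<theta> (g x)) \<in> smooth_vec"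

lemma inner_vec_alt: "x \<bullet> y = (\<Sum>i\<in>UNIV. x $ i * y $ i)" for x y :: "real^'n"
  by (simp add: inner_vec_def)

lemma gradient_eqI:
  assumes "(\<phi> has_derivative (\<lambda>h. G \<bullet> h)) (at x)"
  shows "gradient \<phi> x = G"
proof -
  have "frechet_derivative \<phi> (at x) = (\<lambda>h. G \<bullet> h)"
    using frechet_derivative_at[OF assms] by simp
  then show ?thesis
    by (simp add: gradient_def vec_eq_iff inner_axis)
qed

lemma gradient_has_derivative:
  assumes "\<phi> differentiable (at x)"
  shows "(\<phi> has_derivative (\<lambda>h. gradient \<phi> x \<bullet> h)) (at x)"
proof -
  let ?D = "frechet_derivative \<phi> (at x)"
  have D: "(\<phi> has_derivative ?D) (at x)" using assms frechet_derivative_works by blast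
  then have lin: "linear ?D" by (simp add: has_derivative_linear)
  have "?D h = gradient \<phi> x \<bullet> h" for h
  proof -
    have "?D h = ?D (\<Sum>i\<in>UNIV. h $ i *\<^sub>R axis i 1)"
      by (simp add: basis_expansion scalar_mult_eq_scaleR[symmetric])
    also have "\<dots> = (\<Sum>i\<in>UNIV. h $ i * ?D (axis i 1))"
      using lin by (simp add: linear_sum linear_cmul)
    finally show ?thesis by (simp add: gradient_def inner_vec_alt mult.commute)
  qed
  then have "?D = (\<lambda>h. gradient \<phi> x \<bullet> h)" by blast
  with D show ?thesis by simp
qed

lemma smooth_vec_gradient:
  "f \<in> smooth_vec \<Longrightarrow>
    \<exists>G. (\<forall>i. (\<lambda>x. G x $ i) \<in> smooth_vec) \<and> (\<forall>x. (f has_derivative (\<lambda>h. G x \<bullet> h)) (at x))"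
proof (induction rule: smooth_vec.induct)
  case (const c)
  show ?case by (rule exI[of _ "\<lambda>_. 0"]) (simp add: smooth_vec.const)
next
  case (coord i)
  have "((\<lambda>x. x $ i) has_derivative (\<lambda>h. axis i 1 \<bullet> h)) (at x)" for x
    by (simp add: inner_axis' bounded_linear_imp_has_derivative bounded_linear_vec_nth)
  then show ?case by (intro exI[of _ "\<lambda>_. axis i 1"]) (simp add: smooth_vec.const)
next
  case (add f g)
  then obtain F G where *: "\<And>i. (\<lambda>x. F x $ i) \<in> smooth_vec" "\<And>i. (\<lambda>x. G x $ i) \<in> smooth_vec"
    "\<And>x. (f has_derivative (\<lambda>h. F x \<bullet> h)) (at x)" "\<And>x. (g has_derivative (\<lambda>h. G x \<bullet> h)) (at x)"
    by blast
  have "((\<lambda>x. f x + g x) has_derivative (\<lambda>h. (F x + G x) \<bullet> h)) (at x)" for x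
    using has_derivative_add[OF *(3,4)] by (simp add: inner_add_left)
  then show ?case
    by (intro exI[of _ "\<lambda>x. F x + G x"]) (simp add: smooth_vec.add *)
next
  case (mult f g)
  then obtain F G where *: "\<And>i. (\<lambda>x. F x $ i) \<in> smooth_vec" "\<And>i. (\<lambda>x. G x $ i) \<in> smooth_vec"
    "\<And>x. (f has_derivative (\<lambda>h. F x \<bullet> h)) (at x)" "\<And>x. (g has_derivative (\<lambda>h. G x \<bullet> h)) (at x)"
    by blast
  have "((\<lambda>x. f x * g x) has_derivative (\<lambda>h. (f x *\<^sub>R G x + g x *\<^sub>R F x) \<bullet> h)) (at x)" for x
    using has_derivative_mult[OF *(3,4)] by (simp add: inner_add_left mult.commute)
  moreover have "(\<lambda>x. (f x *\<^sub>R G x + g x *\<^sub>R F x) $ i) \<in> smooth_vec" for i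
    using smooth_vec.add[OF smooth_vec.mult[OF mult(1) *(2)] smooth_vec.mult[OF mult(2) *(1)]] by simp
  ultimately show ?case
    by (intro exI[of _ "\<lambda>x. f x *\<^sub>R G x + g x *\<^sub>R F x"]) blast
next
  case (comp \<theta> g)
  then obtain G where *: "\<And>i. (\<lambda>x. G x $ i) \<in> smooth_vec"
    "\<And>x. (g has_derivative (\<lambda>h. G x \<bullet> h)) (at x)" by blast
  obtain \<theta>' where \<theta>': "smooth_real \<theta>'" "\<And>t. (\<theta> has_real_derivative \<theta>' t) (at t)"
    using comp smooth_real_derivative by metis
  have "((\<lambda>x. \<theta> (g x)) has_derivative (\<lambda>h. (\<theta>' (g x) *\<^sub>R G x) \<bullet> h)) (at x)" for x
    using has_derivative_compose[OF *(2) \<theta>'(2)[unfolded has_field_derivative_def]] by simp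
  moreover have "(\<lambda>x. (\<theta>' (g x) *\<^sub>R G x) $ i) \<in> smooth_vec" for i
    using smooth_vec.mult[OF smooth_vec.comp[OF \<theta>'(1) comp(2)] *(1)] by simp
  ultimately show ?case
    by (intro exI[of _ "\<lambda>x. \<theta>' (g x) *\<^sub>R G x"]) blast
qed

lemma smooth_vec_continuously_diff: "f \<in> smooth_vec \<Longrightarrow> continuously_diff k f"
proof (induction k arbitrary: f)
  case 0
  then show ?case
    using smooth_vec_gradient has_derivative_continuous continuous_at_imp_continuous_on
    by (metis continuously_diff.simps(1))
next
  case (Suc k)
  then obtain G where *: "\<And>i. (\<lambda>x. G x $ i) \<in> smooth_vec"
    "\<And>x. (f has_derivative (\<lambda>h. G x \<bullet> h)) (at x)"
    using smooth_vec_gradient by blast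
  then have "gradient f = G" using gradient_eqI by blast
  then show ?case
    using * Suc.IH by (auto simp: differentiable_on_def differentiable_def)
qed

lemma test_functionI:
  assumes "f \<in> smooth_vec" "compact K" "K \<subseteq> \<Omega>" "\<And>x. x \<notin> K \<Longrightarrow> f x = 0"
  shows "test_function \<Omega> f"
proof -
  have "closure {x. f x \<noteq> 0} \<subseteq> K"
    by (rule closure_minimal) (use assms compact_imp_closed in auto)
  moreover from this have "compact (closure {x. f x \<noteq> 0})"
    using compact_Int_closed[OF assms(2) closed_closure, of "{x. f x \<noteq> 0}"] by (metis inf.absorb2)
  ultimately show ?thesis
    using assms(1,3) smooth_vec_continuously_diff unfolding test_function_def by auto
qed

lemma test_function_has_derivative:
  assumes "test_function \<Omega> \<phi>"
  shows "(\<phi> has_derivative (\<lambda>h. gradient \<phi> x \<bullet> h)) (at x)"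
proof -
  have "continuously_diff (Suc 0) \<phi>" using assms unfolding test_function_def by (elim conjE allE)
  then show ?thesis by (simp add: differentiable_on_def gradient_has_derivative)
qed

lemma test_function_continuous:
  assumes "test_function \<Omega> \<phi>"
  shows "continuous_on UNIV \<phi>" "continuous_on UNIV (gradient \<phi>)"
proof -
  have "continuously_diff (Suc 0) \<phi>" "continuously_diff 0 \<phi>"
    using assms unfolding test_function_def by (metis (no_types))+
  then have "continuous_on UNIV \<phi>" "\<And>i. continuous_on UNIV (\<lambda>x. gradient \<phi> x $ i)"
    by auto
  moreover have "gradient \<phi> = (\<lambda>x. \<chi> i. gradient \<phi> x $ i)" by simp
  ultimately show "continuous_on UNIV \<phi>" "continuous_on UNIV (gradient \<phi>)"
    using continuous_on_vec_lambda[of UNIV "\<lambda>i x. gradient \<phi> x $ i"] by auto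
qed

lemma test_function_support:
  assumes "test_function \<Omega> \<phi>"
  obtains K where "compact K" "K \<subseteq> \<Omega>" "\<And>x. x \<notin> K \<Longrightarrow> \<phi> x = 0" "\<And>x. x \<notin> K \<Longrightarrow> gradient \<phi> x = 0"
proof -
  let ?K = "closure {x. \<phi> x \<noteq> 0}"
  have zero: "\<phi> x = 0" if "x \<notin> ?K" for x
    using that closure_subset[of "{x. \<phi> x \<noteq> 0}"] by auto
  have "gradient \<phi> x = 0" if "x \<notin> ?K" for x
  proof (rule gradient_eqI)
    have "((\<lambda>_. 0) has_derivative (\<lambda>h. 0 \<bullet> h)) (at x)" by simp
    then show "(\<phi> has_derivative (\<lambda>h. 0 \<bullet> h)) (at x)"
    proof (rule has_derivative_transform_within_open)
      show "open (- ?K)" by (rule open_Compl[OF closed_closure])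
      show "x \<in> - ?K" using that by simp
      show "0 = \<phi> y" if "y \<in> - ?K" for y using zero[of y] that by simp
    qed
  qed
  moreover have "compact ?K" "?K \<subseteq> \<Omega>" using assms by (simp_all add: test_function_def)
  ultimately show ?thesis using zero that[of ?K] by blast
qed

section \<open>Radial functions and radial fields: smoothness, gradient, divergence\<close>

lemma norm_square_smooth: "(\<lambda>x::real^'n. (norm x)\<^sup>2) \<in> smooth_vec"
proof -
  have "(\<lambda>x::real^'n. \<Sum>i\<in>A. x $ i * x $ i) \<in> smooth_vec" if "finite A" for A
    using that
  proof (induction A)
    case empty
    show ?case using smooth_vec.const by simp
  next
    case (insert i A)
    then show ?case
      using smooth_vec.add[OF smooth_vec.mult[OF smooth_vec.coord smooth_vec.coord] insert.IH] by simp
  qed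
  then show ?thesis
    by (simp add: power2_norm_eq_inner inner_vec_alt)
qed

lemma radial_smooth:
  assumes "smooth_real \<theta>" "\<delta> > 0" "\<And>t. t \<le> \<delta> \<Longrightarrow> \<theta> t = 0"
  shows "(\<lambda>x::real^'n. \<theta> (norm x) * norm x powr p) \<in> smooth_vec"
proof -
  have "(\<lambda>x::real^'n. \<theta> (sqrt ((norm x)\<^sup>2)) * ((norm x)\<^sup>2) powr (p / 2)) \<in> smooth_vec"
    by (rule smooth_vec.comp[OF smooth_real_comp_sqrt[OF assms] norm_square_smooth])
  moreover have "((norm x)\<^sup>2) powr (p / 2) = norm x powr p" for x :: "real^'n"
    by (cases "x = 0") (auto simp: powr_powr simp flip: powr_numeral)
  ultimately show ?thesis by simp
qed

lemma gradient_radial: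
  assumes \<theta>: "\<And>t. (\<theta> has_real_derivative \<theta>' t) (at t)" and "x \<noteq> 0"
  shows "gradient (\<lambda>x::real^'n. \<theta> (norm x)) x = \<theta>' (norm x) *\<^sub>R (x /\<^sub>R norm x)"
proof (rule gradient_eqI)
  show "((\<lambda>x. \<theta> (norm x)) has_derivative (\<lambda>h. (\<theta>' (norm x) *\<^sub>R (x /\<^sub>R norm x)) \<bullet> h)) (at x)"
    using has_derivative_compose[OF has_derivative_norm[OF assms(2)] \<theta>[unfolded has_field_derivative_def]]
    by (simp add: sgn_div_norm inner_commute mult.assoc)
qed

lemma gradient_radial_coord:
  assumes \<theta>: "\<And>t. (\<theta> has_real_derivative \<theta>' t) (at t)" and "x \<noteq> 0"
  shows "gradient (\<lambda>x::real^'n. \<theta> (norm x) * norm x powr p * x $ i) x $ i =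
    (\<theta>' (norm x) * norm x powr p + p * \<theta> (norm x) * norm x powr (p - 1)) * (x $ i)\<^sup>2 / norm x
      + \<theta> (norm x) * norm x powr p"
proof -
  let ?q = "\<lambda>r. \<theta>' r * r powr p + p * \<theta> r * r powr (p - 1)"
  have q: "((\<lambda>r. \<theta> r * r powr p) has_real_derivative ?q r) (at r)" if "r > 0" for r
    using that by (auto intro!: derivative_eq_intros \<theta>)
  have 1: "((\<lambda>x. \<theta> (norm x) * norm x powr p) has_derivative (\<lambda>h. ?q (norm x) * ((x /\<^sub>R norm x) \<bullet> h))) (at x)"
    using has_derivative_compose[OF has_derivative_norm[OF assms(2)] q[unfolded has_field_derivative_def]] assms(2)
    by (simp add: sgn_div_norm inner_commute)
  have 2: "((\<lambda>x. x $ i) has_derivative (\<lambda>h. axis i 1 \<bullet> h)) (at x)"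
    by (simp add: inner_axis' bounded_linear_imp_has_derivative bounded_linear_vec_nth)
  have "((\<lambda>x. \<theta> (norm x) * norm x powr p * x $ i) has_derivative
     (\<lambda>h. ((\<theta> (norm x) * norm x powr p) *\<^sub>R axis i 1 + (x $ i * ?q (norm x)) *\<^sub>R (x /\<^sub>R norm x)) \<bullet> h)) (at x)"
    using has_derivative_mult[OF 1 2] by (simp add: inner_add_left algebra_simps)
  from gradient_eqI[OF this] show ?thesis
    by (simp add: power2_eq_square field_simps axis_def)
qed

text \<open>The field |x|^(-N) x is divergence free away from the origin: differentiating the power
  contributes -N \<theta> |x|^(-N), and the N coordinates contribute the same amount with a plus
  sign. Only the term with \<theta>' survives.\<close>

lemma radial_divergence:
  assumes \<theta>: "\<And>t. (\<theta> has_real_derivative \<theta>' t) (at t)" and "x \<noteq> 0"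
  shows "(\<Sum>i\<in>UNIV. gradient (\<lambda>x::real^'n. \<theta> (norm x) * norm x powr (- real CARD('n)) * x $ i) x $ i)
    = \<theta>' (norm x) * norm x powr (1 - real CARD('n))"
proof -
  let ?r = "norm x" and ?N = "real CARD('n)"
  have s: "(\<Sum>i\<in>UNIV. (x $ i)\<^sup>2) = ?r\<^sup>2"
    unfolding power2_norm_eq_inner inner_vec_alt by (simp add: power2_eq_square)
  have r: "?r > 0" using assms by simp
  have "(\<Sum>i\<in>UNIV. gradient (\<lambda>x::real^'n. \<theta> (norm x) * norm x powr (- ?N) * x $ i) x $ i)
     = (\<theta>' ?r * ?r powr (- ?N) - ?N * \<theta> ?r * ?r powr (- ?N - 1)) * ?r\<^sup>2 / ?r + ?N * (\<theta> ?r * ?r powr (- ?N))"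
    by (simp add: gradient_radial_coord[OF assms] sum.distrib sum_distrib_left[symmetric]
         sum_divide_distrib[symmetric] s)
  also have "\<dots> = \<theta>' ?r * (?r powr (- ?N) * ?r)"
    using r by (simp add: power2_eq_square powr_diff field_simps)
  also have "?r powr (- ?N) * ?r = ?r powr (1 - ?N)"
    using r by (simp add: powr_diff powr_minus field_simps)
  finally show ?thesis .
qed

section \<open>The fundamental lemma of the calculus of variations\<close>

text \<open>\<open>ennreal\<close> truncates negative values, so \<open>?P\<close> and
  \<open>?M\<close> have the positive and the negative part of \<open>G\<close> as densities. They
  agree on open boxes, an intersection-stable generator, hence everywhere; uniqueness of densities
  makes both parts equal, and one of them is zero at each point.\<close>

lemma AE_zero_box_integrals:
  fixes G :: "'a::euclidean_space \<Rightarrow> real"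
  assumes G: "integrable lborel G" and zero: "\<And>a b. (LINT x:box a b|lborel. G x) = 0"
  shows "AE x in lborel. G x = 0"
proof -
  have [measurable]: "G \<in> borel_measurable borel" using G by auto
  let ?P = "density lborel (\<lambda>x. ennreal (G x))" and ?M = "density lborel (\<lambda>x. ennreal (- G x))"
  have eq: "emeasure ?P (box a b) = emeasure ?M (box a b)" for a b
  proof -
    have i: "integrable lborel (\<lambda>x. indicator (box a b) x * G x)"
      using integrable_mult_indicator[OF _ G, of "box a b"] by simp
    have pos: "(\<integral>\<^sup>+x. ennreal (h x) * indicator (box a b) x \<partial>lborel) =
        ennreal (LINT x|lborel. max 0 (indicator (box a b) x * h x))"
      if "integrable lborel (\<lambda>x. indicator (box a b) x * h x)" for h
    proof -
      have "(\<integral>\<^sup>+x. ennreal (h x) * indicator (box a b) x \<partial>lborel) =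
          (\<integral>\<^sup>+x. ennreal (max 0 (indicator (box a b) x * h x)) \<partial>lborel)"
        by (rule nn_integral_cong) (auto simp: indicator_def max_def ennreal_neg)
      also have "\<dots> = ennreal (LINT x|lborel. max 0 (indicator (box a b) x * h x))"
        by (rule nn_integral_eq_integral) (use that in \<open>simp_all only: integrable_max integrable_zero, simp\<close>)
      finally show ?thesis .
    qed
    have 1: "emeasure ?P (box a b) = ennreal (LINT x|lborel. max 0 (indicator (box a b) x * G x))"
      using pos[OF i] by (simp add: emeasure_density)
    have "integrable lborel (\<lambda>x. indicator (box a b) x * - G x)" using i by simp
    from pos[OF this]
    have 2: "emeasure ?M (box a b) = ennreal (LINT x|lborel. max 0 (- (indicator (box a b) x * G x)))"
      by (simp add: emeasure_density)
    have "(LINT x|lborel. max 0 (indicator (box a b) x * G x)) -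
        (LINT x|lborel. max 0 (- (indicator (box a b) x * G x))) =
        (LINT x|lborel. max 0 (indicator (box a b) x * G x) - max 0 (- (indicator (box a b) x * G x)))"
      by (rule Bochner_Integration.integral_diff[symmetric]) (intro integrable_max integrable_zero integrable_minus i)+
    also have "\<dots> = (LINT x:box a b|lborel. G x)"
      unfolding set_lebesgue_integral_def by (rule Bochner_Integration.integral_cong) (auto simp: max_def)
    finally show ?thesis using zero 1 2 by simp
  qed
  have fin: "emeasure ?P (box a b) \<noteq> \<infinity>" for a b
  proof -
    have "emeasure ?P (box a b) \<le> (\<integral>\<^sup>+x. ennreal (norm (G x)) \<partial>lborel)"
      by (subst emeasure_density, simp, simp)
         (auto intro!: nn_integral_mono simp: indicator_def intro: ennreal_leI)
    also have "\<dots> < \<infinity>" using G by (simp add: integrable_iff_bounded)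
    finally show ?thesis by simp
  qed
  have "?P = ?M"
  proof (rule measure_eqI_generator_eq)
    let ?E = "range (\<lambda>(a, b). box a b::'a set)"
    show "Int_stable ?E"
      by (auto simp: Int_stable_def box_Int_box)
    show "?E \<subseteq> Pow UNIV" "sets ?P = sigma_sets UNIV ?E" "sets ?M = sigma_sets UNIV ?E"
      by (simp_all add: borel_eq_box sets_lborel)
    let ?A = "\<lambda>n::nat. box (- (real n *\<^sub>R One)) (real n *\<^sub>R One) :: 'a set"
    show "range ?A \<subseteq> ?E" "(\<Union>i. ?A i) = UNIV"
      unfolding UN_box_eq_UNIV by auto
    show "emeasure ?P (?A i) \<noteq> \<infinity>" for i by (rule fin)
    show "emeasure ?P X = emeasure ?M X" if "X \<in> ?E" for X using that eq by auto
  qed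
  then have "AE x in lborel. ennreal (G x) = ennreal (- G x)"
    by (subst (asm) sigma_finite_measure.density_unique_iff[OF lborel.sigma_finite_measure_axioms]) auto
  then show ?thesis
  proof eventually_elim
    case (elim x)
    then show ?case
      using ennreal_neg[of "G x"] ennreal_neg[of "- G x"]
      by (cases "G x \<ge> 0") (simp_all add: ennreal_eq_0_iff)
  qed
qed

text \<open>Localisation: \<open>g\<close> is cut off to one open box inside \<Omega>, where the
  intersection with any other box is again a box, and \<Omega> is a countable union of closed boxes.
  The faces of each box form a null set.\<close>

lemma AE_zero_on_open:
  fixes g :: "'a::euclidean_space \<Rightarrow> real"
  assumes \<Omega>: "open \<Omega>"
    and int: "\<And>a b. cbox a b \<subseteq> \<Omega> \<Longrightarrow> set_integrable lebesgue (cbox a b) g"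
    and zero: "\<And>a b. cbox a b \<subseteq> \<Omega> \<Longrightarrow> (LINT x:box a b|lebesgue. g x) = 0"
  shows "AE x in lebesgue. x \<in> \<Omega> \<longrightarrow> g x = 0"
proof -
  have *: "AE x in lebesgue. x \<in> cbox c d \<longrightarrow> g x = 0" if cd: "cbox c d \<subseteq> \<Omega>" for c d
  proof -
    define G where "G = (\<lambda>x. indicator (box c d) x * g x)"
    have "set_integrable lebesgue (box c d) g"
      by (rule set_integrable_subset[OF int[OF cd]]) (auto simp: box_subset_cbox)
    then have G: "integrable lebesgue G" by (simp add: G_def set_integrable_def)
    have Gz: "(LINT x:box a b|lebesgue. G x) = 0" for a b
    proof -
      obtain a' b' where ab': "box a b \<inter> box c d = box a' b'"
        by (simp add: box_Int_box)
      \<comment> \<open>If \<open>box a' b'\<close> is empty, its corners are not known to satisfy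
        \<open>cbox a' b' \<subseteq> \<Omega>\<close>. If it is nonempty, its closure is
        \<open>cbox a' b'\<close>, which therefore lies in \<open>cbox c d\<close>.\<close>
      show ?thesis
      proof (cases "box a' b' = {}")
        case True
        then have "(\<lambda>x. indicator (box a b) x *\<^sub>R G x) = (\<lambda>x. 0)"
          using ab' by (auto simp: G_def indicator_def fun_eq_iff)
        then show ?thesis by (simp only: set_lebesgue_integral_def) simp
      next
        case False
        then have "cbox a' b' \<subseteq> cbox c d"
          using ab' closure_box[of a' b'] closure_mono[of "box a' b'" "box c d"]
          by (metis Int_lower2 closure_box closure_empty inf_bot_right subset_empty)
        then have "(LINT x:box a' b'|lebesgue. g x) = 0" using zero cd by blast
        moreover have "indicator (box a' b') x *\<^sub>R g x = indicator (box a b) x *\<^sub>R G x" for x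
          using ab'[symmetric] by (auto simp: G_def indicator_def)
        ultimately show ?thesis by (simp add: set_lebesgue_integral_def)
      qed
    qed
    \<comment> \<open>A Borel version of \<open>G\<close> is needed, since the box criterion is
      stated for \<open>lborel\<close> while \<open>G\<close> is only Lebesgue measurable.\<close>
    obtain G' where G': "G' \<in> borel_measurable lborel" "AE x in lborel. G x = G' x"
      using completion_ex_borel_measurable_real[of G lborel] G by auto
    then have ae: "AE x in lebesgue. G x = G' x" by (simp add: AE_completion)
    have G'm: "G' \<in> borel_measurable lebesgue" using G'(1) by (rule measurable_completion)
    have "integrable lebesgue G'"
      using integrable_cong_AE_imp[OF G G'm] ae by simp
    then have iG': "integrable lborel G'" using G'(1) by (simp add: integrable_completion)
    have "(LINT x:box a b|lborel. G' x) = 0" for a b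
    proof -
      have "(LINT x:box a b|lborel. G' x) = (LINT x:box a b|lebesgue. G' x)"
        unfolding set_lebesgue_integral_def
        by (rule integral_completion[symmetric]) (use G'(1) in auto)
      also have "\<dots> = (LINT x:box a b|lebesgue. G x)"
        unfolding set_lebesgue_integral_def
      proof (rule integral_cong_AE)
        show "(\<lambda>x. indicat_real (box a b) x *\<^sub>R G' x) \<in> borel_measurable lebesgue"
          "(\<lambda>x. indicat_real (box a b) x *\<^sub>R G x) \<in> borel_measurable lebesgue"
          using G G'm by (intro borel_measurable_scaleR borel_measurable_indicator; simp)+
        show "AE x in lebesgue. indicat_real (box a b) x *\<^sub>R G' x = indicat_real (box a b) x *\<^sub>R G x"
          using ae by eventually_elim simp
      qed
      finally show ?thesis using Gz by simp
    qed
    from AE_zero_box_integrals[OF iG' this] have "AE x in lebesgue. G' x = 0"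
      by (rule AE_completion)
    moreover have "cbox c d - box c d \<in> null_sets lebesgue"
      using negligible_frontier_interval negligible_iff_null_sets by blast
    then have "AE x in lebesgue. x \<notin> cbox c d - box c d" by (rule AE_not_in)
    ultimately show ?thesis using ae
      by eventually_elim (auto simp: G_def indicator_def split: if_splits)
  qed
  obtain D where D: "countable D" "D \<subseteq> Pow \<Omega>"
      "\<And>X. X \<in> D \<Longrightarrow> \<exists>a b. X = cbox a b" "\<Union>D = \<Omega>"
    by (rule open_countable_Union_open_cbox[OF \<Omega>]) (rule that)
  have "AE x in lebesgue. \<forall>X\<in>D. x \<in> X \<longrightarrow> g x = 0"
    unfolding AE_ball_countable[OF D(1)]
  proof
    fix X assume "X \<in> D"
    then obtain a b where "X = cbox a b" "X \<subseteq> \<Omega>" using D(2) D(3)[of X] by auto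
    then show "AE x in lebesgue. x \<in> X \<longrightarrow> g x = 0" using *[of a b] by simp
  qed
  then show ?thesis unfolding D(4)[symmetric] by eventually_elim auto
qed

text \<open>The functions \<open>1 - exp (- n s)\<close> are smooth when \<open>s\<close> is, and increase to the indicator of \<open>{s > 0}\<close>.\<close>

lemma smooth_indicator_limit:
  assumes "s \<ge> 0"
  shows "(\<lambda>n. 1 - exp (- real n * s)) \<longlonglongrightarrow> (if s > 0 then 1 else 0)"
proof (cases "s > 0")
  case True
  have "(\<lambda>n. exp (- s) ^ n) \<longlonglongrightarrow> 0"
    by (rule LIMSEQ_power_zero) (use True in simp)
  then have "(\<lambda>n. exp (- real n * s)) \<longlonglongrightarrow> 0"
    by (simp add: exp_of_nat_mult[symmetric] algebra_simps)
  from tendsto_diff[OF tendsto_const this] show ?thesis using True by simp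
next
  case False
  with assms show ?thesis by simp
qed

lemma smooth_indicator_bound:
  assumes "s \<ge> 0"
  shows "\<bar>1 - exp (- real n * s)\<bar> \<le> 1"
proof -
  have "exp (- real n * s) \<le> 1" "exp (- real n * s) > 0" using assms by simp_all
  then show ?thesis by linarith
qed

text \<open>Dominated convergence with majorant |g| passes from the smooth weights 1 - exp(-n s) to
  the indicator of the set where s is positive.\<close>

lemma integral_positivity_set_zero:
  fixes g s :: "'a \<Rightarrow> real"
  assumes g: "integrable M g" and s: "s \<in> borel_measurable M" "\<And>x. 0 \<le> s x"
    and zero: "\<And>n. (LINT x|M. (1 - exp (- real n * s x)) * g x) = 0"
  shows "(LINT x|M. indicator {x. 0 < s x} x * g x) = 0"
proof -
  have gm: "g \<in> borel_measurable M" using g by (rule borel_measurable_integrable)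
  have lim: "(\<lambda>n. (1 - exp (- real n * s x)) * g x) \<longlonglongrightarrow> indicator {x. 0 < s x} x * g x" for x
    using tendsto_mult_right[OF smooth_indicator_limit[OF s(2)[of x]], of "g x"]
    by (cases "0 < s x") simp_all
  have nm: "(\<lambda>x. (1 - exp (- real n * s x)) * g x) \<in> borel_measurable M" for n
    using s(1) gm by measurable
  have "(\<lambda>n. LINT x|M. (1 - exp (- real n * s x)) * g x) \<longlonglongrightarrow> (LINT x|M. indicator {x. 0 < s x} x * g x)"
  proof (rule integral_dominated_convergence[where w = "\<lambda>x. \<bar>g x\<bar>"])
    show "AE x in M. norm ((1 - exp (- real n * s x)) * g x) \<le> \<bar>g x\<bar>" for n
    proof (rule AE_I2)
      show "norm ((1 - exp (- real n * s x)) * g x) \<le> \<bar>g x\<bar>" for x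
        using smooth_indicator_bound[OF s(2)[of x], of n] by (simp add: abs_mult mult_left_le_one_le)
    qed
    show "(\<lambda>x. indicator {x. 0 < s x} x * g x) \<in> borel_measurable M"
      by (rule borel_measurable_LIMSEQ_real[OF lim nm])
  qed (use g lim nm in auto)
  then show ?thesis unfolding zero by (simp add: LIMSEQ_const_iff)
qed

text \<open>A product of one-dimensional bumps is positive exactly on a given open box. The
  functions 1 - exp(-n s) built from it are test functions supported in the closed box and tend to
  the indicator of the open one, so all box integrals of \<open>g\<close> vanish without any
  mollification.\<close>

lemma fundamental_lemma:
  fixes g :: "real^'n \<Rightarrow> real"
  assumes \<Omega>: "open \<Omega>"
    and int: "\<And>K. compact K \<Longrightarrow> K \<subseteq> \<Omega> \<Longrightarrow> set_integrable lebesgue K g"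
    and zero: "\<And>\<phi>. test_function \<Omega> \<phi> \<Longrightarrow> (LINT x|lebesgue. \<phi> x * g x) = 0"
  shows "AE x in lebesgue. x \<in> \<Omega> \<longrightarrow> g x = 0"
proof (rule AE_zero_on_open[OF \<Omega>])
  show "set_integrable lebesgue (cbox a b) g" if "cbox a b \<subseteq> \<Omega>" for a b
    using int that compact_cbox by blast
  show "(LINT x:box a b|lebesgue. g x) = 0" if ab: "cbox a b \<subseteq> \<Omega>" for a b
  proof -
    define s where "s = (\<lambda>x::real^'n. \<Prod>i\<in>UNIV. bump (a $ i) (b $ i) (x $ i))"
    have "(\<lambda>x. \<Prod>i\<in>A. bump (a $ i) (b $ i) (x $ i)) \<in> smooth_vec"
      if "finite A" for A :: "'n set"
      using that
    proof (induction A)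
      case empty
      then show ?case using smooth_vec.const by simp
    next
      case (insert i A)
      from smooth_vec.mult[OF smooth_vec.comp[OF smooth_real_bump smooth_vec.coord] insert.IH] insert.hyps
      show ?case by simp
    qed
    then have s: "s \<in> smooth_vec" by (simp add: s_def)
    have s0: "s x \<ge> 0" for x by (simp add: s_def prod_nonneg bump_nonneg)
    have "s x \<noteq> 0 \<longleftrightarrow> x \<in> box a b" for x
      by (simp add: s_def bump_eq_0_iff mem_box_cart)
    then have sbox: "s x > 0 \<longleftrightarrow> x \<in> box a b" for x using s0[of x] by (metis less_eq_real_def less_irrefl)
    define \<phi> where "\<phi> = (\<lambda>n x. 1 - exp (- real n * s x))"
    have "test_function \<Omega> (\<phi> n)" for n
    proof (rule test_functionI[OF _ compact_cbox ab])
      from smooth_vec.comp[OF smooth_real_one_minus_exp s] show "\<phi> n \<in> smooth_vec" by (simp add: \<phi>_def)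
      show "\<phi> n x = 0" if "x \<notin> cbox a b" for x
      proof -
        have "x \<notin> box a b" using that box_subset_cbox by blast
        then have "s x = 0" using sbox[of x] s0[of x] by simp
        then show ?thesis by (simp add: \<phi>_def)
      qed
    qed
    then have z: "(LINT x|lebesgue. \<phi> n x * g x) = 0" for n by (rule zero)
    have i: "integrable lebesgue (\<lambda>x. indicator (cbox a b) x * g x)"
      using int[OF compact_cbox ab] by (simp add: set_integrable_def)
    \<comment> \<open>\<open>g\<close> is integrable only on compact subsets of \<Omega>, so the
      indicator of the closed box is inserted to obtain an integrable function on the whole
      space.\<close>
    have eq: "\<phi> n x * g x = \<phi> n x * (indicator (cbox a b) x * g x)" for n x
    proof (cases "x \<in> cbox a b")
      case False
      then have "x \<notin> box a b" using box_subset_cbox by blast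
      then have "s x = 0" using sbox[of x] s0[of x] by simp
      then show ?thesis by (simp add: \<phi>_def)
    qed simp
    have "s \<in> borel_measurable lebesgue"
      using smooth_vec_continuously_diff[OF s, of 0]
      by (auto intro!: measurable_completion borel_measurable_continuous_onI)
    moreover have "(LINT x|lebesgue. (1 - exp (- real n * s x)) * (indicator (cbox a b) x * g x)) = 0" for n
      using z[of n, unfolded eq] by (simp only: \<phi>_def)
    ultimately have "(LINT x|lebesgue. indicator {x. 0 < s x} x * (indicator (cbox a b) x * g x)) = 0"
      by (intro integral_positivity_set_zero[OF i _ s0])
    moreover have "indicator {x. 0 < s x} x * (indicator (cbox a b) x * g x) = indicator (box a b) x *\<^sub>R g x" for x
      using box_subset_cbox[of a b] by (auto simp: indicator_def sbox)
    ultimately show ?thesis by (simp add: set_lebesgue_integral_def)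
  qed
qed

section \<open>The lemma of du Bois-Reymond\<close>

definition test_real :: "real \<Rightarrow> real \<Rightarrow> (real \<Rightarrow> real) \<Rightarrow> bool" where
  "test_real p q \<theta> \<longleftrightarrow> smooth_real \<theta> \<and> (\<exists>a b. p < a \<and> a < b \<and> b < q \<and> (\<forall>t. t \<notin> {a..b} \<longrightarrow> \<theta> t = 0))"

lemma fundamental_lemma_real:
  fixes g :: "real \<Rightarrow> real"
  assumes g: "integrable lborel g"
    and zero: "\<And>\<zeta>. test_real p q \<zeta> \<Longrightarrow> (LINT t|lborel. \<zeta> t * g t) = 0"
  shows "AE t in lborel. t \<in> {p<..<q} \<longrightarrow> g t = 0"
proof -
  have "AE t in lebesgue. t \<in> {p<..<q} \<longrightarrow> g t = 0"
  proof (rule AE_zero_on_open)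
    have gl: "integrable lebesgue g" using g by (simp add: integrable_completion borel_measurable_integrable)
    show "set_integrable lebesgue (cbox a b) g" for a b
      unfolding set_integrable_def by (rule integrable_mult_indicator) (use gl in auto)
    show "(LINT x:box a b|lebesgue. g x) = 0" if ab: "cbox a b \<subseteq> {p<..<q}" for a b
    proof (cases "a < b")
      case False
      then show ?thesis by (simp add: set_lebesgue_integral_def)
    next
      case True
      with ab have pq: "p < a" "b < q" by (auto simp: subset_iff)
      define s where "s = bump a b"
      have s: "smooth_real s" unfolding s_def by (rule smooth_real_bump)
      have s0: "s t \<ge> 0" for t by (simp add: s_def bump_nonneg)
      have "s t \<noteq> 0 \<longleftrightarrow> t \<in> {a<..<b}" for t by (simp add: s_def bump_eq_0_iff)
      then have sb: "s t > 0 \<longleftrightarrow> t \<in> {a<..<b}" for t using s0[of t] by (metis less_eq_real_def less_irrefl)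
      define \<phi> where "\<phi> = (\<lambda>n t. 1 - exp (- real n * s t))"
      have "test_real p q (\<phi> n)" for n
      proof -
        from smooth_real_comp[OF smooth_real_one_minus_exp s] have "smooth_real (\<phi> n)" by (simp add: \<phi>_def)
        moreover have "\<phi> n t = 0" if "t \<notin> {a..b}" for t
        proof -
          have "s t = 0" using that sb[of t] s0[of t] by auto
          then show ?thesis by (simp add: \<phi>_def)
        qed
        ultimately show ?thesis using pq True unfolding test_real_def by blast
      qed
      then have z: "(LINT t|lborel. \<phi> n t * g t) = 0" for n by (rule zero)
      have "s \<in> borel_measurable lborel"
        using borel_measurable_continuous_onI[OF smooth_real_continuous[OF s]] by simp
      then have "(LINT t|lborel. indicator {t. 0 < s t} t * g t) = 0"
        by (rule integral_positivity_set_zero[OF g _ s0]) (rule z[unfolded \<phi>_def])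
      moreover have "{t. 0 < s t} = {a<..<b}" by (simp only: sb Collect_mem_eq)
      ultimately have "(LINT t|lborel. indicator {a<..<b} t * g t) = 0" by simp
      moreover have "(LINT t|lebesgue. indicator {a<..<b} t * g t) = (LINT t|lborel. indicator {a<..<b} t * g t)"
        by (rule integral_completion) (use g in auto)
      ultimately show ?thesis by (simp add: set_lebesgue_integral_def box_real)
    qed
  qed simp
  then show ?thesis by (simp add: AE_completion_iff)
qed

text \<open>The base point is minus infinity, which is legitimate for integrands integrable on the
  whole line and avoids oriented integrals.\<close>

abbreviation primitive :: "(real \<Rightarrow> real) \<Rightarrow> real \<Rightarrow> real" where
  "primitive x t \<equiv> LINT s|lborel. indicator {..<t} s * x s"

text \<open>Fubini on the two halves \<open>s < t\<close> and \<open>t \<le> s\<close> of the plane.\<close>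

lemma integral_parts_lborel:
  fixes x y :: "real \<Rightarrow> real"
  assumes x: "integrable lborel x" and y: "integrable lborel y"
  defines "X \<equiv> \<lambda>t. primitive x t"
    and "Y \<equiv> \<lambda>s. LINT t|lborel. indicator {..s} t * y t"
  shows "integrable lborel (\<lambda>t. y t * X t)" "integrable lborel (\<lambda>s. x s * Y s)"
    "(LINT t|lborel. y t * X t) + (LINT s|lborel. x s * Y s) = (LINT s|lborel. x s) * (LINT t|lborel. y t)"
proof -
  let ?P = "lborel \<Otimes>\<^sub>M (lborel :: real measure)"
  have [measurable]: "x \<in> borel_measurable borel" "y \<in> borel_measurable borel" using x y by auto
  have xy: "integrable ?P (\<lambda>(s, t). x s * y t)"
  proof (rule lborel_pair.Fubini_integrable)
    show "(\<lambda>(s, t). x s * y t) \<in> borel_measurable ?P" by measurable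
    show "AE s in lborel. integrable lborel (\<lambda>t. case (s, t) of (s, t) \<Rightarrow> x s * y t)" using y by simp
    have "integrable lborel (\<lambda>s. \<bar>x s\<bar> * (LINT t|lborel. \<bar>y t\<bar>))" using x by simp
    then show "integrable lborel (\<lambda>s. LINT t|lborel. norm (case (s, t) of (s, t) \<Rightarrow> x s * y t))"
      by (simp add: abs_mult)
  qed
  \<comment> \<open>The strict half-plane produces the open half-line in \<open>X\<close>, its
    complement the closed half-line in \<open>Y\<close>; the two pieces cover the plane exactly,
    diagonal included.\<close>
  let ?L = "\<lambda>(s, t). (if s < t then 1 else 0) * (x s * y t)"
  let ?G = "\<lambda>(s, t). (if s < t then 0 else 1) * (x s * y t)"
  have L: "integrable ?P ?L"
    by (rule Bochner_Integration.integrable_bound[OF xy]) (auto simp: split_beta intro!: AE_I2)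
  have G: "integrable ?P ?G"
    by (rule Bochner_Integration.integrable_bound[OF xy]) (auto simp: split_beta intro!: AE_I2)
  have 1: "(LINT s|lborel. (if s < t then 1 else 0) * (x s * y t)) = y t * X t" for t
    unfolding X_def integral_mult_right_zero[symmetric]
    by (rule Bochner_Integration.integral_cong) (auto simp: indicator_def)
  have 2: "(LINT t|lborel. (if s < t then 0 else 1) * (x s * y t)) = x s * Y s" for s
    unfolding Y_def integral_mult_right_zero[symmetric]
    by (rule Bochner_Integration.integral_cong) (auto simp: indicator_def)
  show "integrable lborel (\<lambda>t. y t * X t)"
    using lborel_pair.integrable_snd[OF L] unfolding 1 by simp
  show "integrable lborel (\<lambda>s. x s * Y s)"
    using lborel_pair.integrable_fst'[OF G] by (simp add: 2)
  have "(LINT t|lborel. y t * X t) = (LINT z|?P. ?L z)"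
    using lborel_pair.integral_snd[OF L] by (simp add: 1)
  moreover have "(LINT s|lborel. x s * Y s) = (LINT z|?P. ?G z)"
    using lborel_pair.integral_fst'[OF G] by (simp add: 2)
  moreover have "(LINT z|?P. ?L z) + (LINT z|?P. ?G z) = (LINT z|?P. (case z of (s, t) \<Rightarrow> x s * y t))"
    by (subst Bochner_Integration.integral_add[OF L G, symmetric])
       (auto intro!: Bochner_Integration.integral_cong simp: split_beta)
  moreover have "(LINT z|?P. (case z of (s, t) \<Rightarrow> x s * y t)) = (LINT s|lborel. x s) * (LINT t|lborel. y t)"
    using lborel_pair.integral_fst'[OF xy] by simp
  ultimately show "(LINT t|lborel. y t * X t) + (LINT s|lborel. x s * Y s) = (LINT s|lborel. x s) * (LINT t|lborel. y t)"
    by simp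
qed

text \<open>The zero mean is what makes the primitive vanish to the right of the support as well, so
  that it is again a test function.\<close>

lemma test_real_antiderivative:
  assumes \<eta>: "test_real p q \<eta>" and zero: "(LINT t|lborel. \<eta> t) = 0"
  obtains \<theta> where "test_real p q \<theta>" "\<And>t. (\<theta> has_real_derivative \<eta> t) (at t)"
proof -
  obtain a b where ab: "p < a" "a < b" "b < q" and supp: "\<And>t. t \<notin> {a..b} \<Longrightarrow> \<eta> t = 0"
    and sm: "smooth_real \<eta>"
    using \<eta> unfolding test_real_def by blast
  have cont: "continuous_on A \<eta>" for A by (rule smooth_real_continuous[OF sm])
  define \<theta> where "\<theta> = (\<lambda>t. integral {p..t} \<eta>)"
  have low: "\<theta> t = 0" if "t < a" for t
    unfolding \<theta>_def using integral_cong[of "{p..t}" \<eta> "\<lambda>_. 0"] supp that by simp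
  have int_eq: "\<theta> t = (LINT t|lborel. \<eta> t)" if "t \<ge> b" for t
  proof -
    have "\<theta> t = (LINT s:{p..t}|lborel. \<eta> s)"
      unfolding \<theta>_def
      by (rule set_borel_integral_eq_integral(2)[symmetric])
         (use borel_integrable_compact[of "{p..t}" \<eta>] cont in \<open>simp add: set_integrable_def\<close>)
    also have "\<dots> = (LINT t|lborel. \<eta> t)"
      unfolding set_lebesgue_integral_def
    proof (rule Bochner_Integration.integral_cong[OF refl])
      show "indicator {p..t} s *\<^sub>R \<eta> s = \<eta> s" for s
        using supp[of s] ab that by (cases "s \<in> {a..b}") auto
    qed
    finally show ?thesis .
  qed
  have deriv: "(\<theta> has_real_derivative \<eta> t) (at t)" for t
  proof (cases "t < a")
    case True
    have ev: "\<forall>\<^sub>F s in nhds t. 0 = \<theta> s"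
      using eventually_nhds_in_open[of "{..<a}" t] True low by (auto elim!: eventually_mono)
    show ?thesis using DERIV_cong_ev[OF refl ev refl, of 0] DERIV_const[of 0 "at t"] supp[of t] True by simp
  next
    case False
    have "(\<theta> has_real_derivative \<eta> t) (at t within {p..t+1})"
      unfolding \<theta>_def by (rule integral_has_real_derivative[OF cont]) (use False ab in auto)
    moreover have "at t within {p..t+1} = at t"
      by (rule at_within_interior) (use False ab in auto)
    ultimately show ?thesis by simp
  qed
  have "smooth_real \<theta>" by (rule smooth_realI[OF sm deriv])
  moreover have "\<theta> t = 0" if "t \<notin> {a..b}" for t using that low int_eq zero by auto
  ultimately have "test_real p q \<theta>" using ab unfolding test_real_def by blast
  then show ?thesis using deriv that by blast
qed

section \<open>Operations on one-dimensional test functions\<close>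

lemma test_real_integrable:
  assumes "test_real p q \<theta>" shows "integrable lborel \<theta>"
proof -
  obtain a b where supp: "\<And>t. t \<notin> {a..b} \<Longrightarrow> \<theta> t = 0" and sm: "smooth_real \<theta>"
    using assms unfolding test_real_def by blast
  have "integrable lborel (\<lambda>t. indicator {a..b} t *\<^sub>R \<theta> t)"
    by (rule borel_integrable_compact) (auto intro: smooth_real_continuous[OF sm])
  also have "(\<lambda>t. indicator {a..b} t *\<^sub>R \<theta> t) = \<theta>" using supp by (auto simp: indicator_def fun_eq_iff)
  finally show ?thesis .
qed

lemma test_real_bounded:
  assumes "test_real p q \<theta>" obtains B where "\<And>t. \<bar>\<theta> t\<bar> \<le> B"
proof -
  obtain a b where supp: "\<And>t. t \<notin> {a..b} \<Longrightarrow> \<theta> t = 0" and sm: "smooth_real \<theta>"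
    using assms unfolding test_real_def by blast
  have "bounded (\<theta> ` {a..b})"
    by (intro compact_imp_bounded compact_continuous_image smooth_real_continuous[OF sm]) simp
  then obtain B where "\<forall>x\<in>\<theta> ` {a..b}. norm x \<le> B" unfolding bounded_iff ..
  then have B: "\<bar>\<theta> t\<bar> \<le> B" if "t \<in> {a..b}" for t using that by simp
  have "\<bar>\<theta> t\<bar> \<le> max B 0" for t using B[of t] supp[of t] by (cases "t \<in> {a..b}") auto
  then show ?thesis by (rule that)
qed

lemma integrable_mult_bounded:
  fixes f :: "'a \<Rightarrow> 'b::euclidean_space" and m :: "'a \<Rightarrow> real"
  assumes f: "integrable M f" and m: "m \<in> borel_measurable M" and B: "\<And>x. \<bar>m x\<bar> \<le> B"
  shows "integrable M (\<lambda>x. m x *\<^sub>R f x)"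
proof (rule Bochner_Integration.integrable_bound)
  show "integrable M (\<lambda>x. B *\<^sub>R f x)" using f by simp
  show "AE x in M. norm (m x *\<^sub>R f x) \<le> norm (B *\<^sub>R f x)"
    by (rule AE_I2) (auto intro!: mult_right_mono order_trans[OF B abs_ge_self])
qed (use f m in auto)

lemma test_real_mult_integrable:
  assumes "test_real p q \<theta>" "integrable lborel x"
  shows "integrable lborel (\<lambda>t. \<theta> t * x t)"
proof -
  obtain B where "\<And>t. \<bar>\<theta> t\<bar> \<le> B" using test_real_bounded[OF assms(1)] by blast
  from integrable_mult_bounded[OF assms(2) _ this] show ?thesis
    using test_real_integrable[OF assms(1)] by auto
qed

lemma test_real_add_scale:
  assumes "test_real p q \<theta>" "test_real p q \<eta>"
  shows "test_real p q (\<lambda>t. \<theta> t - c * \<eta> t)"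
proof -
  obtain a b where 1: "p < a" "a < b" "b < q" "\<And>t. t \<notin> {a..b} \<Longrightarrow> \<theta> t = 0" "smooth_real \<theta>"
    using assms(1) unfolding test_real_def by blast
  obtain a' b' where 2: "p < a'" "a' < b'" "b' < q" "\<And>t. t \<notin> {a'..b'} \<Longrightarrow> \<eta> t = 0" "smooth_real \<eta>"
    using assms(2) unfolding test_real_def by blast
  have "smooth_real (\<lambda>t. \<theta> t - c * \<eta> t)"
    by (intro smooth_real_diff smooth_real_mult smooth_real_const 1 2)
  moreover have "\<theta> t - c * \<eta> t = 0" if "t \<notin> {min a a'..max b b'}" for t 
    using 1(4)[of t] 2(4)[of t] that by (cases "t \<in> {a..b}"; cases "t \<in> {a'..b'}") auto
  moreover have "p < min a a'" "min a a' < max b b'" "max b b' < q" using 1 2 by auto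
  ultimately show ?thesis unfolding test_real_def by blast
qed

lemma test_real_derivative:
  assumes "test_real p q \<theta>" "\<And>t. (\<theta> has_real_derivative \<theta>' t) (at t)"
  shows "test_real p q \<theta>'"
proof -
  obtain a b where 1: "p < a" "a < b" "b < q" "\<And>t. t \<notin> {a..b} \<Longrightarrow> \<theta> t = 0" "smooth_real \<theta>"
    using assms(1) unfolding test_real_def by blast
  obtain \<eta> where \<eta>: "smooth_real \<eta>" "\<And>t. (\<theta> has_real_derivative \<eta> t) (at t)"
    using smooth_real_derivative[OF 1(5)] by metis
  have "\<eta> = \<theta>'" using DERIV_unique[OF \<eta>(2) assms(2)] by (rule ext)
  moreover have "\<theta>' t = 0" if "t \<notin> {a..b}" for t
    by (rule derivative_zero_on_open[of "- {a..b}" t \<theta>])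
      (use that 1(4) assms(2) in \<open>auto simp: open_Compl\<close>)
  ultimately show ?thesis using \<eta>(1) 1(1-3) unfolding test_real_def by blast
qed

lemma integral_test_derivative:
  assumes \<theta>: "test_real p q \<theta>" "\<And>t. (\<theta> has_real_derivative \<theta>' t) (at t)"
  shows "(LINT t|lborel. indicator {..s} t * \<theta>' t) = \<theta> s" "(LINT t|lborel. \<theta>' t) = 0"
proof -
  obtain a b where 1: "p < a" "a < b" "b < q" "\<And>t. t \<notin> {a..b} \<Longrightarrow> \<theta> t = 0"
    using assms(1) unfolding test_real_def by blast
  have t': "test_real p q \<theta>'" by (rule test_real_derivative[OF \<theta>])
  then have sm: "smooth_real \<theta>'" unfolding test_real_def by blast
  have "\<theta>' t = 0" if "t \<notin> {a..b}" for t
    by (rule derivative_zero_on_open[of "- {a..b}" t \<theta>])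
      (use that 1(4) \<theta>(2) in \<open>auto simp: open_Compl\<close>)
  then have z: "\<theta>' t = 0" if "t < p \<or> q < t" for t using that 1(1-3) by auto
  have fin: "(LINT t|lborel. indicator {..s} t * \<theta>' t) = \<theta> s" if "p \<le> s" for s
  proof -
    have "(LINT t|lborel. indicator {..s} t * \<theta>' t) = (LINT t|lborel. indicator {p..s} t *\<^sub>R \<theta>' t)"
      by (rule Bochner_Integration.integral_cong) (use z in \<open>auto simp: indicator_def\<close>)
    also have "\<dots> = \<theta> s - \<theta> p"
    proof (rule integral_FTC_Icc[OF that])
      show "(\<theta> has_vector_derivative \<theta>' t) (at t within {p..s})" for t
        using \<theta>(2)[of t] has_real_derivative_iff_has_vector_derivative has_vector_derivative_at_within by blast
      show "continuous_on {p..s} \<theta>'" by (rule smooth_real_continuous[OF sm])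
    qed
    finally show ?thesis using 1(4)[of p] 1(1) by simp
  qed
  show "(LINT t|lborel. indicator {..s} t * \<theta>' t) = \<theta> s"
  proof (cases "p \<le> s")
    case False
    then have "(\<lambda>t. indicator {..s} t * \<theta>' t) = (\<lambda>t. 0)" using z by (auto simp: indicator_def fun_eq_iff)
    then show ?thesis using 1(4)[of s] False 1(1) by simp
  qed (rule fin)
  have "(LINT t|lborel. \<theta>' t) = (LINT t|lborel. indicator {..q} t * \<theta>' t)"
    by (rule Bochner_Integration.integral_cong) (use z in \<open>auto simp: indicator_def\<close>)
  also have "\<dots> = \<theta> q" using fin[of q] 1 by simp
  finally show "(LINT t|lborel. \<theta>' t) = 0" using 1(3) 1(4)[of q] by simp
qed

lemma test_real_exists:
  assumes "p < q"
  obtains \<beta> where "test_real p q \<beta>" "(LINT t|lborel. \<beta> t) = 1"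
proof -
  define a b where "a = (2 * p + q) / 3" and "b = (p + 2 * q) / 3"
  have ab: "p < a" "a < b" "b < q" using assms by (auto simp: a_def b_def field_simps)
  define s where "s = bump a b"
  have s: "smooth_real s" unfolding s_def by (rule smooth_real_bump)
  have s0: "s t \<ge> 0" for t by (simp add: s_def bump_nonneg)
  have sb: "s t \<noteq> 0 \<longleftrightarrow> t \<in> {a<..<b}" for t by (simp add: s_def bump_eq_0_iff)
  have "s t = 0" if "t \<notin> {a..b}" for t using that sb[of t] by auto
  then have t: "test_real p q s" using s ab unfolding test_real_def by blast
  have i: "integrable lborel s" by (rule test_real_integrable[OF t])
  have "(LINT t|lborel. s t) \<noteq> 0"
  proof
    assume "(LINT t|lborel. s t) = 0"
    then have "AE t in lborel. s t = 0" using integral_nonneg_eq_0_iff_AE[OF i] s0 by simp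
    then have "AE t in lborel. t \<notin> {a<..<b}" by eventually_elim (use sb in blast)
    then have "{a<..<b} \<in> null_sets lborel" by (subst (asm) AE_iff_null_sets[symmetric]) auto
    then show False using ab by (simp add: null_sets_def)
  qed
  then have I: "(LINT t|lborel. s t) > 0"
    using integral_nonneg_AE[of s lborel] s0 by (simp add: less_le)
  define c where "c = 1 / (LINT t|lborel. s t)"
  \<comment> \<open>Multiplication by the normalising constant \<open>c\<close> is written as a
    difference, so that \<open>test_real_add_scale\<close> covers it.\<close>
  have "test_real p q (\<lambda>t. s t - (1 - c) * s t)" by (rule test_real_add_scale[OF t t])
  moreover have "(\<lambda>t. s t - (1 - c) * s t) = (\<lambda>t. c * s t)" by (auto simp: algebra_simps)
  ultimately have "test_real p q (\<lambda>t. c * s t)" by simp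
  moreover have "(LINT t|lborel. c * s t) = 1" using I by (simp add: c_def)
  ultimately show ?thesis by (rule that)
qed

text \<open>Subtracting the primitive of \<open>y\<close> leaves a function \<open>z\<close> that is
  orthogonal to all derivatives of test functions. Every test function \<zeta> differs from a
  multiple of a fixed \<beta> of mean one by a function of mean zero, which is such a derivative;
  hence \<zeta> cannot distinguish \<open>z\<close> from the constant C, its integral against
  \<beta>.\<close>

lemma du_bois_reymond:
  fixes x y :: "real \<Rightarrow> real"
  assumes pq: "p < q" and x: "integrable lborel x" and y: "integrable lborel y"
    and weak: "\<And>\<theta> \<theta>'. test_real p q \<theta> \<Longrightarrow> (\<And>t. (\<theta> has_real_derivative \<theta>' t) (at t)) \<Longrightarrow>
      (LINT t|lborel. \<theta>' t * x t) = - (LINT t|lborel. \<theta> t * y t)"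
  shows "\<exists>C. AE t in lborel. t \<in> {p<..<q} \<longrightarrow> x t = C + primitive y t"
proof -
  have ind: "integrable lborel (indicator {p<..<q} :: real \<Rightarrow> real)"
    by (rule integrable_real_indicator) (use pq in auto)
  define Y where "Y = (\<lambda>t. primitive y t)"
  \<comment> \<open>\<open>Y\<close> tends to the total integral of \<open>y\<close> at infinity and
    need not be integrable, hence the cutoff; test functions supported in the interval do not see
    it.\<close>
  define z where "z = (\<lambda>t. x t - indicator {p<..<q} t * Y t)"
  obtain \<beta> where \<beta>: "test_real p q \<beta>" "(LINT t|lborel. \<beta> t) = 1" using test_real_exists[OF pq] .
  have Yb: "integrable lborel (\<lambda>t. indicator {p<..<q} t * Y t)"
    unfolding Y_def by (rule integral_parts_lborel(1)[OF y ind])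
  then have z: "integrable lborel z" using x by (simp add: z_def)
  have ztest: "(LINT t|lborel. \<theta>' t * z t) = 0"
    if \<theta>: "test_real p q \<theta>" "\<And>t. (\<theta> has_real_derivative \<theta>' t) (at t)" for \<theta> \<theta>'
  proof -
    have t': "test_real p q \<theta>'" by (rule test_real_derivative[OF \<theta>])
    have i: "integrable lborel \<theta>'" by (rule test_real_integrable[OF t'])
    have "(LINT t|lborel. \<theta>' t * Y t) + (LINT s|lborel. y s * \<theta> s) = 0"
      using integral_parts_lborel(3)[OF y i] integral_test_derivative[OF \<theta>] by (simp add: Y_def)
    moreover have "\<theta>' t * Y t = \<theta>' t * (indicator {p<..<q} t * Y t)" for t
      using t' unfolding test_real_def by (cases "t \<in> {p<..<q}") force+
    ultimately have "(LINT t|lborel. \<theta>' t * (indicator {p<..<q} t * Y t)) = - (LINT t|lborel. \<theta> t * y t)"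
      by (simp add: mult.commute[of "y _"])
    then show ?thesis
      unfolding z_def right_diff_distrib
      by (subst Bochner_Integration.integral_diff)
         (use weak[OF \<theta>] test_real_mult_integrable[OF t'] x Yb in auto)
  qed
  define C where "C = (LINT t|lborel. \<beta> t * z t)"
  have "AE t in lborel. t \<in> {p<..<q} \<longrightarrow> z t - indicator {p<..<q} t * C = 0"
  proof (rule fundamental_lemma_real)
    show "integrable lborel (\<lambda>t. z t - indicator {p<..<q} t * C)"
      by (intro Bochner_Integration.integrable_diff z integrable_mult_left ind)
    fix \<zeta> assume \<zeta>: "test_real p q \<zeta>"
    define c where "c = (LINT t|lborel. \<zeta> t)"
    have i: "integrable lborel \<zeta>" "integrable lborel \<beta>" using \<zeta> \<beta> test_real_integrable by auto
    have iz: "integrable lborel (\<lambda>t. \<zeta> t * z t)" "integrable lborel (\<lambda>t. \<beta> t * z t)"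
      using \<zeta> \<beta> z test_real_mult_integrable by auto
    have "test_real p q (\<lambda>t. \<zeta> t - c * \<beta> t)" by (rule test_real_add_scale[OF \<zeta> \<beta>(1)])
    moreover have "(LINT t|lborel. \<zeta> t - c * \<beta> t) = 0" using i \<beta>(2) by (simp add: c_def)
    ultimately obtain \<theta> where "test_real p q \<theta>" "\<And>t. (\<theta> has_real_derivative \<zeta> t - c * \<beta> t) (at t)"
      by (rule test_real_antiderivative) (rule that)
    from ztest[OF this] have "(LINT t|lborel. \<zeta> t * z t - c * (\<beta> t * z t)) = 0" by (simp add: algebra_simps)
    then have e: "(LINT t|lborel. \<zeta> t * z t) = c * C" using iz by (simp add: C_def)
    have "\<zeta> t * (z t - indicator {p<..<q} t * C) = \<zeta> t * z t - C * \<zeta> t" for t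
      using \<zeta> unfolding test_real_def by (cases "t \<in> {p<..<q}") (force simp: algebra_simps)+
    then show "(LINT t|lborel. \<zeta> t * (z t - indicator {p<..<q} t * C)) = 0"
      using i iz e by (simp add: c_def)
  qed
  then have "AE t in lborel. t \<in> {p<..<q} \<longrightarrow> x t = C + Y t"
    by eventually_elim (auto simp: z_def)
  then show ?thesis unfolding Y_def by blast
qed

section \<open>Integration of radial functions\<close>

text \<open>The surface area of a sphere as the derivative of the volume of a ball; the value 0 for
  r \<le> 0 makes it a density on the whole line.\<close>

definition sphere_area :: "nat \<Rightarrow> real \<Rightarrow> real" where
  "sphere_area N r = (if r > 0 then real N * unit_ball_vol (real N) * r ^ (N - 1) else 0)"

lemma sphere_area_measurable [measurable]: "sphere_area N \<in> borel_measurable borel"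
  unfolding sphere_area_def by measurable

lemma sphere_area_nonneg: "0 \<le> sphere_area N r"
  by (simp add: sphere_area_def)

lemma norm_measurable_lebesgue [measurable]: "norm \<in> lebesgue \<rightarrow>\<^sub>M borel"
  by (rule measurable_completion) measurable

text \<open>Both measures give the half-line up to r the volume of the ball of radius r, and
  half-lines are an intersection-stable generator.\<close>

lemma distr_norm:
  "distr lebesgue borel (norm :: real^'n \<Rightarrow> real) =
     density lborel (\<lambda>r. ennreal (sphere_area CARD('n) r))" (is "?D = ?S")
proof -
  let ?N = "CARD('n)"
  have N: "?N > 0" by simp
  have emD: "emeasure ?D {..r} = ennreal (if r \<ge> 0 then unit_ball_vol ?N * r ^ ?N else 0)" for r
  proof -
    have "emeasure ?D {..r} = emeasure lebesgue ((norm :: real^'n \<Rightarrow> real) -` {..r} \<inter> space lebesgue)"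
      by (rule emeasure_distr) auto
    also have "(norm :: real^'n \<Rightarrow> real) -` {..r} \<inter> space lebesgue = cball 0 r" by auto
    finally have "emeasure ?D {..r} = emeasure lebesgue (cball (0::real^'n) r)" .
    then show ?thesis
      by (auto simp: emeasure_cball)
  qed
  have emS: "emeasure ?S {..r} = ennreal (if r \<ge> 0 then unit_ball_vol ?N * r ^ ?N else 0)" for r
  proof (cases "r \<ge> 0")
    case True
    have "emeasure ?S {..r} = (\<integral>\<^sup>+s. ennreal (sphere_area ?N s) * indicator {..r} s \<partial>lborel)"
      by (rule emeasure_density) auto
    \<comment> \<open>The integrands may differ at s = 0, where the power is 1 in dimension one
      while \<open>sphere_area\<close> is 0; hence equality only almost everywhere.\<close>
    also have "\<dots> = (\<integral>\<^sup>+s. ennreal (real ?N * unit_ball_vol ?N * s ^ (?N - 1)) * indicator {0..r} s \<partial>lborel)"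
      by (rule nn_integral_cong_AE, rule AE_mp[OF AE_lborel_singleton[of 0]])
         (auto simp: sphere_area_def indicator_def)
    also have "\<dots> = ennreal (unit_ball_vol ?N * r ^ ?N - unit_ball_vol ?N * 0 ^ ?N)"
    proof (rule nn_integral_FTC_Icc)
      show "((\<lambda>r. unit_ball_vol ?N * r ^ ?N) has_real_derivative real ?N * unit_ball_vol ?N * s ^ (?N - 1)) (at s)" for s
        by (auto intro!: derivative_eq_intros)
    qed (use True in auto)
    finally show ?thesis using True N by (simp add: power_0_left)
  next
    case False
    have "emeasure ?S {..r} = (\<integral>\<^sup>+s. ennreal (sphere_area ?N s) * indicator {..r} s \<partial>lborel)"
      by (rule emeasure_density) auto
    also have "\<dots> = (\<integral>\<^sup>+s. 0 \<partial>(lborel::real measure))"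
      by (rule nn_integral_cong) (use False in \<open>auto simp: sphere_area_def indicator_def\<close>)
    finally show ?thesis using False by simp
  qed
  show ?thesis
  proof (rule measure_eqI_generator_eq)
    let ?E = "range (\<lambda>r::real. {..r})"
    show "Int_stable ?E" by (auto simp: Int_stable_def)
    show "?E \<subseteq> Pow UNIV" by simp
    show "sets ?D = sigma_sets UNIV ?E" "sets ?S = sigma_sets UNIV ?E"
      by (simp_all add: borel_eq_atMost sets_lborel)
    show "range (\<lambda>n::nat. {..real n}) \<subseteq> ?E" by auto
    show "(\<Union>n::nat. {..real n}) = UNIV" using real_arch_simple by auto
    show "emeasure ?D {..real n} \<noteq> \<infinity>" for n using emD by simp
    show "emeasure ?D X = emeasure ?S X" if "X \<in> ?E" for X using that emD emS by auto
  qed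
qed

lemma radial_integral:
  fixes q :: "real \<Rightarrow> real"
  assumes [measurable]: "q \<in> borel_measurable borel"
  shows "integrable lebesgue (\<lambda>x::real^'n. q (norm x)) \<longleftrightarrow> integrable lborel (\<lambda>r. sphere_area CARD('n) r * q r)"
    and "(LINT x::real^'n|lebesgue. q (norm x)) = (LINT r|lborel. sphere_area CARD('n) r * q r)"
proof -
  have "integrable lebesgue (\<lambda>x::real^'n. q (norm x)) \<longleftrightarrow> integrable (distr lebesgue borel (norm :: real^'n \<Rightarrow> real)) q"
    by (rule integrable_distr_eq[symmetric]) auto
  also have "\<dots> \<longleftrightarrow> integrable lborel (\<lambda>r. sphere_area CARD('n) r * q r)"
    unfolding distr_norm by (subst integrable_density) (auto simp: sphere_area_nonneg)
  finally show "integrable lebesgue (\<lambda>x::real^'n. q (norm x)) \<longleftrightarrow> integrable lborel (\<lambda>r. sphere_area CARD('n) r * q r)" .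
  have "(LINT x::real^'n|lebesgue. q (norm x)) = integral\<^sup>L (distr lebesgue borel (norm :: real^'n \<Rightarrow> real)) q"
    by (rule integral_distr[symmetric]) auto
  also have "\<dots> = (LINT r|lborel. sphere_area CARD('n) r * q r)"
    unfolding distr_norm by (subst integral_density) (auto simp: sphere_area_nonneg)
  finally show "(LINT x::real^'n|lebesgue. q (norm x)) = (LINT r|lborel. sphere_area CARD('n) r * q r)" .
qed

text \<open>Null sets of radii pull back to null sets of points because the image of Lebesgue
  measure under the norm has a density.\<close>

lemma AE_radial:
  assumes "AE r in lborel. P r"
  shows "AE x::real^'n in lebesgue. P (norm x)"
proof -
  from assms obtain A where A: "A \<in> null_sets lborel" "{r. \<not> P r} \<subseteq> A"
    unfolding eventually_ae_filter by auto
  have "A \<in> null_sets (distr lebesgue borel (norm :: real^'n \<Rightarrow> real))"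
    unfolding distr_norm
    by (subst null_sets_density_iff) (use A AE_not_in[OF A(1)] in \<open>auto elim!: eventually_mono\<close>)
  then have "norm -` A \<inter> space lebesgue \<in> null_sets (lebesgue :: (real^'n) measure)"
    by (subst (asm) null_sets_distr_iff) auto
  moreover have "{x \<in> space lebesgue. \<not> P (norm (x::real^'n))} \<subseteq> norm -` A \<inter> space lebesgue"
    using A(2) by auto
  ultimately show ?thesis by (rule AE_I')
qed

text \<open>
  The push-forward of \<open>h dx\<close> under the norm has a density \<open>k\<close> by Radon-Nikodym; up to a weight,
  \<open>k\<close> is the spherical mean of \<open>h\<close>, so no polar coordinates are needed.
\<close>

lemma norm_density_nonneg:
  fixes h :: "real^'n \<Rightarrow> real"
  assumes h: "integrable lebesgue h" and h0: "\<And>x. 0 \<le> h x"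
  obtains k where "integrable lborel k" "\<And>r. 0 \<le> k r"
    "\<And>q. q \<in> borel_measurable borel \<Longrightarrow>
       integrable lebesgue (\<lambda>x. h x * q (norm x)) \<longleftrightarrow> integrable lborel (\<lambda>r. k r * q r)"
    "\<And>q. q \<in> borel_measurable borel \<Longrightarrow>
       (LINT x|lebesgue. h x * q (norm x)) = (LINT r|lborel. k r * q r)"
proof -
  have [measurable]: "h \<in> borel_measurable lebesgue" using h by auto
  define \<nu> where "\<nu> = distr (density lebesgue (\<lambda>x. ennreal (h x))) borel (norm :: real^'n \<Rightarrow> real)"
  have nm: "norm \<in> measurable (density lebesgue (\<lambda>x::real^'n. ennreal (h x))) borel" by simp
  have "absolutely_continuous lborel \<nu>"
    unfolding absolutely_continuous_def
  proof
    fix A :: "real set" assume A: "A \<in> null_sets lborel"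
    then have "AE x::real^'n in lebesgue. norm x \<notin> A" using AE_radial[OF AE_not_in[OF A]] by simp
    moreover have "norm -` A \<in> sets (lebesgue :: (real^'n) measure)"
      using measurable_sets[OF norm_measurable_lebesgue, of A] A by auto
    ultimately have "norm -` A \<inter> space (density lebesgue (\<lambda>x::real^'n. ennreal (h x))) \<in> null_sets (density lebesgue (\<lambda>x. ennreal (h x)))"
      by (subst null_sets_density_iff) (auto elim!: eventually_mono)
    then show "A \<in> null_sets \<nu>"
      unfolding \<nu>_def by (subst null_sets_distr_iff[OF nm]) (use A in auto)
  qed
  moreover have "sets \<nu> = sets lborel" by (simp add: \<nu>_def)
  ultimately obtain k' where k': "k' \<in> borel_measurable lborel" "density lborel k' = \<nu>"
    using sigma_finite_measure.Radon_Nikodym[OF lborel.sigma_finite_measure_axioms] by blast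
  define k where "k = (\<lambda>r. enn2real (k' r))"
  have [measurable]: "k' \<in> borel_measurable borel" "k \<in> borel_measurable borel" using k'(1) by (auto simp: k_def)
  have "(\<integral>\<^sup>+r. k' r \<partial>lborel) = emeasure \<nu> UNIV"
    using emeasure_density[OF k'(1), of UNIV] k'(2) by simp
  also have "\<dots> = (\<integral>\<^sup>+x. ennreal (h x) \<partial>lebesgue)"
    unfolding \<nu>_def by (subst emeasure_distr[OF nm]) (auto simp: emeasure_density)
  also have "\<dots> < \<infinity>" using h h0 by (simp add: integrable_iff_bounded)
  finally have fin: "(\<integral>\<^sup>+r. k' r \<partial>lborel) < \<infinity>" .
  then have "AE r in lborel. k' r \<noteq> \<infinity>"
    by (intro nn_integral_noteq_infinite) auto
  then have kk': "AE r in lborel. ennreal (k r) = k' r"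
    by eventually_elim (simp add: k_def less_top)
  have k0: "0 \<le> k r" for r by (simp add: k_def)
  have "(\<integral>\<^sup>+r. ennreal (k r) \<partial>lborel) < \<infinity>"
    using fin nn_integral_cong_AE[OF kk'] by simp
  then have k: "integrable lborel k" using k0 by (simp add: integrable_iff_bounded)
  have \<nu>: "\<nu> = density lborel (\<lambda>r. ennreal (k r))"
    unfolding k'(2)[symmetric] by (rule density_cong) (use kk' in \<open>auto elim!: eventually_mono\<close>)
  show ?thesis
  proof (rule that[OF k k0])
    fix q :: "real \<Rightarrow> real" assume [measurable]: "q \<in> borel_measurable borel"
    have m: "(\<lambda>x::real^'n. q (norm x)) \<in> borel_measurable lebesgue" by measurable
    show "integrable lebesgue (\<lambda>x. h x * q (norm x)) \<longleftrightarrow> integrable lborel (\<lambda>r. k r * q r)"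
    proof -
      have "integrable lebesgue (\<lambda>x. h x * q (norm x)) \<longleftrightarrow> integrable \<nu> q"
        unfolding \<nu>_def by (subst integrable_distr_eq[OF nm]) (use h0 m in \<open>auto simp: integrable_density\<close>)
      then show ?thesis unfolding \<nu> by (simp add: integrable_density k0)
    qed
    show "(LINT x|lebesgue. h x * q (norm x)) = (LINT r|lborel. k r * q r)"
    proof -
      have "(LINT x|lebesgue. h x * q (norm x)) = integral\<^sup>L \<nu> q"
        unfolding \<nu>_def by (subst integral_distr[OF nm]) (use h0 m in \<open>auto simp: integral_density\<close>)
      then show ?thesis unfolding \<nu> by (simp add: integral_density k0)
    qed
  qed
qed

text \<open>The signed case, by positive and negative parts. Integrability transfers in one
  direction only: cancellation within spheres can make \<open>k r * q r\<close> integrable when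
  \<open>h x * q (norm x)\<close> is not.\<close>

lemma norm_density:
  fixes h :: "real^'n \<Rightarrow> real"
  assumes h: "integrable lebesgue h"
  obtains k where "integrable lborel k"
    "\<And>q. q \<in> borel_measurable borel \<Longrightarrow> integrable lebesgue (\<lambda>x. h x * q (norm x)) \<Longrightarrow>
       integrable lborel (\<lambda>r. k r * q r) \<and>
       (LINT x|lebesgue. h x * q (norm x)) = (LINT r|lborel. k r * q r)"
proof -
  have ip: "integrable lebesgue (\<lambda>x. max 0 (h x))" and im: "integrable lebesgue (\<lambda>x. max 0 (- h x))"
    using h by auto
  obtain k1 where k1: "integrable lborel k1"
    "\<And>q. q \<in> borel_measurable borel \<Longrightarrow>
       integrable lebesgue (\<lambda>x. max 0 (h x) * q (norm x)) \<longleftrightarrow> integrable lborel (\<lambda>r. k1 r * q r)"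
    "\<And>q. q \<in> borel_measurable borel \<Longrightarrow>
       (LINT x|lebesgue. max 0 (h x) * q (norm x)) = (LINT r|lborel. k1 r * q r)"
    by (rule norm_density_nonneg[OF ip]) auto
  obtain k2 where k2: "integrable lborel k2"
    "\<And>q. q \<in> borel_measurable borel \<Longrightarrow>
       integrable lebesgue (\<lambda>x. max 0 (- h x) * q (norm x)) \<longleftrightarrow> integrable lborel (\<lambda>r. k2 r * q r)"
    "\<And>q. q \<in> borel_measurable borel \<Longrightarrow>
       (LINT x|lebesgue. max 0 (- h x) * q (norm x)) = (LINT r|lborel. k2 r * q r)"
    by (rule norm_density_nonneg[OF im]) auto
  show ?thesis
  proof (rule that[of "\<lambda>r. k1 r - k2 r"])
    show "integrable lborel (\<lambda>r. k1 r - k2 r)" using k1(1) k2(1) by simp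
    fix q :: "real \<Rightarrow> real" assume q[measurable]: "q \<in> borel_measurable borel"
      and i: "integrable lebesgue (\<lambda>x. h x * q (norm x))"
    have qm[measurable]: "(\<lambda>x::real^'n. q (norm x)) \<in> borel_measurable lebesgue" by measurable
    have [measurable]: "h \<in> borel_measurable lebesgue" using h by auto
    have i1: "integrable lebesgue (\<lambda>x. max 0 (h x) * q (norm x))"
      by (rule Bochner_Integration.integrable_bound[OF i]) (auto simp: abs_mult intro!: AE_I2 mult_right_mono)
    have i2: "integrable lebesgue (\<lambda>x. max 0 (- h x) * q (norm x))"
      by (rule Bochner_Integration.integrable_bound[OF i]) (auto simp: abs_mult intro!: AE_I2 mult_right_mono)
    have "(LINT x|lebesgue. h x * q (norm x)) =
       (LINT x|lebesgue. max 0 (h x) * q (norm x) - max 0 (- h x) * q (norm x))"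
      by (rule Bochner_Integration.integral_cong) (auto simp: max_def)
    also have "\<dots> = (LINT r|lborel. k1 r * q r) - (LINT r|lborel. k2 r * q r)"
      using i1 i2 k1(3)[OF q] k2(3)[OF q] by simp
    also have "\<dots> = (LINT r|lborel. (k1 r - k2 r) * q r)"
      using i1 i2 k1(2)[OF q] k2(2)[OF q] by (simp add: left_diff_distrib)
    finally show "integrable lborel (\<lambda>r. (k1 r - k2 r) * q r) \<and>
       (LINT x|lebesgue. h x * q (norm x)) = (LINT r|lborel. (k1 r - k2 r) * q r)"
      using i1 i2 k1(2)[OF q] k2(2)[OF q] by (simp add: left_diff_distrib)
  qed
qed

lemma radial_integrable:
  fixes y :: "real \<Rightarrow> real"
  assumes y: "integrable lborel y" "\<And>t. t \<notin> {p<..<q} \<Longrightarrow> y t = 0" and p: "0 < p"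
  shows "integrable lebesgue (\<lambda>x::real^'n. y (norm x))"
proof -
  have ym: "y \<in> borel_measurable borel" using y(1) by auto
  have "integrable lborel (\<lambda>r. (indicator {p<..<q} r * sphere_area CARD('n) r) *\<^sub>R y r)"
  proof (rule integrable_mult_bounded[OF y(1)])
    define c where "c = real CARD('n) * unit_ball_vol (real CARD('n))"
    have "c \<ge> 0" by (simp add: c_def)
    then show "\<bar>indicator {p<..<q} r * sphere_area CARD('n) r\<bar> \<le> c * \<bar>q\<bar> ^ (CARD('n) - 1)" for r
      using p by (auto simp: indicator_def sphere_area_def c_def abs_mult intro!: mult_left_mono power_mono)
  qed auto
  also have "(\<lambda>r. (indicator {p<..<q} r * sphere_area CARD('n) r) *\<^sub>R y r) = (\<lambda>r. sphere_area CARD('n) r * y r)"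
    using y(2) by (auto simp: indicator_def fun_eq_iff)
  finally show ?thesis by (simp only: radial_integral(1)[OF ym])
qed

lemma direction_component:
  fixes x :: "real^'n"
  shows "\<bar>x $ i / norm x\<bar> \<le> 1"
    and "(\<lambda>x::real^'n. x $ i / norm x) \<in> borel_measurable lebesgue"
proof -
  show "\<bar>x $ i / norm x\<bar> \<le> 1"
    using component_le_norm_cart[of x i] by (cases "x = 0") (auto simp: divide_le_eq)
  show "(\<lambda>x::real^'n. x $ i / norm x) \<in> borel_measurable lebesgue"
    by (rule measurable_completion) measurable
qed

section \<open>Weak gradients of radial functions\<close>

lemma continuous_compact_support:
  fixes f :: "'a::euclidean_space \<Rightarrow> 'b::euclidean_space"
  assumes "continuous_on UNIV f" "compact K" "\<And>x. x \<notin> K \<Longrightarrow> f x = 0"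
  shows "integrable lborel f" "integrable lebesgue f" "\<exists>B. \<forall>x. norm (f x) \<le> B"
proof -
  have m: "f \<in> borel_measurable borel" using assms(1) by (rule borel_measurable_continuous_onI)
  have "integrable lborel (\<lambda>x. indicator K x *\<^sub>R f x)"
    by (rule borel_integrable_compact[OF assms(2) continuous_on_subset[OF assms(1)]]) simp
  also have "(\<lambda>x. indicator K x *\<^sub>R f x) = f" using assms(3) by (auto simp: indicator_def fun_eq_iff)
  finally show i: "integrable lborel f" .
  show "integrable lebesgue f" using i m by (simp add: integrable_completion)
  have "bounded (f ` K)"
    by (intro compact_imp_bounded compact_continuous_image assms continuous_on_subset[OF assms(1)]) simp
  then obtain B where "\<forall>x\<in>f ` K. norm x \<le> B" unfolding bounded_iff ..
  then have "norm (f x) \<le> max B 0" for x using assms(3)[of x] by (cases "x \<in> K") (auto simp: le_max_iff_disj)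
  then show "\<exists>B. \<forall>x. norm (f x) \<le> B" by blast
qed

text \<open>Difference quotients in direction i have integral zero by translation invariance, and
  they converge to the partial derivative. The mean value inequality bounds them by the supremum of
  |G|, so dominated convergence applies.\<close>

lemma integral_partial_derivative_zero:
  fixes \<psi> :: "real^'n \<Rightarrow> real" and G :: "real^'n \<Rightarrow> real^'n"
  assumes \<psi>: "\<And>x. (\<psi> has_derivative (\<lambda>h. G x \<bullet> h)) (at x)" and G: "continuous_on UNIV G"
    and K: "compact K" "\<And>x. x \<notin> K \<Longrightarrow> \<psi> x = 0" "\<And>x. x \<notin> K \<Longrightarrow> G x = 0"
  shows "(LINT x|lebesgue. G x $ i) = 0"
proof -
  let ?e = "axis i 1 :: real^'n"
  have c\<psi>: "continuous_on UNIV \<psi>"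
    by (rule continuous_at_imp_continuous_on) (use \<psi> in \<open>auto intro: has_derivative_continuous\<close>)
  have cG: "continuous_on UNIV (\<lambda>x. G x $ i)" using G by (intro continuous_intros)
  note I\<psi> = continuous_compact_support[OF c\<psi> K(1,2)]
  obtain B where B: "\<And>x. norm (G x) \<le> B" using continuous_compact_support(3)[OF G K(1,3)] by blast
  define D where "D = (\<lambda>n x. real (Suc n) * (\<psi> (x + (1 / real (Suc n)) *\<^sub>R ?e) - \<psi> x))"
  have shift: "integrable lborel (\<lambda>x. \<psi> (x + c))" "(LINT x|lborel. \<psi> (x + c)) = (LINT x|lborel. \<psi> x)" for c
  proof -
    have m: "\<psi> \<in> borel_measurable borel" using c\<psi> by (rule borel_measurable_continuous_onI)
    have d: "distr lborel borel ((+) c) = (lborel :: (real^'n) measure)" by (rule lborel_distr_plus)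
    have "integrable (distr lborel borel ((+) c)) \<psi>" using I\<psi>(1) d by simp
    then show "integrable lborel (\<lambda>x. \<psi> (x + c))"
      by (subst (asm) integrable_distr_eq) (use m in \<open>auto simp: add.commute\<close>)
    have "(LINT x|lborel. \<psi> x) = integral\<^sup>L (distr lborel borel ((+) c)) \<psi>" using d by simp
    also have "\<dots> = (LINT x|lborel. \<psi> (x + c))"
      by (subst integral_distr) (use m in \<open>auto simp: add.commute\<close>)
    finally show "(LINT x|lborel. \<psi> (x + c)) = (LINT x|lborel. \<psi> x)" ..
  qed
  have D0: "(LINT x|lborel. D n x) = 0" for n
    unfolding D_def using shift I\<psi>(1) by simp
  have "(\<lambda>n. LINT x|lborel. D n x) \<longlonglongrightarrow> (LINT x|lborel. G x $ i)"
  proof (rule integral_dominated_convergence)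
    \<comment> \<open>The increments have length 1 / (n + 1) \<le> 1, so all difference quotients
      are supported in the unit neighbourhood of \<open>K\<close>.\<close>
    define K' where "K' = (\<Union>x\<in>K. \<Union>y\<in>cball 0 1. {x + y})"
    have K': "compact K'" unfolding K'_def by (rule compact_sums'[OF K(1) compact_cball])
    show "integrable lborel (\<lambda>x. B * indicator K' x)"
      by (intro integrable_mult_right integrable_real_indicator)
        (use K' emeasure_compact_finite[OF K'] in \<open>simp_all add: borel_compact\<close>)
    show "(\<lambda>x. G x $ i) \<in> borel_measurable lborel" using borel_measurable_continuous_onI[OF cG] by simp
    show "D n \<in> borel_measurable lborel" for n
      unfolding D_def using shift(1) I\<psi>(1) by (intro borel_measurable_times borel_measurable_diff) auto
    show "AE x in lborel. (\<lambda>n. D n x) \<longlonglongrightarrow> G x $ i"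
    proof (rule AE_I2)
      fix x
      have "((\<lambda>t::real. x + t *\<^sub>R ?e) has_derivative (\<lambda>t. t *\<^sub>R ?e)) (at 0)"
        by (auto intro!: derivative_eq_intros)
      moreover have "(\<psi> has_derivative (\<lambda>h. G x \<bullet> h)) (at (x + 0 *\<^sub>R ?e))" using \<psi> by simp
      ultimately have "((\<lambda>t. \<psi> (x + t *\<^sub>R ?e)) has_derivative (\<lambda>t. G x \<bullet> (t *\<^sub>R ?e))) (at 0)"
        by (rule has_derivative_compose)
      then have "((\<lambda>t. \<psi> (x + t *\<^sub>R ?e)) has_real_derivative G x $ i) (at 0)"
        by (simp add: has_field_derivative_def inner_axis mult.commute[of _ "G x $ i"])
      then have lim: "((\<lambda>t. (\<psi> (x + t *\<^sub>R ?e) - \<psi> x) / t) \<longlongrightarrow> G x $ i) (at 0)"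
        by (simp add: DERIV_def)
      have "filterlim (\<lambda>n. 1 / real (Suc n)) (at 0) sequentially"
        using LIMSEQ_Suc[OF lim_1_over_n[where 'a = real]] by (simp add: filterlim_at del: of_nat_Suc)
      from filterlim_compose[OF lim this] show "(\<lambda>n. D n x) \<longlonglongrightarrow> G x $ i"
        by (simp add: D_def mult.commute)
    qed
    show "AE x in lborel. norm (D n x) \<le> B * indicator K' x" for n
    proof (rule AE_I2)
      fix x
      let ?c = "(1 / real (Suc n)) *\<^sub>R ?e"
      have nc: "norm ?c = 1 / real (Suc n)" by simp
      have K'I: "x \<in> K'" if "x + y \<in> K" "norm y \<le> 1" for y
      proof -
        have "x = (x + y) + (- y)" "- y \<in> cball 0 1" using that by auto
        then show ?thesis unfolding K'_def using that(1) by blast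
      qed
      show "norm (D n x) \<le> B * indicator K' x"
      proof (cases "x \<in> K'")
        case True
        have "norm (\<psi> (x + ?c) - \<psi> x) \<le> B * norm (x + ?c - x)"
        proof (rule differentiable_bound[of UNIV \<psi> "\<lambda>x h. G x \<bullet> h"])
          show "onorm (\<lambda>h. G y \<bullet> h) \<le> B" for y
          proof (rule onorm_bound)
            show "0 \<le> B" using B[of 0] norm_ge_zero order_trans by blast
            show "norm (G y \<bullet> h) \<le> B * norm h" for h
              using Cauchy_Schwarz_ineq2[of "G y" h] mult_right_mono[OF B[of y] norm_ge_zero[of h]] by simp
          qed
        qed (use \<psi> in auto)
        then have "real (Suc n) * norm (\<psi> (x + ?c) - \<psi> x) \<le> real (Suc n) * (B * (1 / real (Suc n)))"
          unfolding add_diff_cancel_left' nc by (rule mult_left_mono) simp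
        then show ?thesis using True by (simp add: D_def abs_mult)
      next
        case False
        have "x \<notin> K" using K'I[of 0] False by auto
        moreover have "x + ?c \<notin> K" using K'I[of ?c] False nc by (auto simp: divide_le_eq)
        ultimately show ?thesis using False K(2) by (simp add: D_def)
      qed
    qed
  qed
  then have "(LINT x|lborel. G x $ i) = 0" unfolding D0 by (simp add: LIMSEQ_const_iff)
  moreover have "(LINT x|lebesgue. G x $ i) = (LINT x|lborel. G x $ i)"
    by (rule integral_completion) (use borel_measurable_continuous_onI[OF cG] in simp)
  ultimately show ?thesis by simp
qed

lemma test_function_component_integrable:
  assumes "test_function \<Omega> \<phi>"
  shows "integrable lebesgue (\<lambda>x. gradient \<phi> x $ i)" "integrable lebesgue \<phi>"
proof -
  obtain K where K: "compact K" "\<And>x. x \<notin> K \<Longrightarrow> \<phi> x = 0" "\<And>x. x \<notin> K \<Longrightarrow> gradient \<phi> x = 0"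
    using test_function_support[OF assms] by metis
  have "continuous_on UNIV (\<lambda>x. gradient \<phi> x $ i)"
    using test_function_continuous(2)[OF assms] by (intro continuous_intros)
  then show "integrable lebesgue (\<lambda>x. gradient \<phi> x $ i)"
    by (rule continuous_compact_support(2)[OF _ K(1)]) (simp add: K(3))
  show "integrable lebesgue \<phi>"
    by (rule continuous_compact_support(2)[OF test_function_continuous(1)[OF assms] K(1,2)])
qed

lemma integral_gradient_test_function:
  assumes "test_function \<Omega> \<phi>"
  shows "(LINT x|lebesgue. gradient \<phi> x $ i) = 0"
proof -
  obtain K where K: "compact K" "\<And>x. x \<notin> K \<Longrightarrow> \<phi> x = 0" "\<And>x. x \<notin> K \<Longrightarrow> gradient \<phi> x = 0"
    using test_function_support[OF assms] by metis
  show ?thesis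
    by (rule integral_partial_derivative_zero[OF test_function_has_derivative[OF assms]
          test_function_continuous(2)[OF assms] K])
qed

text \<open>The gradient of the product \<theta>(|x|) \<phi>(x) has integral zero. Since \<theta>
  vanishes up to p > 0, the singularity of the norm at the origin does not matter.\<close>

lemma integral_parts_radial:
  fixes \<phi> :: "real^'n \<Rightarrow> real"
  assumes \<phi>: "test_function \<Omega> \<phi>" and p: "0 < p" and \<theta>: "test_real p q \<theta>"
    and \<theta>': "\<And>t. (\<theta> has_real_derivative \<theta>' t) (at t)"
  shows "(LINT x|lebesgue. gradient \<phi> x $ i * \<theta> (norm x)) =
    - (LINT x|lebesgue. \<phi> x * x $ i / norm x * \<theta>' (norm x))"
proof -
  obtain K where K: "compact K" "\<And>x. x \<notin> K \<Longrightarrow> \<phi> x = 0" "\<And>x. x \<notin> K \<Longrightarrow> gradient \<phi> x = 0"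
    using test_function_support[OF \<phi>] by metis
  have t': "test_real p q \<theta>'" by (rule test_real_derivative[OF \<theta> \<theta>'])
  have sm: "smooth_real \<theta>" "smooth_real \<theta>'" using \<theta> t' unfolding test_real_def by auto
  have low: "\<theta> t = 0" "\<theta>' t = 0" if "t \<le> p" for t
    using \<theta> t' that unfolding test_real_def by force+
  note c = test_function_continuous[OF \<phi>]
  have c\<theta>: "continuous_on UNIV (\<lambda>x::real^'n. \<theta> (norm x))"
    by (intro continuous_on_compose2[OF smooth_real_continuous[OF sm(1), of UNIV]] continuous_intros) simp
  \<comment> \<open>The quotient is written as a power so that \<open>radial_smooth\<close> yields
    continuity across the origin.\<close>
  define G1 where "G1 = (\<lambda>x::real^'n. (\<theta>' (norm x) * norm x powr (-1)) *\<^sub>R x)"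
  have cG1: "continuous_on UNIV G1"
  proof -
    have "(\<lambda>x::real^'n. \<theta>' (norm x) * norm x powr (-1)) \<in> smooth_vec"
      by (rule radial_smooth[OF sm(2) p low(2)])
    then have "continuous_on UNIV (\<lambda>x::real^'n. \<theta>' (norm x) * norm x powr (-1))"
      using smooth_vec_continuously_diff[of _ 0] by simp
    then show ?thesis unfolding G1_def by (rule continuous_on_scaleR[OF _ continuous_on_id])
  qed
  have G1: "G1 x = (\<theta>' (norm x) / norm x) *\<^sub>R x" for x
    by (cases "x = 0") (simp_all add: G1_def powr_minus divide_inverse)
  have d\<theta>: "((\<lambda>x. \<theta> (norm x)) has_derivative (\<lambda>h. G1 x \<bullet> h)) (at x)" for x :: "real^'n"
  proof (cases "x = 0")
    case False
    then show ?thesis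
      using has_derivative_compose[OF has_derivative_norm[OF False] \<theta>'[unfolded has_field_derivative_def]]
      by (simp add: sgn_div_norm inner_commute G1 divide_inverse mult.assoc)
  next
    case True
    have "((\<lambda>_. 0) has_derivative (\<lambda>h. G1 x \<bullet> h)) (at x)" using True by (simp add: G1)
    then show ?thesis
      by (rule has_derivative_transform_within_open[of _ _ _ _ "ball 0 p"]) (use True p low in auto)
  qed
  let ?G = "\<lambda>x. \<theta> (norm x) *\<^sub>R gradient \<phi> x + \<phi> x *\<^sub>R G1 x"
  have "(LINT x|lebesgue. ?G x $ i) = 0"
  proof (rule integral_partial_derivative_zero[where \<psi> = "\<lambda>x. \<theta> (norm x) * \<phi> x", OF _ _ K(1)])
    show "((\<lambda>x. \<theta> (norm x) * \<phi> x) has_derivative (\<lambda>h. ?G x \<bullet> h)) (at x)" for x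
      using has_derivative_mult[OF d\<theta> test_function_has_derivative[OF \<phi>]]
      by (simp add: inner_add_left mult.commute add.commute)
    show "continuous_on UNIV ?G" using c c\<theta> cG1 by (intro continuous_intros)
  qed (use K in auto)
  moreover have i1: "integrable lebesgue (\<lambda>x. \<theta> (norm x) * gradient \<phi> x $ i)"
    by (rule continuous_compact_support(2)[OF _ K(1)])
       (use c c\<theta> K in \<open>auto intro!: continuous_intros\<close>)
  moreover have "integrable lebesgue (\<lambda>x. \<phi> x * G1 x $ i)"
    by (rule continuous_compact_support(2)[OF _ K(1)])
       (use c cG1 K in \<open>auto intro!: continuous_intros\<close>)
  ultimately have "(LINT x|lebesgue. \<theta> (norm x) * gradient \<phi> x $ i) = - (LINT x|lebesgue. \<phi> x * G1 x $ i)"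
    by simp
  moreover have "\<phi> x * G1 x $ i = \<phi> x * x $ i / norm x * \<theta>' (norm x)" for x by (simp add: G1)
  ultimately show ?thesis by (simp add: mult.commute)
qed

lemma integrable_continuous_mult:
  fixes g :: "'a::euclidean_space \<Rightarrow> 'b::euclidean_space" and \<phi> :: "'a \<Rightarrow> real"
  assumes K: "compact K" and g: "g absolutely_integrable_on K"
    and \<phi>: "continuous_on UNIV \<phi>" "\<And>x. x \<notin> K \<Longrightarrow> \<phi> x = 0"
  shows "integrable lebesgue (\<lambda>x. \<phi> x *\<^sub>R g x)"
proof -
  obtain B where B: "\<And>x. \<bar>\<phi> x\<bar> \<le> B"
    using continuous_compact_support(3)[OF \<phi>(1) K \<phi>(2)] by auto
  have "\<phi> \<in> borel_measurable lebesgue"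
    using borel_measurable_continuous_onI[OF \<phi>(1)] by (simp add: measurable_completion)
  from integrable_mult_bounded[OF g[unfolded set_integrable_def] this B]
  have "integrable lebesgue (\<lambda>x. \<phi> x *\<^sub>R (indicator K x *\<^sub>R g x))" .
  also have "(\<lambda>x. \<phi> x *\<^sub>R (indicator K x *\<^sub>R g x)) = (\<lambda>x. \<phi> x *\<^sub>R g x)"
    using \<phi>(2) by (auto simp: indicator_def fun_eq_iff)
  finally show ?thesis .
qed

text \<open>The definition tests with vector-valued integrals over \<Omega>; here they become scalar
  integrals over the whole space. Integrability is proved along the way because taking components
  under the integral requires it.\<close>

lemma weak_gradient_test:
  fixes u :: "real^'n \<Rightarrow> real"
  assumes wg: "has_weak_gradient \<Omega> u g" and \<phi>: "test_function \<Omega> \<phi>"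
  shows "integrable lebesgue (\<lambda>x. \<phi> x * g x $ i)" "integrable lebesgue (\<lambda>x. u x * gradient \<phi> x $ i)"
    "(LINT x|lebesgue. \<phi> x * g x $ i) = - (LINT x|lebesgue. u x * gradient \<phi> x $ i)"
proof -
  obtain K where K: "compact K" "K \<subseteq> \<Omega>" "\<And>x. x \<notin> K \<Longrightarrow> \<phi> x = 0" "\<And>x. x \<notin> K \<Longrightarrow> gradient \<phi> x = 0"
    using test_function_support[OF \<phi>] by metis
  have uK: "u absolutely_integrable_on K" and gK: "g absolutely_integrable_on K"
    using wg K(1,2) unfolding has_weak_gradient_def locally_integrable_def by auto
  have i1: "integrable lebesgue (\<lambda>x. \<phi> x *\<^sub>R g x)"
    by (rule integrable_continuous_mult[OF K(1) gK test_function_continuous(1)[OF \<phi>] K(3)])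
  have ci: "continuous_on UNIV (\<lambda>x. gradient \<phi> x $ i)" for i
    using test_function_continuous(2)[OF \<phi>] by (intro continuous_intros)
  have i2: "integrable lebesgue (\<lambda>x. u x * gradient \<phi> x $ i)" for i
    using integrable_continuous_mult[OF K(1) uK ci[of i]] K(4) by (simp add: mult.commute)
  have bl: "bounded_linear (\<lambda>x::real^'n. x $ i)" for i by (rule bounded_linear_vec_nth)
  show "integrable lebesgue (\<lambda>x. \<phi> x * g x $ i)"
    using integrable_bounded_linear[OF bl i1, of i] by simp
  show "integrable lebesgue (\<lambda>x. u x * gradient \<phi> x $ i)" by (rule i2)
  have c: "continuous_on UNIV (\<lambda>x. gradient \<phi> x)" by (rule test_function_continuous(2)[OF \<phi>])
  have i3: "integrable lebesgue (\<lambda>x. u x *\<^sub>R gradient \<phi> x)"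
  proof -
    obtain B where B: "\<And>x. norm (gradient \<phi> x) \<le> B"
      using continuous_compact_support(3)[OF c K(1,4)] by auto
    show ?thesis
    proof (rule Bochner_Integration.integrable_bound)
      show "integrable lebesgue (\<lambda>x. B *\<^sub>R (indicator K x *\<^sub>R u x))"
        using uK unfolding set_integrable_def by (rule integrable_scaleR_right)
      have "(\<lambda>x. gradient \<phi> x) \<in> borel_measurable lebesgue"
        using borel_measurable_continuous_onI[OF c] by (simp add: measurable_completion)
      then have "(\<lambda>x. (indicator K x *\<^sub>R u x) *\<^sub>R gradient \<phi> x) \<in> borel_measurable lebesgue"
        by (rule borel_measurable_scaleR[OF borel_measurable_integrable[OF uK[unfolded set_integrable_def]]])
      also have "(\<lambda>x. (indicator K x *\<^sub>R u x) *\<^sub>R gradient \<phi> x) = (\<lambda>x. u x *\<^sub>R gradient \<phi> x)"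
        using K(4) by (auto simp: indicator_def fun_eq_iff)
      finally show "(\<lambda>x. u x *\<^sub>R gradient \<phi> x) \<in> borel_measurable lebesgue" .
      show "AE x in lebesgue. norm (u x *\<^sub>R gradient \<phi> x) \<le> norm (B *\<^sub>R (indicator K x *\<^sub>R u x))"
      proof (rule AE_I2)
        fix x
        have "norm (gradient \<phi> x) \<le> \<bar>B\<bar>" using B[of x] by linarith
        from mult_left_mono[OF this abs_ge_zero[of "u x"]]
        show "norm (u x *\<^sub>R gradient \<phi> x) \<le> norm (B *\<^sub>R (indicator K x *\<^sub>R u x))"
          using K(4)[of x] by (cases "x \<in> K") (auto simp: abs_mult mult.commute)
      qed
    qed
  qed
  have "(LINT x|lebesgue. indicator \<Omega> x *\<^sub>R (u x *\<^sub>R gradient \<phi> x)) =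
      - (LINT x|lebesgue. indicator \<Omega> x *\<^sub>R (\<phi> x *\<^sub>R g x))"
    using wg \<phi> unfolding has_weak_gradient_def set_lebesgue_integral_def by blast
  moreover have "(\<lambda>x. indicator \<Omega> x *\<^sub>R (u x *\<^sub>R gradient \<phi> x)) = (\<lambda>x. u x *\<^sub>R gradient \<phi> x)"
    using K(2,4) by (auto simp: indicator_def fun_eq_iff)
  moreover have "(\<lambda>x. indicator \<Omega> x *\<^sub>R (\<phi> x *\<^sub>R g x)) = (\<lambda>x. \<phi> x *\<^sub>R g x)"
    using K(2,3) by (auto simp: indicator_def fun_eq_iff)
  ultimately have "(LINT x|lebesgue. u x *\<^sub>R gradient \<phi> x) = - (LINT x|lebesgue. \<phi> x *\<^sub>R g x)"
    by (simp only:)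
  then have "(LINT x|lebesgue. u x *\<^sub>R gradient \<phi> x) $ i = - ((LINT x|lebesgue. \<phi> x *\<^sub>R g x) $ i)" by simp
  then show "(LINT x|lebesgue. \<phi> x * g x $ i) = - (LINT x|lebesgue. u x * gradient \<phi> x $ i)"
    using integral_bounded_linear[OF bl i1, of i] integral_bounded_linear[OF bl i3, of i] by simp
qed

lemma AE_interval_nonempty:
  assumes "AE t in lborel. t \<in> {a<..<b} \<longrightarrow> P t" and "a < (b::real)"
  obtains t where "t \<in> {a<..<b}" "P t"
proof (rule ccontr)
  assume "\<not> thesis"
  then have *: "\<not> P t" if "t \<in> {a<..<b}" for t using that \<open>\<And>t. t \<in> {a<..<b} \<Longrightarrow> P t \<Longrightarrow> thesis\<close> by auto
  have "AE t in lborel. t \<notin> {a<..<b}" by (rule eventually_mono[OF assms(1)]) (use * in auto)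
  then have "{a<..<b} \<in> null_sets lborel" by (subst (asm) AE_iff_null_sets[symmetric]) auto
  then show False using assms(2) by (simp add: null_sets_def)
qed

text \<open>
  Only \<open>U = C + \<integral> y\<close> is known, so \<open>U\<close> cannot be differentiated under the integral directly. The
  radial densities of \<open>\<partial>\<^sub>i\<phi>\<close> and of \<open>\<phi> x\<^sub>i / |x|\<close> are derivative and primitive of each other, again by
  du Bois-Reymond, and then one-dimensional integration by parts applies.
\<close>

lemma radial_weak_gradient:
  fixes \<phi> :: "real^'n \<Rightarrow> real" and U y :: "real \<Rightarrow> real"
  assumes pq: "0 < p" "p < q" and \<phi>: "test_function {x. p < norm x \<and> norm x < q} \<phi>"
    and y: "integrable lborel y" "\<And>t. t \<notin> {p<..<q} \<Longrightarrow> y t = 0"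
    and U: "U \<in> borel_measurable borel" "\<And>t. \<bar>U t\<bar> \<le> M" "\<And>t. t \<notin> {p<..<q} \<Longrightarrow> U t = 0"
    and Uy: "AE t in lborel. t \<in> {p<..<q} \<longrightarrow> U t = C + primitive y t"
  shows "integrable lebesgue (\<lambda>x. \<phi> x * x $ i / norm x * y (norm x))"
    "(LINT x|lebesgue. gradient \<phi> x $ i * U (norm x)) = - (LINT x|lebesgue. \<phi> x * x $ i / norm x * y (norm x))"
proof -
  define Y where "Y = (\<lambda>t. primitive y t)"
  obtain K where K: "compact K" "K \<subseteq> {x. p < norm x \<and> norm x < q}" "\<And>x. x \<notin> K \<Longrightarrow> \<phi> x = 0"
      "\<And>x. x \<notin> K \<Longrightarrow> gradient \<phi> x = 0"
    using test_function_support[OF \<phi>] by metis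
  \<comment> \<open>The support of \<phi> keeps a positive distance from the boundary of the
    annulus, which leaves the interval from p to p' free for fixing a constant below.\<close>
  obtain p' q' where pq': "p < p'" "p' < q'" "q' < q" "\<And>x. x \<in> K \<Longrightarrow> norm x \<in> {p'..q'}"
  proof -
    have c: "compact (norm ` K)" by (rule compact_continuous_image) (auto intro!: continuous_intros K(1))
    show ?thesis
    proof (cases "K = {}")
      case True
      show ?thesis by (rule that[of "(2 * p + q) / 3" "(p + 2 * q) / 3"]) (use pq True in \<open>auto simp: field_simps\<close>)
    next
      case False
      then obtain m where m: "m \<in> K" "\<And>x. x \<in> K \<Longrightarrow> norm m \<le> norm x"
        using compact_attains_inf[OF c] by auto
      obtain M where M: "M \<in> K" "\<And>x. x \<in> K \<Longrightarrow> norm x \<le> norm M"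
        using compact_attains_sup[OF c] False by auto
      note mM = m(1) M(1) m(2) M(2)
      have 1: "p < norm m" "norm m \<le> norm M" "norm M < q" using mM(1,2) mM(3)[OF mM(2)] K(2) by auto
      show ?thesis
      proof (rule that[of "(p + norm m) / 2" "(norm M + q) / 2"])
        show "norm x \<in> {(p + norm m) / 2..(norm M + q) / 2}" if "x \<in> K" for x
          using mM(3,4)[OF that] 1 by (simp add: field_simps)
      qed (use 1 in \<open>simp_all add: field_simps\<close>)
    qed
  qed
  let ?h1 = "\<lambda>x. gradient \<phi> x $ i" and ?h2 = "\<lambda>x. \<phi> x * x $ i / norm x"
  have h1: "integrable lebesgue ?h1" by (rule test_function_component_integrable[OF \<phi>])
  obtain M\<phi> where M\<phi>: "\<And>x. \<bar>\<phi> x\<bar> \<le> M\<phi>"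
    using continuous_compact_support(3)[OF test_function_continuous(1)[OF \<phi>] K(1,3)] by auto
  have h2: "integrable lebesgue ?h2"
    using integrable_mult_bounded[OF test_function_component_integrable(2)[OF \<phi>] direction_component(2,1)]
    by (simp add: mult.commute)
  obtain k1 where k1: "integrable lborel k1"
    "\<And>w. w \<in> borel_measurable borel \<Longrightarrow> integrable lebesgue (\<lambda>x. ?h1 x * w (norm x)) \<Longrightarrow>
       integrable lborel (\<lambda>r. k1 r * w r) \<and> (LINT x|lebesgue. ?h1 x * w (norm x)) = (LINT r|lborel. k1 r * w r)"
    by (rule norm_density[OF h1]) (rule that)
  obtain k2 where k2: "integrable lborel k2"
    "\<And>w. w \<in> borel_measurable borel \<Longrightarrow> integrable lebesgue (\<lambda>x. ?h2 x * w (norm x)) \<Longrightarrow>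
       integrable lborel (\<lambda>r. k2 r * w r) \<and> (LINT x|lebesgue. ?h2 x * w (norm x)) = (LINT r|lborel. k2 r * w r)"
    by (rule norm_density[OF h2]) (rule that)
  \<comment> \<open>The densities come with no information on their support. Cutting them to
    \<open>{p'..q'}\<close> changes no integral, since \<phi> vanishes at all other radii.\<close>
  define I where "I = (indicator {p'..q'} :: real \<Rightarrow> real)"
  have Im[measurable]: "I \<in> borel_measurable borel" by (simp add: I_def)
  have Iz: "I t = 0" if "t \<notin> {p'..q'}" for t using that by (simp add: I_def)
  have h1I: "?h1 x * (I (norm x) * w) = ?h1 x * w" and h2I: "?h2 x * (I (norm x) * w) = ?h2 x * w" for x w
    using K(3,4)[of x] pq'(4)[of x] by (cases "x \<in> K"; simp add: I_def)+
  define b where "b = (\<lambda>r. k1 r * I r)"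
  define B where "B = (\<lambda>r. k2 r * I r)"
  have bB: "integrable lborel b" "integrable lborel B"
    unfolding b_def B_def I_def using k1(1) k2(1)
    by (simp_all add: mult.commute integrable_real_mult_indicator)
  have b: "integrable lborel (\<lambda>r. b r * w r)" "(LINT x|lebesgue. ?h1 x * w (norm x)) = (LINT r|lborel. b r * w r)"
    if w: "w \<in> borel_measurable borel" "integrable lebesgue (\<lambda>x. ?h1 x * w (norm x))" for w
    using k1(2)[of "\<lambda>r. I r * w r", unfolded h1I] w by (simp_all add: b_def mult.assoc)
  have B: "integrable lborel (\<lambda>r. B r * w r)" "(LINT x|lebesgue. ?h2 x * w (norm x)) = (LINT r|lborel. B r * w r)"
    if w: "w \<in> borel_measurable borel" "integrable lebesgue (\<lambda>x. ?h2 x * w (norm x))" for w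
    using k2(2)[of "\<lambda>r. I r * w r", unfolded h2I] w by (simp_all add: B_def mult.assoc)
  have b0: "(LINT r|lborel. b r) = 0"
    using b(2)[of "\<lambda>_. 1"] h1 integral_gradient_test_function[OF \<phi>, of i] by simp
  have wm: "(\<lambda>x::real^'n. w (norm x)) \<in> borel_measurable lebesgue" if "w \<in> borel_measurable borel" for w :: "real \<Rightarrow> real"
    using measurable_compose[OF norm_measurable_lebesgue that] .
  have bounded_i: "integrable lebesgue (\<lambda>x. h x * w (norm x))"
    if "integrable lebesgue h" "w \<in> borel_measurable borel" "\<And>t. \<bar>w t\<bar> \<le> m" for h :: "real^'n \<Rightarrow> real" and w m
    using integrable_mult_bounded[OF that(1) wm[OF that(2)] that(3)] by (simp add: mult.commute)
  \<comment> \<open>That \<open>b\<close> is the weak derivative of \<open>B\<close> is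
    \<open>integral_parts_radial\<close> read through the two densities.\<close>
  have "\<exists>C. AE t in lborel. t \<in> {p<..<q} \<longrightarrow> B t = C + primitive b t"
  proof (rule du_bois_reymond[OF pq(2) bB(2,1)])
    fix \<theta> \<theta>' assume \<theta>: "test_real p q \<theta>" "\<And>t. (\<theta> has_real_derivative \<theta>' t) (at t)"
    have t': "test_real p q \<theta>'" by (rule test_real_derivative[OF \<theta>])
    have m: "\<theta> \<in> borel_measurable borel" "\<theta>' \<in> borel_measurable borel"
      using test_real_integrable[OF \<theta>(1)] test_real_integrable[OF t'] by auto
    obtain m1 where m1: "\<And>t. \<bar>\<theta> t\<bar> \<le> m1" by (rule test_real_bounded[OF \<theta>(1)]) (rule that)
    obtain m2 where m2: "\<And>t. \<bar>\<theta>' t\<bar> \<le> m2" by (rule test_real_bounded[OF t']) (rule that)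
    show "(LINT t|lborel. \<theta>' t * B t) = - (LINT t|lborel. \<theta> t * b t)"
      using integral_parts_radial[OF \<phi> pq(1) \<theta>, of i]
        b(2)[OF m(1) bounded_i[OF h1 m(1) m1]] B(2)[OF m(2) bounded_i[OF h2 m(2) m2]]
      by (simp add: mult.commute)
  qed
  then obtain C1 where C1: "AE t in lborel. t \<in> {p<..<q} \<longrightarrow> B t = C1 + primitive b t" ..
  \<comment> \<open>Both \<open>B\<close> and the primitive of \<open>b\<close> vanish between p and
    p', and an almost everywhere identity holds at some point of that interval.\<close>
  have "C1 = 0"
  proof -
    have "AE t in lborel. t \<in> {p<..<p'} \<longrightarrow> B t = C1 + primitive b t"
      using C1 by eventually_elim (use pq' in auto)
    then obtain t where t: "t \<in> {p<..<p'}" "B t = C1 + primitive b t"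
      by (rule AE_interval_nonempty[OF _ pq'(1)]) (rule that)
    have "(\<lambda>s. indicator {..<t} s * b s) = (\<lambda>s. 0)" using t(1) by (auto simp: b_def I_def indicator_def)
    moreover have "B t = 0" using t(1) by (auto simp: B_def I_def)
    ultimately show ?thesis using t(2) by simp
  qed
  with C1 have Bb: "AE t in lborel. t \<in> {p<..<q} \<longrightarrow> B t = primitive b t" by simp
  \<comment> \<open>\<open>primitive\<close> uses the open half-line, while
    \<open>integral_parts_lborel\<close> produces the closed one on this side.\<close>
  have sing: "primitive b t = (LINT s|lborel. indicator {..t} s * b s)" for t
    by (rule integral_cong_AE, (use bB in \<open>measurable\<close>)[2], rule AE_mp[OF AE_lborel_singleton[of t]])
       (auto simp: indicator_def)
  have ym: "y \<in> borel_measurable borel" using y(1) by auto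
  have iy: "integrable lebesgue (\<lambda>x::real^'n. y (norm x))" by (rule radial_integrable[OF y pq(1)])
  have "\<bar>?h2 x\<bar> \<le> M\<phi>" for x
    using mult_mono[OF M\<phi>[of x] direction_component(1)[of x i]] M\<phi>[of x] by (simp add: abs_mult)
  from integrable_mult_bounded[OF iy _ this]
  show ih2y: "integrable lebesgue (\<lambda>x. ?h2 x * y (norm x))" using h2 by simp
  have eqy: "(LINT x|lebesgue. ?h2 x * y (norm x)) = (LINT r|lborel. B r * y r)" by (rule B(2)[OF ym ih2y])
  have iU: "integrable lebesgue (\<lambda>x. ?h1 x * U (norm x))" by (rule bounded_i[OF h1 U(1,2)])
  have parts: "integrable lborel (\<lambda>t. b t * Y t)"
    "integrable lborel (\<lambda>s. y s * (LINT t|lborel. indicator {..s} t * b t))"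
    "(LINT t|lborel. b t * Y t) + (LINT s|lborel. y s * (LINT t|lborel. indicator {..s} t * b t)) =
       (LINT s|lborel. y s) * (LINT t|lborel. b t)"
    unfolding Y_def by (rule integral_parts_lborel[OF y(1) bB(1)])+
  have "(LINT x|lebesgue. ?h1 x * U (norm x)) = (LINT r|lborel. b r * U r)" by (rule b(2)[OF U(1) iU])
  also have "\<dots> = (LINT r|lborel. C * b r + b r * Y r)"
  proof (rule integral_cong_AE)
    show "AE r in lborel. b r * U r = C * b r + b r * Y r"
      using Uy
    proof eventually_elim
      case (elim r)
      show ?case
      proof (cases "r \<in> {p<..<q}")
        case True with elim show ?thesis by (simp add: Y_def algebra_simps)
      next
        case False
        then have "b r = 0" using pq' by (auto simp: b_def I_def)
        then show ?thesis by simp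
      qed
    qed
    show "(\<lambda>r. b r * U r) \<in> borel_measurable lborel" using bB U(1) by simp
    show "(\<lambda>r. C * b r + b r * Y r) \<in> borel_measurable lborel"
      by (rule borel_measurable_integrable) (use bB parts(1) in simp)
  qed
  also have "\<dots> = (LINT r|lborel. b r * Y r)" using bB parts(1) b0 by simp
  also have "\<dots> = - (LINT s|lborel. y s * (LINT t|lborel. indicator {..s} t * b t))"
    using parts(3) b0 by simp
  also have "(LINT s|lborel. y s * (LINT t|lborel. indicator {..s} t * b t)) = (LINT s|lborel. B s * y s)"
  proof (rule integral_cong_AE)
    show "AE s in lborel. y s * (LINT t|lborel. indicator {..s} t * b t) = B s * y s"
      using Bb by eventually_elim (use y(2) sing in force)
    show "(\<lambda>s. y s * (LINT t|lborel. indicator {..s} t * b t)) \<in> borel_measurable lborel"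
      using parts(2) by (rule borel_measurable_integrable)
    show "(\<lambda>s. B s * y s) \<in> borel_measurable lborel" using bB ym by simp
  qed
  finally show "(LINT x|lebesgue. ?h1 x * U (norm x)) = - (LINT x|lebesgue. ?h2 x * y (norm x))"
    unfolding eqy .
qed

section \<open>The weak gradient in an annulus\<close>

lemma annulus_sets [measurable]: "{x::real^'n. p < norm x \<and> norm x < q} \<in> sets borel"
  by measurable

lemma compact_annulus: "compact {x::real^'n. p \<le> norm x \<and> norm x \<le> q}"
proof -
  have "{x::real^'n. p \<le> norm x \<and> norm x \<le> q} = cball 0 q - ball 0 p" by auto
  then show ?thesis by (simp add: compact_diff)
qed

lemma open_annulus: "open {x::real^'n. p < norm x \<and> norm x < q}"
  by (intro open_Collect_conj open_Collect_less continuous_intros)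

lemma test_real_in_annulus:
  assumes "test_real p q \<theta>" "0 < p" "q \<le> R"
  shows "test_function (ball 0 R - {0}) (\<lambda>x::real^'n. \<theta> (norm x))"
    and "test_function (ball 0 R - {0}) (\<lambda>x::real^'n. \<theta> (norm x) * norm x powr s * x $ i)"
proof -
  obtain a b where ab: "p < a" "b < q" "\<And>t. t \<notin> {a..b} \<Longrightarrow> \<theta> t = 0" and sm: "smooth_real \<theta>"
    using assms(1) unfolding test_real_def by blast
  have K: "compact {x::real^'n. a \<le> norm x \<and> norm x \<le> b}" by (rule compact_annulus)
  have sub: "{x. a \<le> norm x \<and> norm x \<le> b} \<subseteq> ball 0 R - {0::real^'n}" using ab assms by auto
  have "\<theta> t = 0" if "t \<le> p" for t using ab that by auto
  then have s: "(\<lambda>x::real^'n. \<theta> (norm x) * norm x powr s) \<in> smooth_vec" for s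
    by (rule radial_smooth[OF sm assms(2)])
  have "(\<lambda>x::real^'n. \<theta> (norm x) * norm x powr 0) = (\<lambda>x. \<theta> (norm x))"
    using ab assms by auto
  with s[of 0] show "test_function (ball 0 R - {0}) (\<lambda>x::real^'n. \<theta> (norm x))"
    by (intro test_functionI[OF _ K sub]) (use ab in auto)
  show "test_function (ball 0 R - {0}) (\<lambda>x::real^'n. \<theta> (norm x) * norm x powr s * x $ i)"
    by (rule test_functionI[OF smooth_vec.mult[OF s smooth_vec.coord] K sub]) (use ab in auto)
qed

text \<open>
  The test fields \<open>\<theta>(|x|) |x|\<^sup>-\<^sup>N x\<close> have divergence \<open>\<theta>'(|x|) |x|\<^sup>1\<^sup>-\<^sup>N\<close>, whose weight cancels the surface
  area of the spheres.
\<close>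

lemma weak_gradient_radial_1d:
  fixes u :: "real^'n \<Rightarrow> real" and U :: "real \<Rightarrow> real"
  assumes pq: "0 < p" "p < q" "q < R"
    and wg: "has_weak_gradient (ball 0 R - {0}) u g"
    and uU: "\<And>x. p < norm x \<Longrightarrow> norm x < q \<Longrightarrow> u x = U (norm x)"
    and U: "U \<in> borel_measurable borel" "\<And>t. \<bar>U t\<bar> \<le> M" "\<And>t. t \<notin> {p<..<q} \<Longrightarrow> U t = 0"
  obtains y C where "integrable lborel y" "\<And>t. t \<notin> {p<..<q} \<Longrightarrow> y t = 0"
    "AE t in lborel. t \<in> {p<..<q} \<longrightarrow> U t = C + primitive y t"
proof -
  let ?\<Omega> = "ball 0 R - {0::real^'n}" and ?N = "CARD('n)"
  define A where "A = {x::real^'n. p < norm x \<and> norm x < q}"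
  define a where "a = real ?N * unit_ball_vol (real ?N)"
  have a: "a > 0" by (simp add: a_def)
  have Am: "A \<in> sets lebesgue" unfolding A_def by simp
  define h where "h = (\<lambda>x. indicator A x * (g x \<bullet> x))"
  have "g absolutely_integrable_on {x. p \<le> norm x \<and> norm x \<le> q}"
  proof -
    have "{x::real^'n. p \<le> norm x \<and> norm x \<le> q} \<subseteq> ?\<Omega>" using pq by auto
    with wg compact_annulus show ?thesis unfolding has_weak_gradient_def locally_integrable_def by blast
  qed
  then have gA: "g absolutely_integrable_on A"
    by (rule set_integrable_subset[OF _ Am]) (auto simp: A_def)
  then have gA': "integrable lebesgue (\<lambda>x. indicator A x *\<^sub>R g x)" by (simp add: set_integrable_def)
  have hint: "integrable lebesgue h"
  proof (rule Bochner_Integration.integrable_bound)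
    show "integrable lebesgue (\<lambda>x. q *\<^sub>R (indicator A x *\<^sub>R g x))" using gA' by (rule integrable_scaleR_right)
    have "(\<lambda>x. (indicator A x *\<^sub>R g x) \<bullet> x) \<in> borel_measurable lebesgue"
      by (rule borel_measurable_inner[OF borel_measurable_integrable[OF gA']]) (rule measurable_completion, simp)
    then show "h \<in> borel_measurable lebesgue" by (simp add: h_def)
    show "AE x in lebesgue. norm (h x) \<le> norm (q *\<^sub>R (indicator A x *\<^sub>R g x))"
    proof (rule AE_I2)
      fix x
      have "\<bar>g x \<bullet> x\<bar> \<le> q * norm (g x)" if "x \<in> A"
        using Cauchy_Schwarz_ineq2[of "g x" x] that mult_left_mono[of "norm x" q "norm (g x)"]
        by (auto simp: A_def mult.commute)
      then show "norm (h x) \<le> norm (q *\<^sub>R (indicator A x *\<^sub>R g x))"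
        using pq by (cases "x \<in> A") (auto simp: h_def)
    qed
  qed
  obtain k where k: "integrable lborel k"
    "\<And>w. w \<in> borel_measurable borel \<Longrightarrow> integrable lebesgue (\<lambda>x. h x * w (norm x)) \<Longrightarrow>
       integrable lborel (\<lambda>r. k r * w r) \<and> (LINT x|lebesgue. h x * w (norm x)) = (LINT r|lborel. k r * w r)"
    by (rule norm_density[OF hint]) (rule that)
  \<comment> \<open>\<open>k\<close> is the radial density of \<open>g x \<bullet> x\<close>.
    Dividing by the surface area a r^(N-1) and by one more factor r = |x| leaves the spherical mean
    of the radial component of \<open>g\<close>, the candidate for U'.\<close>
  define y where "y = (\<lambda>r. (indicator {p<..<q} r * r powr (- real ?N) / a) *\<^sub>R k r)"
  have y: "integrable lborel y"
    unfolding y_def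
  proof (rule integrable_mult_bounded[OF k(1)])
    show "\<bar>indicator {p<..<q} r * r powr (- real ?N) / a\<bar> \<le> p powr (- real ?N) / a" for r
      using pq a by (auto simp: indicator_def abs_mult intro!: divide_right_mono powr_mono2')
  qed auto
  have y0: "y t = 0" if "t \<notin> {p<..<q}" for t using that by (simp add: y_def)
  have Uint: "integrable lborel U"
  proof -
    have "integrable lborel (\<lambda>t. U t *\<^sub>R (indicator {p<..<q} t :: real))"
      by (rule integrable_mult_bounded[OF _ _ U(2)]) (use U(1) pq in \<open>auto intro!: integrable_real_indicator\<close>)
    also have "(\<lambda>t. U t *\<^sub>R (indicator {p<..<q} t :: real)) = U"
      using U(3) by (auto simp: indicator_def fun_eq_iff)
    finally show ?thesis .
  qed
  have "\<exists>C. AE t in lborel. t \<in> {p<..<q} \<longrightarrow> U t = C + primitive y t"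
  proof (rule du_bois_reymond[OF pq(2) Uint y])
    fix \<theta> \<theta>' assume \<theta>: "test_real p q \<theta>" "\<And>t. (\<theta> has_real_derivative \<theta>' t) (at t)"
    have t': "test_real p q \<theta>'" by (rule test_real_derivative[OF \<theta>])
    have [measurable]: "\<theta> \<in> borel_measurable borel" "\<theta>' \<in> borel_measurable borel" "U \<in> borel_measurable borel"
      using test_real_integrable[OF \<theta>(1)] test_real_integrable[OF t'] U(1) by auto
    have z: "\<theta> t = 0" "\<theta>' t = 0" if "t \<notin> {p<..<q}" for t
      using \<theta>(1) t' that unfolding test_real_def by force+
    define \<phi> where "\<phi> = (\<lambda>i x::real^'n. \<theta> (norm x) * norm x powr (- real ?N) * x $ i)"
    have t\<phi>: "test_function ?\<Omega> (\<phi> i)" for i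
      unfolding \<phi>_def by (rule test_real_in_annulus(2)[OF \<theta>(1)]) (use pq in auto)
    note w = weak_gradient_test[OF wg t\<phi>]
    let ?w = "\<lambda>r. \<theta> r * r powr (- real ?N)"
    have e1: "(\<Sum>i\<in>UNIV. \<phi> i x * g x $ i) = h x * ?w (norm x)" for x
    proof -
      have "(\<Sum>i\<in>UNIV. \<phi> i x * g x $ i) = ?w (norm x) * (\<Sum>i\<in>UNIV. g x $ i * x $ i)"
        by (simp add: \<phi>_def sum_distrib_left algebra_simps)
      also have "\<dots> = h x * ?w (norm x)"
        using z(1)[of "norm x"] by (cases "x \<in> A") (auto simp: h_def A_def inner_vec_alt)
      finally show ?thesis .
    qed
    let ?v = "\<lambda>r. U r * \<theta>' r * r powr (1 - real ?N)"
    have e2: "(\<Sum>i\<in>UNIV. u x * gradient (\<phi> i) x $ i) = ?v (norm x)" for x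
    proof (cases "x = 0")
      case True
      then have "x \<notin> ?\<Omega>" by simp
      then have "gradient (\<phi> i) x = 0" for i using test_function_support[OF t\<phi>[of i]] by (metis subsetD)
      with True show ?thesis by simp
    next
      case False
      from radial_divergence[OF \<theta>(2) this]
      have "(\<Sum>i\<in>UNIV. gradient (\<phi> i) x $ i) = \<theta>' (norm x) * norm x powr (1 - real ?N)"
        by (simp add: \<phi>_def)
      then have "(\<Sum>i\<in>UNIV. u x * gradient (\<phi> i) x $ i) = u x * (\<theta>' (norm x) * norm x powr (1 - real ?N))"
        by (simp add: sum_distrib_left[symmetric])
      also have "\<dots> = ?v (norm x)"
        using uU[of x] z(2)[of "norm x"] by (cases "x \<in> A") (auto simp: A_def)
      finally show ?thesis .
    qed
    have i1: "integrable lebesgue (\<lambda>x. h x * ?w (norm x))"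
      unfolding e1[symmetric] using w(1) by (intro Bochner_Integration.integrable_sum)
    have "(LINT x|lebesgue. h x * ?w (norm x)) = (\<Sum>i\<in>UNIV. LINT x|lebesgue. \<phi> i x * g x $ i)"
      unfolding e1[symmetric] using w(1) by (intro Bochner_Integration.integral_sum)
    also have "\<dots> = - (\<Sum>i\<in>UNIV. LINT x|lebesgue. u x * gradient (\<phi> i) x $ i)"
      by (simp add: w(3) sum_negf)
    also have "(\<Sum>i\<in>UNIV. LINT x|lebesgue. u x * gradient (\<phi> i) x $ i) = (LINT x::real^'n|lebesgue. ?v (norm x))"
      unfolding e2[symmetric] using w(2) by (intro Bochner_Integration.integral_sum[symmetric])
    also have "\<dots> = (LINT r|lborel. sphere_area ?N r * ?v r)"
      by (rule radial_integral(2)) measurable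
    also have "\<dots> = (LINT r|lborel. a * (\<theta>' r * U r))"
    proof (rule Bochner_Integration.integral_cong[OF refl])
      fix r
      show "sphere_area ?N r * ?v r = a * (\<theta>' r * U r)"
      proof (cases "r > 0")
        case True
        have "r ^ (?N - 1) * r powr (1 - real ?N) = r powr (real (?N - 1)) * r powr (1 - real ?N)"
          by (simp only: powr_realpow[OF True])
        also have "\<dots> = 1" using True by (simp add: powr_add[symmetric] of_nat_diff)
        finally have "r ^ (?N - 1) * r powr (1 - real ?N) = 1" .
        then show ?thesis using True by (simp add: sphere_area_def a_def)
      next
        case False
        then show ?thesis using U(3)[of r] pq by (simp add: sphere_area_def)
      qed
    qed
    also have "(LINT x|lebesgue. h x * ?w (norm x)) = (LINT r|lborel. k r * ?w r)"
      using k(2)[OF _ i1] by simp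
    also have "\<dots> = (LINT r|lborel. a * (\<theta> r * y r))"
      by (rule Bochner_Integration.integral_cong[OF refl])
         (use z(1) a in \<open>auto simp: y_def indicator_def\<close>)
    finally have "a * ((LINT t|lborel. \<theta>' t * U t) + (LINT t|lborel. \<theta> t * y t)) = 0"
      by (simp add: distrib_left)
    then show "(LINT t|lborel. \<theta>' t * U t) = - (LINT t|lborel. \<theta> t * y t)" using a by simp
  qed
  then show ?thesis using that y y0 by blast
qed

text \<open>The one-dimensional statement controls only a spherical mean of \<open>g\<close>. By
  \<open>radial_weak_gradient\<close> the radial field with profile \<open>y\<close> satisfies the
  same integration by parts as \<open>g\<close>, so their difference is orthogonal to all test
  functions in the annulus and vanishes almost everywhere.\<close>

lemma weak_gradient_radial:
  fixes u :: "real^'n \<Rightarrow> real" and U :: "real \<Rightarrow> real"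
  assumes pq: "0 < p" "p < q" "q < R"
    and wg: "has_weak_gradient (ball 0 R - {0}) u g"
    and uU: "\<And>x. p < norm x \<Longrightarrow> norm x < q \<Longrightarrow> u x = U (norm x)"
    and U: "U \<in> borel_measurable borel" "\<And>t. \<bar>U t\<bar> \<le> M" "\<And>t. t \<notin> {p<..<q} \<Longrightarrow> U t = 0"
  obtains y C where "integrable lborel y" "\<And>t. t \<notin> {p<..<q} \<Longrightarrow> y t = 0"
    "AE t in lborel. t \<in> {p<..<q} \<longrightarrow> U t = C + primitive y t"
    "AE x in lebesgue. p < norm x \<and> norm x < q \<longrightarrow> g x = (y (norm x) / norm x) *\<^sub>R x"
proof -
  let ?\<Omega> = "ball 0 R - {0::real^'n}" and ?A = "{x::real^'n. p < norm x \<and> norm x < q}"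
  obtain y C where y: "integrable lborel y" "\<And>t. t \<notin> {p<..<q} \<Longrightarrow> y t = 0"
    and C: "AE t in lborel. t \<in> {p<..<q} \<longrightarrow> U t = C + primitive y t"
    by (rule weak_gradient_radial_1d[OF pq wg uU U]) (assumption+, rule that)
  have A\<Omega>: "?A \<subseteq> ?\<Omega>" using pq by auto
  have ae: "AE x in lebesgue. x \<in> ?A \<longrightarrow> g x $ i - x $ i / norm x * y (norm x) = 0" for i
  proof (rule fundamental_lemma[OF open_annulus])
    have iy: "integrable lebesgue (\<lambda>x::real^'n. y (norm x))" by (rule radial_integrable[OF y pq(1)])
    have iP: "integrable lebesgue (\<lambda>x. x $ i / norm x * y (norm x))"
      using integrable_mult_bounded[OF iy direction_component(2,1)] by simp
    show "set_integrable lebesgue K (\<lambda>x. g x $ i - x $ i / norm x * y (norm x))"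
      if K: "compact K" "K \<subseteq> ?A" for K
    proof -
      have "g absolutely_integrable_on K"
        using wg K A\<Omega> unfolding has_weak_gradient_def locally_integrable_def by blast
      then have "integrable lebesgue (\<lambda>x. indicator K x *\<^sub>R g x)" by (simp add: set_integrable_def)
      from integrable_bounded_linear[OF bounded_linear_vec_nth[of i] this]
      have "integrable lebesgue (\<lambda>x. indicator K x * g x $ i)" by simp
      moreover have "integrable lebesgue (\<lambda>x. indicator K x * (x $ i / norm x * y (norm x)))"
        using integrable_mult_indicator[OF _ iP, of K] K(1) by (simp add: lmeasurable_compact fmeasurableD)
      ultimately show ?thesis by (simp add: set_integrable_def right_diff_distrib)
    qed
    fix \<phi> assume \<phi>: "test_function ?A \<phi>"
    then have \<phi>\<Omega>: "test_function ?\<Omega> \<phi>" using A\<Omega> unfolding test_function_def by blast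
    note w = weak_gradient_test[OF wg \<phi>\<Omega>, of i]
    note rw = radial_weak_gradient[OF pq(1,2) \<phi> y U C, of i]
    obtain K where K: "K \<subseteq> ?A" "\<And>x. x \<notin> K \<Longrightarrow> gradient \<phi> x = 0"
      using test_function_support[OF \<phi>] by metis
    have eq: "(\<lambda>x. u x * gradient \<phi> x $ i) = (\<lambda>x. gradient \<phi> x $ i * U (norm x))"
    proof
      show "u x * gradient \<phi> x $ i = gradient \<phi> x $ i * U (norm x)" for x
        using K uU[of x] by (cases "x \<in> K") auto
    qed
    have "(LINT x|lebesgue. \<phi> x * g x $ i) = (LINT x|lebesgue. \<phi> x * x $ i / norm x * y (norm x))"
      using w(3)[unfolded eq] rw(2) by linarith
    then have "(LINT x|lebesgue. \<phi> x * g x $ i - \<phi> x * x $ i / norm x * y (norm x)) = 0"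
      using w(1) rw(1) by simp
    then show "(LINT x|lebesgue. \<phi> x * (g x $ i - x $ i / norm x * y (norm x))) = 0"
      by (simp add: right_diff_distrib mult.assoc)
  qed
  have "AE x in lebesgue. \<forall>i. x \<in> ?A \<longrightarrow> g x $ i - x $ i / norm x * y (norm x) = 0"
    unfolding AE_all_countable by (intro allI ae)
  then have "AE x in lebesgue. p < norm x \<and> norm x < q \<longrightarrow> g x = (y (norm x) / norm x) *\<^sub>R x"
    by eventually_elim (simp add: vec_eq_iff)
  then show ?thesis using that y C by blast
qed

section \<open>The radial equation\<close>

text \<open>\<open>flux N d = |d|\<^sup>N\<^sup>-\<^sup>2 d\<close> and its inverse, the signed root of order \<open>N - 1\<close>.\<close>

definition flux :: "nat \<Rightarrow> real \<Rightarrow> real" where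
  "flux N d = \<bar>d\<bar> ^ (N - 2) * d"

definition flux_inv :: "nat \<Rightarrow> real \<Rightarrow> real" where
  "flux_inv N z = sgn z * \<bar>z\<bar> powr (1 / (real N - 1))"

lemma power_pred:
  fixes x :: real
  assumes "N \<ge> 2" shows "x ^ (N - 2) * x = x ^ (N - 1)"
proof -
  obtain M where "N = Suc (Suc M)" using assms by (metis add_2_eq_Suc le_Suc_ex)
  then show ?thesis by simp
qed

lemma flux_flux_inv:
  assumes "N \<ge> 2" shows "flux N (flux_inv N z) = z"
proof (cases "z = 0")
  case False
  have s: "\<bar>flux_inv N z\<bar> = \<bar>z\<bar> powr (1 / (real N - 1))"
    using False by (simp add: flux_inv_def abs_mult)
  have "flux N (flux_inv N z) = (\<bar>z\<bar> powr (1 / (real N - 1))) ^ (N - 2) * (\<bar>z\<bar> powr (1 / (real N - 1))) * sgn z"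
    unfolding flux_def s by (simp add: flux_inv_def)
  also have "(\<bar>z\<bar> powr (1 / (real N - 1))) ^ (N - 2) * (\<bar>z\<bar> powr (1 / (real N - 1))) = (\<bar>z\<bar> powr (1 / (real N - 1))) ^ (N - 1)"
    by (rule power_pred[OF assms])
  also have "\<dots> = \<bar>z\<bar> powr (1 / (real N - 1) * real (N - 1))"
    using False by (simp add: powr_realpow[symmetric] powr_powr)
  also have "1 / (real N - 1) * real (N - 1) = 1" using assms by (simp add: of_nat_diff)
  finally show ?thesis by (simp add: abs_mult_sgn)
qed (simp add: flux_def flux_inv_def)

lemma flux_mult:
  assumes "N \<ge> 2" "c \<ge> 0" shows "flux N (c * d) = c ^ (N - 1) * flux N d"
proof -
  have "c ^ (N - 1) = c ^ (N - 2) * c" using power_pred[OF assms(1)] by simp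
  then show ?thesis using assms by (simp add: flux_def abs_mult power_mult_distrib)
qed

lemma abs_flux: assumes "N \<ge> 2" shows "\<bar>flux N d\<bar> = \<bar>d\<bar> ^ (N - 1)"
  using power_pred[OF assms] by (simp add: flux_def abs_mult)

lemma flux_inv_flux:
  assumes "N \<ge> 2" shows "flux_inv N (flux N d) = d"
proof (cases "d = 0")
  case False
  have "flux_inv N (flux N d) = sgn d * (\<bar>d\<bar> ^ (N - 1)) powr (1 / (real N - 1))"
    using abs_flux[OF assms, of d] False by (simp add: flux_inv_def flux_def sgn_mult)
  also have "(\<bar>d\<bar> ^ (N - 1)) powr (1 / (real N - 1)) = \<bar>d\<bar> powr (real (N - 1) * (1 / (real N - 1)))"
    using False by (simp add: powr_realpow[symmetric] powr_powr)
  also have "real (N - 1) * (1 / (real N - 1)) = 1" using assms by (simp add: of_nat_diff)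
  finally show ?thesis using False by (simp add: mult.commute abs_mult_sgn)
qed (simp add: flux_def flux_inv_def)

lemma continuous_flux_inv:
  assumes "N \<ge> 2" shows "continuous_on UNIV (flux_inv N)"
proof -
  have e: "1 / (real N - 1) > 0" using assms by simp
  have eq: "flux_inv N z = (if 0 \<le> z then z powr (1 / (real N - 1)) else - ((- z) powr (1 / (real N - 1))))" for z
    by (auto simp: flux_inv_def sgn_if)
  have "continuous_on ({0..} \<union> {..0}) (\<lambda>z. if 0 \<le> z then z powr (1 / (real N - 1)) else - ((- z) powr (1 / (real N - 1))))"
    by (rule continuous_on_cases) (use e in \<open>auto intro!: continuous_intros continuous_on_powr'\<close>)
  moreover have "{0..} \<union> {..0} = (UNIV::real set)" by auto
  ultimately show ?thesis by (simp add: eq[abs_def])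
qed

section \<open>From the weak equation to the classical radial equation\<close>

lemma integral_indicator_has_derivative:
  fixes x :: "real \<Rightarrow> real"
  assumes x: "integrable lborel x" "continuous_on {p<..<q} x" and t: "t \<in> {p<..<q}"
  shows "((\<lambda>t. primitive x t) has_real_derivative x t) (at t)"
proof -
  define t1 t2 where "t1 = (p + t) / 2" and "t2 = (t + q) / 2"
  have b: "p < t1" "t1 < t" "t < t2" "t2 < q" using t by (auto simp: t1_def t2_def field_simps)
  have c: "continuous_on {t1..t2} x" by (rule continuous_on_subset[OF x(2)]) (use b in auto)
  have eq: "primitive x r = primitive x t1 + integral {t1..r} x"
    if r: "r \<in> {t1<..<t2}" for r
  proof -
    have i: "set_integrable lborel {t1..r} x"
      unfolding set_integrable_def by (rule integrable_mult_indicator) (use x in auto)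
    have "primitive x r = (LINT s|lborel. indicator {..<t1} s * x s + indicator {t1..r} s *\<^sub>R x s)"
      by (rule integral_cong_AE, (use x in measurable)[2], rule AE_mp[OF AE_lborel_singleton[of r]])
         (use r in \<open>auto simp: indicator_def\<close>)
    also have "\<dots> = primitive x t1 + (LINT s:{t1..r}|lborel. x s)"
      unfolding set_lebesgue_integral_def
      by (rule Bochner_Integration.integral_add)
         (use x i integrable_mult_indicator[of "{..<t1}" lborel x] in \<open>auto simp: set_integrable_def\<close>)
    also have "(LINT s:{t1..r}|lborel. x s) = integral {t1..r} x"
      by (rule set_borel_integral_eq_integral(2)[OF i])
    finally show ?thesis .
  qed
  have "((\<lambda>r. integral {t1..r} x) has_real_derivative x t) (at t within {t1..t2})"
    by (rule integral_has_real_derivative[OF c]) (use b in auto)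
  moreover have "at t within {t1..t2} = at t" by (rule at_within_interior) (use b in auto)
  ultimately have "((\<lambda>r. primitive x t1 + integral {t1..r} x) has_real_derivative 0 + x t) (at t)"
    by (intro DERIV_add DERIV_const) simp
  then have "((\<lambda>r. primitive x t1 + integral {t1..r} x) has_real_derivative x t) (at t)" by simp
  moreover have ev: "\<forall>\<^sub>F r in nhds t. primitive x r =
      primitive x t1 + integral {t1..r} x"
    using eventually_nhds_in_open[of "{t1<..<t2}" t] b eq by (auto elim!: eventually_mono)
  ultimately show ?thesis using DERIV_cong_ev[OF refl ev refl] by simp
qed

lemma AE_eq_continuous:
  fixes a b :: "real \<Rightarrow> real"
  assumes ae: "AE t in lborel. t \<in> {p<..<q} \<longrightarrow> a t = b t"
    and c: "continuous_on {p<..<q} a" "continuous_on {p<..<q} b" and t: "t \<in> {p<..<q}"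
  shows "a t = b t"
proof (rule ccontr)
  assume ne: "a t \<noteq> b t"
  have "open ({p<..<q} \<inter> (\<lambda>t. a t - b t) -` (- {0}))"
    by (rule continuous_open_preimage) (auto intro!: continuous_intros c)
  moreover have "t \<in> {p<..<q} \<inter> (\<lambda>t. a t - b t) -` (- {0})" using ne t by simp
  ultimately obtain e where e: "e > 0" "ball t e \<subseteq> {p<..<q} \<inter> (\<lambda>t. a t - b t) -` (- {0})"
    using open_contains_ball by blast
  have sub: "{t - e<..<t + e} \<subseteq> {p<..<q} \<inter> (\<lambda>t. a t - b t) -` (- {0})"
    using e(2) by (simp add: ball_eq_greaterThanLessThan)
  have "AE s in lborel. s \<in> {t - e<..<t + e} \<longrightarrow> a s = b s"
    by (rule eventually_mono[OF ae]) (use sub in auto)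
  then obtain s where "s \<in> {t - e<..<t + e}" "a s = b s"
    by (rule AE_interval_nonempty) (use e(1) in simp, rule that)
  with sub show False by auto
qed

text \<open>Here \<open>w = r\<^sup>N\<^sup>-\<^sup>1 |U'|\<^sup>N\<^sup>-\<^sup>2 U'\<close>.\<close>

lemma solution_local_ode:
  fixes u :: "real^'n \<Rightarrow> real" and f U :: "real \<Rightarrow> real"
  defines "N \<equiv> CARD('n)"
  assumes N2: "N \<ge> 2" and pq: "0 < p" "p < q" "q < R" and fc: "continuous_on {0..} f"
    and sol: "solution f R u"
    and uU: "\<And>x. x \<in> ball 0 R - {0} \<Longrightarrow> u x = U (norm x)"
    and Uc: "continuous_on {0<..<R} U" and U0: "\<And>r. r \<in> {0<..<R} \<Longrightarrow> 0 \<le> U r"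
  shows "\<exists>w. \<forall>t\<in>{p<..<q}. (U has_real_derivative flux_inv N (w t) / t) (at t) \<and>
    (w has_real_derivative - (t ^ (N - 1) * f (U t))) (at t)"
proof -
  let ?\<Omega> = "ball 0 R - {0::real^'n}" and ?A = "{x::real^'n. p < norm x \<and> norm x < q}"
  have A\<Omega>: "?A \<subseteq> ?\<Omega>" using pq by auto
  obtain g where wg: "has_weak_gradient ?\<Omega> u g"
    and gN: "locally_integrable ?\<Omega> (\<lambda>x. norm (g x) ^ (N - 1))"
    and pde: "\<And>\<phi>. test_function ?\<Omega> \<phi> \<Longrightarrow>
        (LINT x:?\<Omega>|lebesgue. norm (g x) ^ (N - 2) * (g x \<bullet> gradient \<phi> x)) =
        (LINT x:?\<Omega>|lebesgue. f (u x) * \<phi> x)"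
    using sol unfolding solution_def Let_def N_def by blast
  define a where "a = real N * unit_ball_vol (real N)"
  have a: "a > 0" using N2 by (simp add: a_def)
  have pqR: "{p..q} \<subseteq> {0<..<R}" "{p<..<q} \<subseteq> {p..q}" using pq by auto
  have Upq: "continuous_on {p..q} U" by (rule continuous_on_subset[OF Uc pqR(1)])
  define V where "V = (\<lambda>t. indicator {p<..<q} t * U t)"
  have Vm: "V \<in> borel_measurable borel"
    unfolding V_def using borel_measurable_continuous_on_indicator[OF _ continuous_on_subset[OF Upq pqR(2)]]
    by simp
  have "bounded (U ` {p..q})" by (intro compact_imp_bounded compact_continuous_image Upq) simp
  then obtain M where "\<forall>x\<in>U ` {p..q}. norm x \<le> M" unfolding bounded_iff ..
  then have M: "\<bar>U t\<bar> \<le> M" if "t \<in> {p..q}" for t using that by simp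
  have VM: "\<bar>V t\<bar> \<le> \<bar>M\<bar>" for t using M[of t] by (auto simp: V_def indicator_def)
  obtain y C where y: "integrable lborel y" "\<And>t. t \<notin> {p<..<q} \<Longrightarrow> y t = 0"
    and VC: "AE t in lborel. t \<in> {p<..<q} \<longrightarrow> V t = C + primitive y t"
    and gy: "AE x in lebesgue. p < norm x \<and> norm x < q \<longrightarrow> g x = (y (norm x) / norm x) *\<^sub>R x"
  proof (rule weak_gradient_radial[OF pq wg _ Vm VM])
    show "u x = V (norm x)" if "p < norm x" "norm x < q" for x
    proof -
      have "x \<in> ?\<Omega>" using that pq by auto
      with uU[of x] that show ?thesis by (simp add: V_def)
    qed
    show "V t = 0" if "t \<notin> {p<..<q}" for t using that by (simp add: V_def)
  qed (rule that)
  have ym[measurable]: "y \<in> borel_measurable borel" using y(1) by auto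
  have fluxm[measurable]: "flux N \<in> borel_measurable borel" unfolding flux_def[abs_def] by measurable
  \<comment> \<open>The quantity whose derivative the equation prescribes. It is integrable because
    a |m| is the radial density of |g|^(N-1) on the annulus.\<close>
  define m where "m = (\<lambda>t. t ^ (N - 1) * flux N (y t))"
  have gA: "integrable lebesgue (\<lambda>x. indicator ?A x * norm (g x) ^ (N - 1))"
  proof -
    have "{x::real^'n. p \<le> norm x \<and> norm x \<le> q} \<subseteq> ?\<Omega>" using pq by auto
    with gN compact_annulus have "(\<lambda>x. norm (g x) ^ (N - 1)) absolutely_integrable_on {x::real^'n. p \<le> norm x \<and> norm x \<le> q}"
      unfolding locally_integrable_def by blast
    then have "(\<lambda>x. norm (g x) ^ (N - 1)) absolutely_integrable_on ?A"
      by (rule set_integrable_subset) auto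
    then show ?thesis by (simp add: set_integrable_def)
  qed
  have m: "integrable lborel m"
  proof -
    have "integrable lebesgue (\<lambda>x::real^'n. \<bar>y (norm x)\<bar> ^ (N - 1))"
    proof (rule integrable_cong_AE_imp[OF gA])
      have "(\<lambda>r. \<bar>y r\<bar> ^ (N - 1)) \<in> borel_measurable borel" by measurable
      from measurable_compose[OF norm_measurable_lebesgue this]
      show "(\<lambda>x::real^'n. \<bar>y (norm x)\<bar> ^ (N - 1)) \<in> borel_measurable lebesgue" .
      show "AE x in lebesgue. indicator ?A x * norm (g x) ^ (N - 1) = \<bar>y (norm x)\<bar> ^ (N - 1)"
        using gy
      proof eventually_elim
        case (elim x)
        have "y (norm x) = 0" if "x \<notin> ?A" using y(2)[of "norm x"] that by auto
        with elim N2 pq show ?case by (cases "x \<in> ?A") (auto simp: power_0_left)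
      qed
    qed
    then have i: "integrable lborel (\<lambda>r. sphere_area N r * \<bar>y r\<bar> ^ (N - 1))"
      unfolding N_def by (subst (asm) radial_integral(1)) simp_all
    show ?thesis
    proof (rule Bochner_Integration.integrable_bound)
      show "integrable lborel (\<lambda>r. (1 / a) * (sphere_area N r * \<bar>y r\<bar> ^ (N - 1)))" using i by simp
      show "m \<in> borel_measurable lborel" unfolding m_def by measurable
      show "AE r in lborel. norm (m r) \<le> norm ((1 / a) * (sphere_area N r * \<bar>y r\<bar> ^ (N - 1)))"
      proof (rule AE_I2)
        fix r
        show "norm (m r) \<le> norm ((1 / a) * (sphere_area N r * \<bar>y r\<bar> ^ (N - 1)))"
        proof (cases "r \<in> {p<..<q}")
          case True
          then have "sphere_area N r = a * r ^ (N - 1)" "r > 0" using pq by (auto simp: sphere_area_def a_def)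
          then show ?thesis using a abs_flux[OF N2, of "y r"] by (simp add: m_def abs_mult)
        next
          case False
          then show ?thesis using y(2)[of r] by (simp add: m_def flux_def)
        qed
      qed
    qed
  qed
  define c where "c = (\<lambda>t. - (t ^ (N - 1) * f (U t)))"
  have cc: "continuous_on {p..q} c"
    unfolding c_def
    by (intro continuous_intros continuous_on_compose2[OF fc Upq]) (use U0 pqR in auto)
  define ci where "ci = (\<lambda>t. indicator {p<..<q} t * c t)"
  have ci: "integrable lborel ci"
  proof -
    have "integrable lborel (\<lambda>t. indicator {p<..<q} t *\<^sub>R (indicator {p..q} t *\<^sub>R c t))"
      by (rule integrable_mult_indicator[OF _ borel_integrable_compact[OF compact_Icc cc]]) simp
    also have "(\<lambda>t. indicator {p<..<q} t *\<^sub>R (indicator {p..q} t *\<^sub>R c t)) = ci"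
      by (auto simp: ci_def indicator_def fun_eq_iff)
    finally show ?thesis .
  qed
  then have cim[measurable]: "ci \<in> borel_measurable borel" by auto
  have "\<exists>D. AE t in lborel. t \<in> {p<..<q} \<longrightarrow> m t = D + primitive ci t"
  proof (rule du_bois_reymond[OF pq(2) m ci])
    fix \<theta> \<theta>' assume \<theta>: "test_real p q \<theta>" "\<And>t. (\<theta> has_real_derivative \<theta>' t) (at t)"
    have t': "test_real p q \<theta>'" by (rule test_real_derivative[OF \<theta>])
    have [measurable]: "\<theta> \<in> borel_measurable borel" "\<theta>' \<in> borel_measurable borel"
      using test_real_integrable[OF \<theta>(1)] test_real_integrable[OF t'] by auto
    have z: "\<theta> t = 0" "\<theta>' t = 0" if "t \<notin> {p<..<q}" for t
      using \<theta>(1) t' that unfolding test_real_def by force+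
    let ?\<phi> = "\<lambda>x::real^'n. \<theta> (norm x)"
    have t\<phi>: "test_function ?\<Omega> ?\<phi>"
      by (rule test_real_in_annulus(1)[OF \<theta>(1)]) (use pq in auto)
    \<comment> \<open>\<open>ci\<close> already contains the weight r^(N-1), which is divided out to
      recover f(u) \<phi> as a function on space; the surface area restores it.\<close>
    let ?L = "\<lambda>r. flux N (y r) * \<theta>' r" and ?R = "\<lambda>r. if r > 0 then - (ci r * \<theta> r) / r ^ (N - 1) else 0"
    have "?L \<in> borel_measurable borel" by measurable
    have L1: "(LINT x:?\<Omega>|lebesgue. norm (g x) ^ (N - 2) * (g x \<bullet> gradient ?\<phi> x)) = (LINT x::real^'n|lebesgue. ?L (norm x))"
      unfolding set_lebesgue_integral_def
    proof (rule integral_cong_AE)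
      have "(\<lambda>r. ?L r) \<in> borel_measurable borel" by measurable
      from measurable_compose[OF norm_measurable_lebesgue this]
      show m2: "(\<lambda>x::real^'n. ?L (norm x)) \<in> borel_measurable lebesgue" .
      show ae: "AE x in lebesgue. indicator ?\<Omega> x *\<^sub>R (norm (g x) ^ (N - 2) * (g x \<bullet> gradient ?\<phi> x)) = ?L (norm x)"
        using gy
      proof eventually_elim
        case (elim x)
        show ?case
        proof (cases "x = 0")
          case True
          then show ?thesis using z(2)[of 0] pq by simp
        next
          case False
          note gr = gradient_radial[OF \<theta>(2) False]
          show ?thesis
          proof (cases "x \<in> ?A")
            case True
            with elim have gx: "g x = (y (norm x) / norm x) *\<^sub>R x" by simp
            have "norm (g x) = \<bar>y (norm x)\<bar>" using False by (simp add: gx)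
            moreover have "g x \<bullet> gradient ?\<phi> x = y (norm x) * \<theta>' (norm x)"
              using False by (simp add: gx gr power2_norm_eq_inner[symmetric] power2_eq_square)
            moreover have "x \<in> ?\<Omega>" using A\<Omega> True by blast
            ultimately show ?thesis by (simp add: flux_def)
          next
            case A: False
            then have "\<theta>' (norm x) = 0" using z(2)[of "norm x"] by auto
            then show ?thesis by (simp add: gr)
          qed
        qed
      qed
      \<comment> \<open>Measurability is inherited from the radial integrand through the almost
        everywhere identity.\<close>
      show "(\<lambda>x. indicator ?\<Omega> x *\<^sub>R (norm (g x) ^ (N - 2) * (g x \<bullet> gradient ?\<phi> x))) \<in> borel_measurable lebesgue"
        by (rule borel_measurable_AE[OF m2]) (use ae in \<open>auto elim!: eventually_mono\<close>)
    qed
    have "(LINT x:?\<Omega>|lebesgue. f (u x) * ?\<phi> x) = (LINT x::real^'n|lebesgue. ?R (norm x))"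
      unfolding set_lebesgue_integral_def
    proof (rule Bochner_Integration.integral_cong[OF refl])
      fix x :: "real^'n"
      show "indicator ?\<Omega> x *\<^sub>R (f (u x) * ?\<phi> x) = ?R (norm x)"
      proof (cases "x \<in> ?A")
        case True
        with A\<Omega> have "x \<in> ?\<Omega>" by blast
        with True uU[of x] pq show ?thesis by (auto simp: ci_def c_def)
      next
        case False
        then show ?thesis using z(1)[of "norm x"] by auto
      qed
    qed
    with pde[OF t\<phi>] L1 have "(LINT x::real^'n|lebesgue. ?L (norm x)) = (LINT x::real^'n|lebesgue. ?R (norm x))" by simp
    then have "(LINT r|lborel. sphere_area N r * ?L r) = (LINT r|lborel. sphere_area N r * ?R r)"
      unfolding N_def by (subst (asm) (1 2) radial_integral(2)) (simp_all add: N_def[symmetric])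
    also have "(\<lambda>r. sphere_area N r * ?L r) = (\<lambda>r. a * (\<theta>' r * m r))"
      using z(2) pq by (auto simp: fun_eq_iff sphere_area_def a_def m_def not_less)
    also have "(\<lambda>r. sphere_area N r * ?R r) = (\<lambda>r. - a * (\<theta> r * ci r))"
      using z(1) pq by (auto simp: fun_eq_iff sphere_area_def a_def not_less)
    finally have "a * ((LINT r|lborel. \<theta>' r * m r) + (LINT r|lborel. \<theta> r * ci r)) = 0"
      by (simp add: distrib_left)
    then show "(LINT t|lborel. \<theta>' t * m t) = - (LINT t|lborel. \<theta> t * ci t)" using a by simp
  qed
  then obtain D where D: "AE t in lborel. t \<in> {p<..<q} \<longrightarrow> m t = D + primitive ci t" ..
  define w where "w = (\<lambda>t. D + primitive ci t)"
  have cic: "continuous_on {p<..<q} ci"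
    by (rule continuous_on_eq[OF continuous_on_subset[OF cc pqR(2)]]) (simp add: ci_def)
  have wd: "(w has_real_derivative - (t ^ (N - 1) * f (U t))) (at t)" if t: "t \<in> {p<..<q}" for t
    using DERIV_add[OF DERIV_const[of D] integral_indicator_has_derivative[OF ci cic t]] t
    by (simp add: w_def ci_def c_def)
  have wc: "continuous_on {p<..<q} w"
    by (rule continuous_at_imp_continuous_on) (intro ballI DERIV_isCont[OF wd])
  \<comment> \<open>The continuous representative of \<open>y\<close>: almost everywhere w = t^(N-1)
    flux(y) = flux(t y), which is solved for y.\<close>
  define y' where "y' = (\<lambda>t. indicator {p<..<q} t * (flux_inv N (w t) / t))"
  have y'c0: "continuous_on {p<..<q} (\<lambda>t. flux_inv N (w t) / t)"
    by (intro continuous_intros continuous_on_compose2[OF continuous_flux_inv[OF N2] wc]) (use pq in auto)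
  then have y'c: "continuous_on {p<..<q} y'"
    by (rule continuous_on_eq) (simp add: y'_def)
  have y'm: "y' \<in> borel_measurable borel"
    unfolding y'_def using borel_measurable_continuous_on_indicator[OF _ y'c0] by simp
  have yy': "AE t in lborel. y t = y' t"
    using D
  proof eventually_elim
    case (elim t)
    show ?case
    proof (cases "t \<in> {p<..<q}")
      case True
      with elim have "flux N (t * y t) = w t" using pq flux_mult[OF N2, of t "y t"] by (simp add: m_def w_def)
      then have "flux_inv N (w t) = t * y t" using flux_inv_flux[OF N2] by metis
      with True pq show ?thesis by (simp add: y'_def)
    qed (use y(2)[of t] in \<open>simp add: y'_def\<close>)
  qed
  have y': "integrable lborel y'" by (rule integrable_cong_AE_imp[OF y(1) _ yy']) (use y'm in simp)
  have Yeq: "primitive y t = primitive y' t" for t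
    by (rule integral_cong_AE) (use y'm yy' in \<open>auto elim!: eventually_mono\<close>)
  define Y where "Y = (\<lambda>t. C + primitive y' t)"
  have Yd: "(Y has_real_derivative flux_inv N (w t) / t) (at t)" if t: "t \<in> {p<..<q}" for t
    using DERIV_add[OF DERIV_const[of C] integral_indicator_has_derivative[OF y' y'c t]] t
    by (simp add: Y_def y'_def)
  have Yc: "continuous_on {p<..<q} Y"
    by (rule continuous_at_imp_continuous_on) (intro ballI DERIV_isCont[OF Yd])
  have "AE t in lborel. t \<in> {p<..<q} \<longrightarrow> U t = Y t"
    using VC by eventually_elim (simp add: V_def Yeq Y_def)
  then have UY: "U t = Y t" if "t \<in> {p<..<q}" for t
    by (rule AE_eq_continuous[OF _ continuous_on_subset[OF Upq pqR(2)] Yc that])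
  have Ud: "(U has_real_derivative flux_inv N (w t) / t) (at t)" if t: "t \<in> {p<..<q}" for t
  proof -
    have "\<forall>\<^sub>F s in nhds t. U s = Y s"
      using eventually_nhds_in_open[of "{p<..<q}" t] t UY by (auto elim!: eventually_mono)
    from DERIV_cong_ev[OF refl this refl] Yd[OF t] show ?thesis by simp
  qed
  show ?thesis using Ud wd by blast
qed

text \<open>The local functions glue because each is determined by \<open>U\<close>: inverting the
  first equation gives t^(N-1) flux(U'), an expression independent of the subinterval, and this is
  taken as the global \<open>w\<close>.\<close>

lemma solution_ode:
  fixes u :: "real^'n \<Rightarrow> real" and f U :: "real \<Rightarrow> real"
  defines "N \<equiv> CARD('n)"
  assumes N2: "N \<ge> 2" and fc: "continuous_on {0..} f"
    and sol: "solution f R u"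
    and uU: "\<And>x. x \<in> ball 0 R - {0} \<Longrightarrow> u x = U (norm x)"
    and Uc: "continuous_on {0<..<R} U" and U0: "\<And>r. r \<in> {0<..<R} \<Longrightarrow> 0 \<le> U r"
  obtains w where "\<And>t. t \<in> {0<..<R} \<Longrightarrow> (U has_real_derivative flux_inv N (w t) / t) (at t)"
    "\<And>t. t \<in> {0<..<R} \<Longrightarrow> (w has_real_derivative - (t ^ (N - 1) * f (U t))) (at t)"
proof -
  define w where "w = (\<lambda>t. t ^ (N - 1) * flux N (deriv U t))"
  have "(U has_real_derivative flux_inv N (w t) / t) (at t) \<and>
      (w has_real_derivative - (t ^ (N - 1) * f (U t))) (at t)" if t: "t \<in> {0<..<R}" for t
  proof -
    define p q where "p = t / 2" and "q = (t + R) / 2"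
    have pq: "0 < p" "p < q" "q < R" "t \<in> {p<..<q}" using t by (auto simp: p_def q_def field_simps)
    obtain w' where w': "\<And>s. s \<in> {p<..<q} \<Longrightarrow> (U has_real_derivative flux_inv N (w' s) / s) (at s) \<and>
        (w' has_real_derivative - (s ^ (N - 1) * f (U s))) (at s)"
      using solution_local_ode[OF N2[unfolded N_def] pq(1-3) fc sol uU Uc U0] unfolding N_def by blast
    have eq: "w s = w' s" if s: "s \<in> {p<..<q}" for s
    proof -
      have "deriv U s = flux_inv N (w' s) / s" using w'[OF s] DERIV_imp_deriv by blast
      then have "s * deriv U s = flux_inv N (w' s)" using s pq by simp
      then have "flux N (s * deriv U s) = w' s" using flux_flux_inv[OF N2] by simp
      then show ?thesis using s pq flux_mult[OF N2, of s] by (simp add: w_def)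
    qed
    have ev: "\<forall>\<^sub>F s in nhds t. w s = w' s"
      using eventually_nhds_in_open[of "{p<..<q}" t] pq eq by (auto elim!: eventually_mono)
    show ?thesis using w'[OF pq(4)] eq[OF pq(4)] DERIV_cong_ev[OF refl ev refl] by simp
  qed
  then show ?thesis using that by blast
qed

lemma flux_inv_mono:
  assumes "N \<ge> 2" "x \<le> z" shows "flux_inv N x \<le> flux_inv N z"
proof -
  have e: "0 \<le> 1 / (real N - 1)" using assms(1) by simp
  consider "0 < x" | "z < 0" | "x \<le> 0" "0 \<le> z" by linarith
  then show ?thesis
  proof cases
    case 1 with assms e show ?thesis by (simp add: flux_inv_def powr_mono2)
  next
    case 2 with assms e show ?thesis by (simp add: flux_inv_def powr_mono2)
  next
    case 3
    then have "flux_inv N x \<le> 0" "0 \<le> flux_inv N z" by (auto simp: flux_inv_def sgn_if)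
    then show ?thesis by linarith
  qed
qed

lemma flux_inv_pos: "x > 0 \<Longrightarrow> flux_inv N x = x powr (1 / (real N - 1))"
  by (simp add: flux_inv_def)

section \<open>Asymptotics of the radial equation\<close>

text \<open>One point t0 with f(t0) \<ge> M exp(\<beta> t0) is enough: the power inequality with
  \<lambda> = x / t0 carries the bound to every x \<ge> t0 + 1. The choice M = max 1 c gives M \<le>
  M^\<lambda> and absorbs the constant c.\<close>

lemma super_exponential_lower_bound:
  assumes super: "super_exponential f" and f0: "\<And>t. t \<ge> 0 \<Longrightarrow> 0 \<le> f t"
    and pb: "\<And>l t. l > 1 \<Longrightarrow> t \<ge> 0 \<Longrightarrow> f t powr l \<le> c * f (l * t)" and c: "c > 0" and \<beta>: "\<beta> > 0"
  obtains X where "\<And>x. x \<ge> X \<Longrightarrow> exp (\<beta> * x) \<le> f x"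
proof -
  define M where "M = max 1 c"
  have "\<not> bdd_above ((\<lambda>t. f t * exp (- \<beta> * t)) ` {0..})"
    using super \<beta> unfolding super_exponential_def sub_exponential_def by blast
  \<comment> \<open>Exceeding f(0) as well excludes t0 = 0, so that x / t0 makes sense.\<close>
  then obtain t0 where t0: "t0 \<ge> 0" "f t0 * exp (- \<beta> * t0) > max M (f 0)"
    unfolding bdd_above_def by (auto simp: not_le dest!: spec[of _ "max M (f 0)"])
  have pos: "t0 > 0" using t0 by (cases "t0 = 0") auto
  have ft0: "f t0 \<ge> M * exp (\<beta> * t0)"
    using t0(2) by (simp add: exp_minus field_simps)
  have "exp (\<beta> * x) \<le> f x" if x: "x \<ge> t0 + 1" for x
  proof -
    define l where "l = x / t0"
    have l: "l > 1" "l * t0 = x" using x pos by (auto simp: l_def)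
    have "M * exp (\<beta> * x) \<le> M powr l * exp (\<beta> * t0) powr l"
    proof -
      have "M \<le> M powr l" using l powr_mono[of 1 l M] by (simp add: M_def)
      moreover have "exp (\<beta> * t0) powr l = exp (\<beta> * x)" using l by (simp add: powr_def algebra_simps)
      ultimately show ?thesis by simp
    qed
    also have "\<dots> = (M * exp (\<beta> * t0)) powr l" by (simp add: powr_mult M_def)
    also have "\<dots> \<le> f t0 powr l" by (rule powr_mono2) (use l ft0 in \<open>auto simp: M_def\<close>)
    also have "\<dots> \<le> c * f x" using pb[of l t0] l pos by simp
    also have "\<dots> \<le> M * f x" using f0[of x] x pos by (intro mult_right_mono) (auto simp: M_def)
    finally show ?thesis by (simp add: M_def mult_le_cancel_left)
  qed
  then show ?thesis by (rule that)
qed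

text \<open>The radial equation in the variable \<open>t = - ln r\<close>, with \<open>v(t) = U(r)\<close> and \<open>y = |v'|\<^sup>N\<^sup>-\<^sup>2 v'\<close>.\<close>

locale log_radial_ode =
  fixes N :: nat and f F v y :: "real \<Rightarrow> real" and c \<kappa> T :: real
  assumes N2: "N \<ge> 2" and f0: "\<And>t. t \<ge> 0 \<Longrightarrow> 0 \<le> f t"
    and super: "super_exponential f"
    and \<kappa>: "\<kappa> \<ge> 0" and F: "\<And>t. t \<ge> 0 \<Longrightarrow> F t = f t + \<kappa> * t ^ (N - 1)"
    and F_strict: "strict_mono_on {0..} F" and c: "c > 0"
    and pb: "\<And>l t. l > 1 \<Longrightarrow> t \<ge> 0 \<Longrightarrow> f t powr l \<le> c * f (l * t)"
    and v0: "\<And>t. t > T \<Longrightarrow> 0 \<le> v t"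
    and v': "\<And>t. t > T \<Longrightarrow> (v has_real_derivative flux_inv N (y t)) (at t)"
    and y': "\<And>t. t > T \<Longrightarrow> (y has_real_derivative - (exp (- real N * t) * f (v t))) (at t)"
    and unbounded: "\<And>M. \<exists>t>T. v t > M"
begin

section \<open>Monotonicity and growth\<close>

lemma y_antimono: assumes "T < s" "s \<le> t" shows "y t \<le> y s"
proof (rule DERIV_nonpos_imp_nonincreasing[OF assms(2)])
  fix r assume "s \<le> r" "r \<le> t"
  then have r: "r > T" using assms(1) by simp
  have "- (exp (- real N * r) * f (v r)) \<le> 0" using f0[OF v0[OF r]] by simp
  with y'[OF r] show "\<exists>d. (y has_real_derivative d) (at r) \<and> d \<le> 0" by blast
qed

text \<open>Once \<open>y\<close> is negative it stays below that value, so \<open>v\<close>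
  decreases at least at the fixed rate \<sigma> and would become negative within time (v(t) + 1) /
  \<sigma>.\<close>

lemma y_nonneg: assumes "t > T" shows "y t \<ge> 0"
proof (rule ccontr)
  assume "\<not> y t \<ge> 0"
  then have yt: "y t < 0" by simp
  define \<sigma> where "\<sigma> = - flux_inv N (y t)"
  have \<sigma>: "\<sigma> > 0" using yt by (simp add: \<sigma>_def flux_inv_def)
  have "v s + \<sigma> * s \<le> v t + \<sigma> * t" if "s \<ge> t" for s
  proof (rule DERIV_nonpos_imp_nonincreasing[OF that])
    fix r assume r: "t \<le> r" "r \<le> s"
    have "((\<lambda>s. v s + \<sigma> * s) has_real_derivative flux_inv N (y r) + \<sigma>) (at r)"
      using assms r by (auto intro!: derivative_eq_intros v')
    moreover have "flux_inv N (y r) + \<sigma> \<le> 0"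
      using flux_inv_mono[OF N2 y_antimono[OF assms r(1)]] by (simp add: \<sigma>_def)
    ultimately show "\<exists>d. ((\<lambda>s. v s + \<sigma> * s) has_real_derivative d) (at r) \<and> d \<le> 0" by blast
  qed
  from this[of "t + (v t + 1) / \<sigma>"]
  have "v (t + (v t + 1) / \<sigma>) + \<sigma> * (t + (v t + 1) / \<sigma>) \<le> v t + \<sigma> * t"
    using \<sigma> v0[OF assms] by simp
  moreover have "\<sigma> * (t + (v t + 1) / \<sigma>) = \<sigma> * t + (v t + 1)" using \<sigma> by (simp add: field_simps)
  ultimately have "v (t + (v t + 1) / \<sigma>) \<le> -1" by linarith
  moreover have "v (t + (v t + 1) / \<sigma>) \<ge> 0" using \<sigma> v0[OF assms] assms by (intro v0) (simp add: add_pos_nonneg less_le_trans)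
  ultimately show False by simp
qed

lemma v_mono: assumes "T < s" "s \<le> t" shows "v s \<le> v t"
proof (rule DERIV_nonneg_imp_nondecreasing[OF assms(2)])
  fix r assume "s \<le> r" "r \<le> t"
  then have r: "r > T" using assms by simp
  have "flux_inv N (y r) \<ge> 0" using y_nonneg[OF r] by (simp add: flux_inv_def sgn_if)
  with v'[OF r] show "\<exists>d. (v has_real_derivative d) (at r) \<and> 0 \<le> d" by blast
qed

lemma v_at_top: "filterlim v at_top at_top"
  unfolding filterlim_at_top
proof
  fix M
  obtain t where t: "t > T" "v t > M" using unbounded by blast
  show "\<forall>\<^sub>F s in at_top. M \<le> v s"
    using eventually_ge_at_top[of t] by eventually_elim (use v_mono[OF t(1)] t(2) in force)
qed

lemma f_lower: assumes "\<beta> > 0" shows "\<forall>\<^sub>F x in at_top. exp (\<beta> * x) \<le> f x"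
proof -
  obtain X where "\<And>x. x \<ge> X \<Longrightarrow> exp (\<beta> * x) \<le> f x"
    using super_exponential_lower_bound[OF super f0 pb c assms] by blast
  then show ?thesis by (rule eventually_at_top_linorderI)
qed

text \<open>If \<open>y\<close> stayed away from zero, \<open>v\<close> would grow linearly and \<open>f(v)\<close> faster than \<open>exp (N t)\<close>.\<close>

lemma y_small: assumes "\<epsilon> > 0" shows "\<forall>\<^sub>F t in at_top. y t < \<epsilon>"
proof -
  have "\<exists>t>T. y t < \<epsilon>"
  proof (rule ccontr)
    assume "\<not> (\<exists>t>T. y t < \<epsilon>)"
    then have ge: "y t \<ge> \<epsilon>" if "t > T" for t using that not_le by blast
    define \<sigma> where "\<sigma> = flux_inv N \<epsilon>"
    have \<sigma>: "\<sigma> > 0" using assms by (simp add: \<sigma>_def flux_inv_def)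
    define t1 where "t1 = max T 0 + 1"
    have t1: "t1 > T" "t1 > 0" by (auto simp: t1_def)
    have vlow: "v t \<ge> \<sigma> * (t - t1)" if "t \<ge> t1" for t
    proof -
      have "v t1 - \<sigma> * t1 \<le> v t - \<sigma> * t"
      proof (rule DERIV_nonneg_imp_nondecreasing[OF that])
        fix r assume r: "t1 \<le> r" "r \<le> t"
        have "((\<lambda>s. v s - \<sigma> * s) has_real_derivative flux_inv N (y r) - \<sigma>) (at r)"
          using t1 r by (auto intro!: derivative_eq_intros v')
        moreover have "flux_inv N (y r) - \<sigma> \<ge> 0"
          using flux_inv_mono[OF N2 ge[of r]] t1 r by (simp add: \<sigma>_def)
        ultimately show "\<exists>d. ((\<lambda>s. v s - \<sigma> * s) has_real_derivative d) (at r) \<and> 0 \<le> d" by blast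
      qed
      then show ?thesis using v0[OF t1(1)] by (simp add: algebra_simps)
    qed
    \<comment> \<open>Since v(t) \<ge> \<sigma> (t - t1), the exponent 2 N / \<sigma> gives f(v(t))
      \<ge> exp(2 N (t - t1)), twice the rate needed to beat exp(-N t).\<close>
    have "\<forall>\<^sub>F t in at_top. exp (2 * real N / \<sigma> * v t) \<le> f (v t)"
      by (rule eventually_compose_filterlim[OF f_lower v_at_top]) (use N2 \<sigma> in simp)
    then obtain t2 where t2: "\<And>t. t \<ge> t2 \<Longrightarrow> exp (2 * real N / \<sigma> * v t) \<le> f (v t)"
      unfolding eventually_at_top_linorder by blast
    \<comment> \<open>For r \<ge> 2 t1 the resulting bound exp(N (r - 2 t1)) on -y'(r) is at least
      1, so \<open>y\<close> would become negative in finite time.\<close>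
    define t3 where "t3 = max t2 (2 * t1)"
    have t3: "t3 > T" "t3 \<ge> t1" "t3 \<ge> 2 * t1" "t3 \<ge> t2" using t1 by (auto simp: t3_def)
    have "y s + s \<le> y t3 + t3" if "s \<ge> t3" for s
    proof (rule DERIV_nonpos_imp_nonincreasing[OF that])
      fix r assume r: "t3 \<le> r" "r \<le> s"
      have "((\<lambda>s. y s + s) has_real_derivative - (exp (- real N * r) * f (v r)) + 1) (at r)"
        using t3 r by (auto intro!: derivative_eq_intros y')
      moreover have "exp (- real N * r) * f (v r) \<ge> 1"
      proof -
        have "2 * real N * (r - t1) \<le> 2 * real N / \<sigma> * v r"
          using mult_left_mono[OF vlow[of r], of "2 * real N / \<sigma>"] \<sigma> r t3 by simp
        then have "exp (2 * real N * (r - t1)) \<le> f (v r)"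
          using t2[of r] r t3 by (meson exp_le_cancel_iff order_trans)
        then have "exp (- real N * r) * exp (2 * real N * (r - t1)) \<le> exp (- real N * r) * f (v r)"
          by (rule mult_left_mono) simp
        moreover have "exp (- real N * r) * exp (2 * real N * (r - t1)) = exp (real N * (r - 2 * t1))"
          by (simp add: exp_add[symmetric] algebra_simps)
        moreover have "exp (real N * (r - 2 * t1)) \<ge> 1" using r t3 by simp
        ultimately show ?thesis by linarith
      qed
      then have "- (exp (- real N * r) * f (v r)) + 1 \<le> 0" by linarith
      ultimately show "\<exists>d. ((\<lambda>s. y s + s) has_real_derivative d) (at r) \<and> d \<le> 0" by blast
    qed
    from this[of "t3 + y t3 + 1"] have "y (t3 + y t3 + 1) \<le> -1" using y_nonneg[OF t3(1)] by simp
    moreover have "y (t3 + y t3 + 1) \<ge> 0" using y_nonneg[OF t3(1)] t3 by (intro y_nonneg) simp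
    ultimately show False by simp
  qed
  then obtain t where t: "t > T" "y t < \<epsilon>" by blast
  show ?thesis using eventually_ge_at_top[of t]
    by eventually_elim (use y_antimono[OF t(1)] t(2) in force)
qed

section \<open>Comparison of the solution with the inverse of \<open>F\<close>\<close>

lemma f_le_F: "x \<ge> 0 \<Longrightarrow> f x \<le> F x"
  using F \<kappa> by simp

lemma F_mono: "0 \<le> x \<Longrightarrow> x \<le> z \<Longrightarrow> F x \<le> F z"
  using strict_mono_on_leD[OF F_strict] by simp

text \<open>The added power is eventually below exp(x), which is eventually below f(x).\<close>

lemma F_le_twice_f: "\<forall>\<^sub>F x in at_top. F x \<le> 2 * f x"
proof -
  have "((\<lambda>x. \<kappa> * (x ^ (N - 1) / exp x)) \<longlongrightarrow> \<kappa> * 0) at_top"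
    by (intro tendsto_mult tendsto_const tendsto_power_div_exp_0)
  then have "\<forall>\<^sub>F x in at_top. \<kappa> * (x ^ (N - 1) / exp x) < 1"
    by (rule order_tendstoD) simp
  moreover have "\<forall>\<^sub>F x in at_top. exp (1 * x) \<le> f x" by (rule f_lower) simp
  ultimately show ?thesis using eventually_ge_at_top[of 0]
  proof eventually_elim
    case (elim x)
    then have "\<kappa> * x ^ (N - 1) \<le> exp x" by (simp add: field_simps)
    with elim show ?case by (simp add: F)
  qed
qed

text \<open>Compare \<open>F(v(t))\<close> with the decrease of \<open>y\<close> over \<open>[t, t + 1]\<close>.\<close>

lemma eventually_F_le: "\<forall>\<^sub>F t in at_top. F (v t) \<le> exp (real N * t)"
proof -
  have "\<forall>\<^sub>F t in at_top. F (v t) \<le> 2 * f (v t)"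
    by (rule eventually_compose_filterlim[OF F_le_twice_f v_at_top])
  then obtain t2 where t2: "\<And>t. t \<ge> t2 \<Longrightarrow> F (v t) \<le> 2 * f (v t)"
    unfolding eventually_at_top_linorder by blast
  \<comment> \<open>The factor exp(-N) compensates for evaluating the exponential at the right end t
    + 1, the factor 1/2 for replacing f by F.\<close>
  have "\<forall>\<^sub>F t in at_top. y t < exp (- real N) / 2" by (rule y_small) simp
  then show ?thesis
    using eventually_gt_at_top[of T] eventually_ge_at_top[of t2]
  proof eventually_elim
    case (elim t)
    obtain z where z: "t < z" "z < t + 1"
      "y (t + 1) - y t = (t + 1 - t) * - (exp (- real N * z) * f (v z))"
      using MVT2[of t "t + 1" y "\<lambda>z. - (exp (- real N * z) * f (v z))"] y' elim(2) by auto
    have "exp (- real N * (t + 1)) * (F (v t) / 2) \<le> exp (- real N * z) * f (v z)"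
    proof (rule mult_mono)
      have "F (v t) \<le> F (v z)" using v0[OF elim(2)] v_mono[OF elim(2)] z by (intro F_mono) auto
      also have "\<dots> \<le> 2 * f (v z)" using t2 z elim(3) by simp
      finally show "F (v t) / 2 \<le> f (v z)" by simp
      show "0 \<le> F (v t) / 2" using f0[OF v0[OF elim(2)]] f_le_F[OF v0[OF elim(2)]] by simp
    qed (use z N2 in auto)
    also have "\<dots> \<le> y t" using z y_nonneg[of "t + 1"] elim(2) by simp
    also have "\<dots> \<le> exp (- real N) / 2" using elim(1) by simp
    finally have "exp (- real N) * (exp (- (real N * t)) * F (v t)) \<le> exp (- real N) * 1"
      by (simp add: exp_add[symmetric] algebra_simps)
    then have "exp (- (real N * t)) * F (v t) \<le> 1" by (simp only: mult_le_cancel_left) simp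
    then show ?case by (simp add: exp_minus field_simps)
  qed
qed

text \<open>
  Otherwise the power inequality for \<open>f\<close> gives \<open>f(v) \<le> C exp (a N t)\<close>, so \<open>y\<close> and \<open>v'\<close> decay
  exponentially and \<open>v\<close> is bounded.
\<close>

lemma frequently_F_gt:
  assumes a: "0 < a" "a < 1"
  shows "\<exists>\<^sub>F t in at_top. F (v t / a) > exp (real N * t)"
  unfolding frequently_def
proof
  assume "\<forall>\<^sub>F t in at_top. \<not> F (v t / a) > exp (real N * t)"
  then have "\<forall>\<^sub>F t in at_top. F (v t / a) \<le> exp (real N * t)" by (simp add: not_less)
  then obtain t1 where t1: "\<And>t. t \<ge> t1 \<Longrightarrow> F (v t / a) \<le> exp (real N * t)"
    unfolding eventually_at_top_linorder by blast
  define t2 where "t2 = max t1 (T + 1)"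
  have t2: "t2 > T" "t2 \<ge> t1" by (auto simp: t2_def)
  \<comment> \<open>The rate left over when exp(a N t) is multiplied by exp(-N t).\<close>
  define m where "m = real N * (1 - a)"
  have m: "m > 0" using a N2 by (simp add: m_def)
  have f_le: "exp (- real N * t) * f (v t) \<le> c powr a * exp (- m * t)" if t: "t \<ge> t2" for t
  proof -
    have vt: "v t \<ge> 0" using v0[of t] t t2 by simp
    \<comment> \<open>The power inequality is applied with \<lambda> = 1 / a > 1; raising the result
      to the power a gives the bound on f(v).\<close>
    have "f (v t) powr (1 / a) \<le> c * f (1 / a * v t)" by (rule pb) (use a vt in auto)
    also have "\<dots> \<le> c * F (v t / a)" using f_le_F[of "v t / a"] vt a c by simp
    also have "\<dots> \<le> c * exp (real N * t)" using t1[of t] t t2 c by simp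
    finally have "(f (v t) powr (1 / a)) powr a \<le> (c * exp (real N * t)) powr a"
      using a by (intro powr_mono2) auto
    then have "f (v t) \<le> c powr a * exp (a * (real N * t))"
      using a c f0[OF vt] by (simp add: powr_powr powr_mult) (simp add: powr_def)
    then have "exp (- real N * t) * f (v t) \<le> exp (- real N * t) * (c powr a * exp (a * (real N * t)))"
      by (rule mult_left_mono) simp
    also have "\<dots> = c powr a * exp (- m * t)"
      by (simp add: m_def algebra_simps exp_add[symmetric])
    finally show ?thesis .
  qed
  define K where "K = c powr a / m"
  have K: "K > 0" using c m by (simp add: K_def)
  have y_le: "y t \<le> K * exp (- m * t)" if t: "t \<ge> t2" for t
  proof -
    \<comment> \<open>\<open>K\<close> is chosen so that the derivative of K exp(-m t) is -c^a
      exp(-m t), a lower bound for y'. Hence \<open>z\<close> is nondecreasing, and as it lies below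
      \<open>y\<close>, which tends to 0, it is nonpositive.\<close>
    define z where "z = (\<lambda>t. y t - K * exp (- m * t))"
    have zm: "z t \<le> z s" if s: "s \<ge> t" for s
    proof (rule DERIV_nonneg_imp_nondecreasing[OF s])
      fix r assume r: "t \<le> r" "r \<le> s"
      have "(z has_real_derivative - (exp (- real N * r) * f (v r)) - K * (- m * exp (- m * r))) (at r)"
        unfolding z_def using t t2 r by (auto intro!: derivative_eq_intros y')
      moreover have "K * (- m * exp (- m * r)) = - (c powr a * exp (- m * r))" using m by (simp add: K_def)
      then have "0 \<le> - (exp (- real N * r) * f (v r)) - K * (- m * exp (- m * r))" using f_le[of r] t r by linarith
      ultimately show "\<exists>d. (z has_real_derivative d) (at r) \<and> 0 \<le> d" by blast
    qed
    have "z t \<le> \<epsilon>" if \<epsilon>: "\<epsilon> > 0" for \<epsilon>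
    proof -
      obtain s where s: "y s < \<epsilon>" "t \<le> s"
        using eventually_happens'[OF _ eventually_conj[OF y_small[OF \<epsilon>] eventually_ge_at_top[of t]]] by auto
      have "z s \<le> y s" using K by (simp add: z_def)
      then show ?thesis using zm[OF s(2)] s(1) by simp
    qed
    then have "z t \<le> 0" by (rule field_le_epsilon[of "z t" 0, simplified])
    then show ?thesis by (simp add: z_def)
  qed
  define K2 where "K2 = flux_inv N K"
  \<comment> \<open>The decay rate of v', after taking the root of order N - 1.\<close>
  define l where "l = m / (real N - 1)"
  have l: "l > 0" using m N2 by (simp add: l_def)
  have K2: "K2 > 0" using K by (simp add: K2_def flux_inv_def)
  have v'_le: "flux_inv N (y t) \<le> K2 * exp (- l * t)" if "t \<ge> t2" for t
  proof -
    have "flux_inv N (y t) \<le> flux_inv N (K * exp (- m * t))" by (rule flux_inv_mono[OF N2 y_le[OF that]])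
    also have "\<dots> = K2 * exp (- l * t)"
      using K by (simp add: flux_inv_pos K2_def powr_mult) (simp add: powr_def l_def)
    finally show ?thesis .
  qed
  have "v t \<le> v t2 + K2 / l * exp (- l * t2)" if t: "t \<ge> t2" for t
  proof -
    have "v t + K2 / l * exp (- l * t) \<le> v t2 + K2 / l * exp (- l * t2)"
    proof (rule DERIV_nonpos_imp_nonincreasing[OF t])
      fix r assume r: "t2 \<le> r" "r \<le> t"
      have "((\<lambda>t. v t + K2 / l * exp (- l * t)) has_real_derivative flux_inv N (y r) + K2 / l * (- l * exp (- l * r))) (at r)"
        using t2 r by (auto intro!: derivative_eq_intros v')
      moreover have "K2 / l * (- l * exp (- l * r)) = - (K2 * exp (- l * r))" using l by simp
      then have "flux_inv N (y r) + K2 / l * (- l * exp (- l * r)) \<le> 0" using v'_le[OF r(1)] by linarith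
      ultimately show "\<exists>d. ((\<lambda>t. v t + K2 / l * exp (- l * t)) has_real_derivative d) (at r) \<and> d \<le> 0"
        by blast
    qed
    moreover have "K2 / l * exp (- l * t) \<ge> 0" using K2 l by simp
    ultimately show ?thesis by linarith
  qed
  then have "\<forall>\<^sub>F t in at_top. v t \<le> v t2 + K2 / l * exp (- l * t2)" by (rule eventually_at_top_linorderI)
  moreover have "\<forall>\<^sub>F t in at_top. v t > v t2 + K2 / l * exp (- l * t2)"
    using v_at_top unfolding filterlim_at_top_dense by blast
  ultimately have "\<forall>\<^sub>F t in (at_top :: real filter). False"
    by (rule eventually_elim2) simp
  then show False by simp
qed

end

section \<open>Crossings\<close>

lemma locally_Hoelder_continuous:
  assumes "locally_Hoelder f" shows "continuous_on {0..} f"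
  unfolding continuous_on_def
proof
  obtain \<theta> where \<theta>: "0 < \<theta>" "\<forall>K. compact K \<and> K \<subseteq> {0..} \<longrightarrow>
      (\<exists>C. \<forall>s\<in>K. \<forall>t\<in>K. \<bar>f s - f t\<bar> \<le> C * \<bar>s - t\<bar> powr \<theta>)"
    using assms unfolding locally_Hoelder_def by (elim exE conjE) (rule that)
  fix t :: real assume t: "t \<in> {0..}"
  obtain C where "\<forall>s\<in>{0..t+1}. \<forall>r\<in>{0..t+1}. \<bar>f s - f r\<bar> \<le> C * \<bar>s - r\<bar> powr \<theta>"
    using \<theta>(2)[rule_format, of "{0..t+1}"] by auto
  then have C: "\<bar>f s - f r\<bar> \<le> C * \<bar>s - r\<bar> powr \<theta>" if "s \<in> {0..t+1}" "r \<in> {0..t+1}" for s r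
    using that by blast
  have "((\<lambda>s. C * \<bar>s - t\<bar> powr \<theta>) \<longlongrightarrow> C * \<bar>t - t\<bar> powr \<theta>) (at t within {0..})"
    by (intro tendsto_intros tendsto_powr') (use \<theta>(1) in auto)
  then have lim: "((\<lambda>s. C * \<bar>s - t\<bar> powr \<theta>) \<longlongrightarrow> 0) (at t within {0..})" by simp
  have "\<forall>\<^sub>F s in at t within {0..}. s < t + 1"
    by (rule order_tendstoD(2)[OF tendsto_ident_at]) simp
  moreover have "\<forall>\<^sub>F s in at t within {0..}. s \<in> {0..}" by (simp add: eventually_at_filter)
  ultimately have "\<forall>\<^sub>F s in at t within {0..}. norm (f s - f t) \<le> C * \<bar>s - t\<bar> powr \<theta>"
    by eventually_elim (use C t in simp)
  from Lim_null_comparison[OF this lim] show "(f \<longlongrightarrow> f t) (at t within {0..})"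
    by (simp add: LIM_zero_iff)
qed

lemma alternating_sequence:
  fixes D :: "real \<Rightarrow> real"
  assumes pos: "\<And>t. \<exists>s>t. D s > 0" and neg: "\<And>t. \<exists>s>t. D s < 0"
  obtains \<tau> :: "nat \<Rightarrow> real" where "strict_mono \<tau>" "\<tau> 0 > t0" "\<And>i. D (\<tau> i) * D (\<tau> (Suc i)) < 0"
proof -
  obtain P where P: "\<And>t. P t > t" "\<And>t. D (P t) > 0" using pos by metis
  obtain Q where Q: "\<And>t. Q t > t" "\<And>t. D (Q t) < 0" using neg by metis
  define \<tau> where "\<tau> = rec_nat (P t0) (\<lambda>i t. if even i then Q t else P t)"
  have s: "\<tau> 0 = P t0" "\<And>i. \<tau> (Suc i) = (if even i then Q (\<tau> i) else P (\<tau> i))" by (simp_all add: \<tau>_def)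
  have sg: "if even i then D (\<tau> i) > 0 else D (\<tau> i) < 0" for i
    by (cases i) (auto simp: s P Q)
  have "strict_mono \<tau>" unfolding strict_mono_Suc_iff using P Q by (simp add: s)
  moreover have "D (\<tau> i) * D (\<tau> (Suc i)) < 0" for i
    using sg[of i] sg[of "Suc i"] by (cases "even i") (auto simp: mult_less_0_iff)
  ultimately show ?thesis using that s(1) P(1) by metis
qed

lemma changes_sign_exp:
  assumes "\<And>t. \<exists>s>t. d (exp (- s)) > 0" "\<And>t. \<exists>s>t. d (exp (- s)) < 0"
    and I: "\<And>t. t \<ge> t0 \<Longrightarrow> exp (- t) \<in> I"
  shows "changes_sign_infinitely_often I d"
  unfolding changes_sign_infinitely_often_def
proof
  fix n :: nat
  obtain \<tau> :: "nat \<Rightarrow> real" where \<tau>: "strict_mono \<tau>" "\<tau> 0 > t0"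
    "\<And>i. d (exp (- \<tau> i)) * d (exp (- \<tau> (Suc i))) < 0"
    by (rule alternating_sequence[where D = "\<lambda>s. d (exp (- s))" and ?t0.0 = t0, OF assms(1,2)]) (rule that)
  \<comment> \<open>Increasing times are decreasing radii, so the chain is read backwards. This
    requires finite chains, as the radii accumulate at 0.\<close>
  define r where "r = (\<lambda>i. exp (- \<tau> (n - i)))"
  have "strict_mono_on {..n} r"
    by (rule strict_mono_onI) (auto simp: r_def intro!: strict_monoD[OF \<tau>(1)])
  moreover have "r ` {..n} \<subseteq> I"
  proof -
    have "\<tau> i \<ge> t0" for i using \<tau>(2) strict_mono_leD[OF \<tau>(1), of 0 i] by simp
    then show ?thesis using I by (auto simp: r_def)
  qed
  moreover have "d (r i) * d (r (Suc i)) < 0" if "i < n" for i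
    using \<tau>(3)[of "n - Suc i"] that by (simp add: r_def Suc_diff_Suc mult.commute)
  ultimately show "\<exists>r. strict_mono_on {..n} r \<and> r ` {..n} \<subseteq> I \<and> (\<forall>i<n. d (r i) * d (r (Suc i)) < 0)"
    by blast
qed

theorem corollary6p2:
  fixes f F :: "real \<Rightarrow> real" and u :: "real^'n \<Rightarrow> real" and R \<kappa> c :: real
  assumes dim: "CARD('n) \<ge> 2"
    and R_pos: "R > 0"
    and f_nonneg: "\<forall>t\<ge>0. 0 \<le> f t"
    and f1: "locally_Hoelder f"
    and f2: "Liminf at_top (\<lambda>t. ereal (f t * t powr (1 - real CARD('n)))) > 0"
    and f3: "\<exists>k>0. mono_on {0..} (\<lambda>t. f t + k * t ^ (CARD('n) - 1))"
    and super: "super_exponential f"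
    and kappa: "\<kappa> \<ge> 0"
    and F: "\<forall>t\<ge>0. F t = f t + \<kappa> * t ^ (CARD('n) - 1)"
    and F_strict: "strict_mono_on {0..} F"
    and c_pos: "c > 0"
    and power_bound: "\<forall>l t. l > 1 \<and> t \<ge> 0 \<longrightarrow> f t powr l \<le> c * f (l * t)"
    and sol: "solution f R u"
    and unbounded: "\<not> bounded (u ` (ball 0 R - {0}))"
  shows "((\<lambda>x. u x / inv_into {0..} F (norm x powr - real CARD('n))) \<longlongrightarrow> 1) (at 0) \<or>
    (\<exists>c'. 0 < c' \<and> c' < 1 \<and>
       (\<forall>a. c' < a \<and> a < 1 \<longrightarrow>
          crosses_infinitely_often (admissible_radii CARD('n) R F) u
            (\<lambda>r. a * inv_into {0..} F (r powr - real CARD('n)))))"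
proof -
  let ?\<Omega> = "ball 0 R - {0::real^'n}" and ?N = "CARD('n)"
  have fc: "continuous_on {0..} f" by (rule locally_Hoelder_continuous[OF f1])
  obtain e0 :: "real^'n" where e0: "norm e0 = 1" using norm_axis_1 by blast
  define U where "U = (\<lambda>r. u (r *\<^sub>R e0))"
  have uc: "continuous_on ?\<Omega> u" and radial: "radial_on ?\<Omega> u" and u0: "\<And>x. x \<in> ?\<Omega> \<Longrightarrow> 0 \<le> u x"
    using sol unfolding solution_def Let_def by blast+
  have ray: "r *\<^sub>R e \<in> ?\<Omega>" if "r \<in> {0<..<R}" "norm e = 1" for r and e :: "real^'n"
    using that by auto
  have uU: "u x = U (norm x)" if x: "x \<in> ?\<Omega>" for x
  proof -
    have "norm x *\<^sub>R e0 \<in> ?\<Omega>" using x e0 by (intro ray) auto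
    then show ?thesis using radial x e0 unfolding radial_on_def U_def by auto
  qed
  have Ue: "u (r *\<^sub>R e) = U r" if "r \<in> {0<..<R}" "norm e = 1" for r and e :: "real^'n"
    using uU[OF ray[OF that]] that by simp
  have Uc: "continuous_on {0<..<R} U"
    unfolding U_def by (rule continuous_on_compose2[OF uc]) (use e0 in \<open>auto intro!: continuous_intros\<close>)
  have U0: "0 \<le> U r" if "r \<in> {0<..<R}" for r
    unfolding U_def by (rule u0[OF ray[OF that e0]])
  obtain w where w: "\<And>t. t \<in> {0<..<R} \<Longrightarrow> (U has_real_derivative flux_inv ?N (w t) / t) (at t)"
    "\<And>t. t \<in> {0<..<R} \<Longrightarrow> (w has_real_derivative - (t ^ (?N - 1) * f (U t))) (at t)"
    by (rule solution_ode[OF dim fc sol uU Uc U0]) (assumption+, rule that)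
  \<comment> \<open>The times t > T correspond to the radii below R.\<close>
  define T where "T = - ln R"
  have rad: "exp (- t) \<in> {0<..<R}" if "t > T" for t
  proof -
    have "exp (- t) < exp (ln R)" using that by (simp add: T_def)
    then show ?thesis using R_pos by simp
  qed
  \<comment> \<open>With r = exp(-t) one has d/dt = -r d/dr: the factor r cancels the division in
    the equation for U', and the sign is moved into \<open>y\<close>.\<close>
  define v y where "v = (\<lambda>t. U (exp (- t)))" and "y = (\<lambda>t. - w (exp (- t)))"
  interpret log_radial_ode ?N f F v y c \<kappa> T
  proof
    show "0 \<le> v t" if "t > T" for t unfolding v_def by (rule U0[OF rad[OF that]])
    show "(v has_real_derivative flux_inv ?N (y t)) (at t)" if "t > T" for t
    proof -
      have "((\<lambda>t. exp (- t)) has_real_derivative - exp (- t)) (at t)" by (auto intro!: derivative_eq_intros)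
      from DERIV_chain2[OF w(1)[OF rad[OF that]] this]
      have "(v has_real_derivative - flux_inv ?N (w (exp (- t)))) (at t)" by (simp add: v_def)
      then show ?thesis by (simp add: y_def flux_inv_def sgn_minus)
    qed
    show "(y has_real_derivative - (exp (- real ?N * t) * f (v t))) (at t)" if "t > T" for t
    proof -
      have "((\<lambda>t. exp (- t)) has_real_derivative - exp (- t)) (at t)" by (auto intro!: derivative_eq_intros)
      from DERIV_minus[OF DERIV_chain2[OF w(2)[OF rad[OF that]] this]]
      have "(y has_real_derivative - (exp (- t) ^ (?N - 1) * exp (- t) * f (v t))) (at t)"
        by (simp add: v_def y_def mult_ac)
      also have "exp (- t) ^ (?N - 1) * exp (- t) = exp (- t) ^ ?N"
        using dim by (simp add: power_Suc2[symmetric] del: power_Suc)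
      also have "\<dots> = exp (- real ?N * t)" by (simp add: exp_of_nat_mult[symmetric])
      finally show ?thesis .
    qed
    show "\<exists>t>T. v t > M" for M
    proof (rule ccontr)
      assume "\<not> (\<exists>t>T. v t > M)"
      then have le: "v t \<le> M" if "t > T" for t using that by (meson not_less)
      have "norm (u x) \<le> M" if x: "x \<in> ?\<Omega>" for x
      proof -
        have "T < - ln (norm x)" using x R_pos by (auto simp: T_def)
        from le[OF this] have "u x \<le> M" using x uU[OF x] by (simp add: v_def)
        then show ?thesis using u0[OF x] by simp
      qed
      then have "bounded (u ` ?\<Omega>)" unfolding bounded_iff by blast
      with unbounded show False by simp
    qed
  qed (use dim f_nonneg super kappa F F_strict c_pos power_bound in auto)
  define G where "G = (\<lambda>t. inv_into {0..} F (exp (real ?N * t)))"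
  have powr_exp: "exp (- t) powr - real ?N = exp (real ?N * t)" for t by (simp add: powr_def)
  have F_inj: "inj_on F {0..}" using F_strict by (rule strict_mono_on_imp_inj_on)
  \<comment> \<open>\<open>inv_into\<close> acts as an inverse only on the range of
    \<open>F\<close>. That range is unbounded because F eventually exceeds exp, and the intermediate
    value theorem fills it.\<close>
  have F_surj: "\<exists>x\<ge>0. F x = s" if s: "s \<ge> F 0" for s
  proof -
    have "\<forall>\<^sub>F x in at_top. exp (1 * x) \<le> f x" by (rule f_lower) simp
    then have "\<forall>\<^sub>F x in at_top. 0 \<le> x \<and> s \<le> F x"
      using eventually_ge_at_top[of 0] eventually_ge_at_top[of s]
    proof eventually_elim
      case (elim x)
      have "s \<le> exp x" using elim(3) exp_ge_add_one_self[of x] by linarith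
      then show ?case using elim f_le_F[of x] by simp
    qed
    then obtain x where x: "0 \<le> x" "s \<le> F x" using eventually_happens' trivial_limit_at_top_linorder by blast
    have "continuous_on {0..x} (\<lambda>t. f t + \<kappa> * t ^ (?N - 1))"
      by (intro continuous_intros continuous_on_subset[OF fc]) auto
    then have "continuous_on {0..x} F"
      by (rule continuous_on_eq) (use F in auto)
    from IVT'[OF s x(2,1) this] show ?thesis by auto
  qed
  have G: "G t \<ge> 0" "F (G t) = exp (real ?N * t)" if "exp (real ?N * t) \<ge> F 0" for t
  proof -
    have "exp (real ?N * t) \<in> F ` {0..}" using F_surj[OF that] by force
    then show "G t \<ge> 0" "F (G t) = exp (real ?N * t)"
      unfolding G_def using inv_into_into[of "exp (real ?N * t)" F "{0..}"] f_inv_into_f[of "exp (real ?N * t)" F "{0..}"]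
      by auto
  qed
  have F_less: "F x < F z \<longleftrightarrow> x < z" if "x \<ge> 0" "z \<ge> 0" for x z
    using strict_mono_on_less[OF F_strict] that by simp
  \<comment> \<open>For t \<ge> t0 the radius is below R and exp(N t) > t > F(0), so
    \<open>G t\<close> is a true inverse value and is positive.\<close>
  define t0 where "t0 = max (T + 1) (F 0 + 1)"
  have large: "t > T" "exp (real ?N * t) > F 0" if "t \<ge> t0" for t
  proof -
    show "t > T" using that by (simp add: t0_def)
    have "t \<ge> 0" using that f0[of 0] f_le_F[of 0] by (simp add: t0_def)
    then have "t \<le> real ?N * t" using dim by (simp add: mult_le_cancel_right1)
    also have "\<dots> < exp (real ?N * t)" using exp_ge_add_one_self[of "real ?N * t"] by linarith
    finally show "exp (real ?N * t) > F 0" using that by (simp add: t0_def)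
  qed
  have G_pos: "G t > 0" if "t \<ge> t0" for t
    using G[of t] large(2)[OF that] F_less[of 0 "G t"] by simp
  define \<rho> where "\<rho> = (\<lambda>t. v t / G t)"
  have \<rho>_le: "\<forall>\<^sub>F t in at_top. \<rho> t \<le> 1"
    using eventually_F_le eventually_ge_at_top[of t0]
  proof eventually_elim
    case (elim t)
    then have "\<not> G t < v t"
      using F_less[of "G t" "v t"] G[of t] large[OF elim(2)] v0[of t] by simp
    then show ?case using G_pos[OF elim(2)] by (simp add: \<rho>_def)
  qed
  show ?thesis
  proof (cases "(\<rho> \<longlongrightarrow> 1) at_top")
    case True
    have "filterlim (\<lambda>x::real^'n. - ln (norm x)) at_top (at 0)"
    proof -
      have "filterlim (\<lambda>x::real^'n. norm x) (at_right 0) (at 0)"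
        unfolding filterlim_at by (auto intro!: tendsto_norm_zero tendsto_ident_at simp: eventually_at_filter)
      from filterlim_compose[OF ln_at_0 this] show ?thesis by (simp add: filterlim_uminus_at_top)
    qed
    from filterlim_compose[OF True this]
    have lim: "((\<lambda>x::real^'n. \<rho> (- ln (norm x))) \<longlongrightarrow> 1) (at 0)" .
    have "((\<lambda>x. u x / inv_into {0..} F (norm x powr - real ?N)) \<longlongrightarrow> 1) (at 0)"
    proof (rule Lim_transform_eventually[OF lim])
      have "\<forall>\<^sub>F x in at (0::real^'n). x \<in> ?\<Omega>"
        unfolding eventually_at using R_pos by (intro exI[of _ R]) auto
      then show "\<forall>\<^sub>F x in at 0. \<rho> (- ln (norm x)) = u x / inv_into {0..} F (norm x powr - real ?N)"
      proof eventually_elim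
        case (elim x)
        then have "norm x > 0" by auto
        then show ?case using uU[OF elim] powr_exp[of "- ln (norm x)"] by (simp add: \<rho>_def v_def G_def)
      qed
    qed
    then show ?thesis ..
  next
    case False
    \<comment> \<open>As \<rho> is eventually at most 1, convergence to 1 can fail only from
      below.\<close>
    have "\<exists>a0<1. \<not> (\<forall>\<^sub>F t in at_top. a0 < \<rho> t)"
    proof (rule ccontr)
      assume "\<not> (\<exists>a0<1. \<not> (\<forall>\<^sub>F t in at_top. a0 < \<rho> t))"
      then have "(\<rho> \<longlongrightarrow> 1) at_top"
        by (intro order_tendstoI) (auto intro: eventually_mono[OF \<rho>_le])
      with False show False ..
    qed
    then obtain a0 where a0: "a0 < 1" "\<exists>\<^sub>F t in at_top. \<rho> t \<le> a0"
      by (auto simp: frequently_def not_le)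
    \<comment> \<open>The level a0 may be 0; the maximum with 1/2 keeps the threshold strictly
      between 0 and 1.\<close>
    have "crosses_infinitely_often (admissible_radii ?N R F) u
        (\<lambda>r. a * inv_into {0..} F (r powr - real ?N))" if a: "max a0 (1/2) < a" "a < 1" for a
      unfolding crosses_infinitely_often_def
    proof (intro allI impI)
      fix e :: "real^'n" assume e: "norm e = 1"
      let ?d = "\<lambda>r. u (r *\<^sub>R e) - a * inv_into {0..} F (r powr - real ?N)"
      have d: "?d (exp (- t)) = v t - a * G t" if "t \<ge> t0" for t
        using Ue[OF rad[OF large(1)[OF that]] e] by (simp add: v_def G_def powr_exp)
      show "changes_sign_infinitely_often (admissible_radii ?N R F) ?d"
      proof (rule changes_sign_exp)
        fix t
        \<comment> \<open>Positive differences occur for every a below 1, independently of a0; only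
          the negative ones, further down, use the level a0.\<close>
        have "\<exists>\<^sub>F s in at_top. exp (real ?N * s) < F (v s / a)" by (rule frequently_F_gt) (use a in auto)
        then have "\<exists>\<^sub>F s in at_top. exp (real ?N * s) < F (v s / a) \<and> max t t0 < s"
          by (rule frequently_eventually_frequently) (rule eventually_gt_at_top)
        then obtain s where s: "exp (real ?N * s) < F (v s / a)" "max t t0 < s" by (rule frequentlyE) auto
        then have s0: "s \<ge> t0" by simp
        have "G s < v s / a"
          using F_less[of "G s" "v s / a"] G[of s] large[OF s0] s(1) v0[of s] a by simp
        then have "?d (exp (- s)) > 0" using a unfolding d[OF s0] by (simp add: field_simps)
        then show "\<exists>s>t. ?d (exp (- s)) > 0" using s(2) by auto
      next
        fix t
        have "\<exists>\<^sub>F s in at_top. \<rho> s \<le> a0 \<and> max t t0 < s"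
          by (rule frequently_eventually_frequently[OF a0(2)]) (rule eventually_gt_at_top)
        then obtain s where s: "\<rho> s \<le> a0" "max t t0 < s" by (rule frequentlyE) auto
        then have s0: "s \<ge> t0" by simp
        have "\<rho> s < a" using s(1) a by simp
        then have "?d (exp (- s)) < 0" using G_pos[OF s0] unfolding d[OF s0] by (simp add: \<rho>_def field_simps)
        then show "\<exists>s>t. ?d (exp (- s)) < 0" using s(2) by auto
      next
        show "exp (- t) \<in> admissible_radii ?N R F" if "t \<ge> t0" for t
          using large[OF that] rad[of t] by (simp add: admissible_radii_def powr_exp)
      qed
    qed
    then show ?thesis using a0(1) by (intro disjI2 exI[of _ "max a0 (1/2)"]) auto
  qed
qed

end
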